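(* Let $n\ge2$, $\sigma\in(0,1)$, and let $g=u^{\frac{4}{n-2\sigma}}g_{\mathbb{S}^n}$ with $0<u\in C^\infty(\mathbb{S}^n)$. For $w\in C(\mathbb{S}^n)$ put $$\mathcal{Q}_\sigma[w](y)=2^{-2\sigma}\beta(n,\sigma)\int_{\mathbb{S}^n}\frac{(1-|y|^2)^{2\sigma}}{|x-y|^{n+2\sigma}}\,w(x)\,dV_{g_{\mathbb{S}^n}}(x),\qquad y\in B_1.$$ Let $v\in C^\infty(\mathbb{S}^n)$, $U=\mathcal{Q}_\sigma[u]$, $V=\mathcal{Q}_\sigma[uv]$, $a=\frac{2-4\sigma}{n-2\sigma}$, $N(\sigma)=2^{1-2\sigma}\Gamma(1-\sigma)/\Gamma(\sigma)$, and let $\tilde g=U(y)^{\frac{4}{n-2\sigma}}|dy|^2$, a Riemannian metric on $\overline{B_1}$. Then $$\mathrm{div}_{\tilde g}\Big((1-|y|^2)^{1-2\sigma}\,U^{a}\,\nabla_{\tilde g}\frac{V}{U}\Big)=0\quad\text{in }B_1,$$ $$P_\sigma^g(v)(x)=\frac{2^{2\sigma-1}}{N(\sigma)}\,\mathcal{N}_{\tilde g}\frac{V}{U}(x)+R_\sigma^g(x)\,v(x)\quad\text{for }x\in\mathbb{S}^n,$$ where $$\mathcal{N}_{\tilde g}=\lim_{y\to x}(1-|y|^2)^{1-2\sigma}\,U(y)^{a}\,\frac{\partial}{\partial\nu_{\tilde g}}$$ is the conormal derivative associated with the divergence equation, the limit being understood along $y=\tau x$ with $\tau\nearrow1$.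
   Context: $B_1$ is the open unit ball of $\mathbb{R}^{n+1}$ and $\mathbb{S}^n=\partial B_1$, with round metric $g_{\mathbb{S}^n}$. $\partial/\partial\nu_{\tilde g}$ is the derivative in the outward (radial) direction normalized to have unit length with respect to $\tilde g$. The constant $\beta(n,\sigma)>0$ is determined by $\beta(n,\sigma)\int_{\mathbb{R}^n}\frac{x_{n+1}^{2\sigma}}{(|x'|^2+x_{n+1}^2)^{\frac{n+2\sigma}{2}}}\,dx'=1$ (the integral does not depend on $x_{n+1}>0$). $P_\sigma$ is the operator on $\mathbb{S}^n$ determined by $P_\sigma(Y^{(k)})=\frac{\Gamma(k+\frac n2+\sigma)}{\Gamma(k+\frac n2-\sigma)}Y^{(k)}$ for every spherical harmonic $Y^{(k)}$ of degree $k\ge0$. For $g=u^{\frac{4}{n-2\sigma}}g_{\mathbb{S}^n}$, $P_\sigma^g(\varphi)=u^{-\frac{n+2\sigma}{n-2\sigma}}P_\sigma(u\varphi)$ and $R_\sigma^g=P_\sigma^g(1)$. *)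

theory Defs
  imports "HOL-Analysis.Analysis"
begin

text \<open>
  The ambient space of the unit sphere of dimension \<open>n\<close> is \<open>real ^ 'm\<close> with \<open>CARD('m) = n + 1\<close>.
  Functions on the sphere are represented by functions on the ambient space; every notion below
  that takes such a function depends only on its values on \<open>sphere 0 1\<close>.
\<close>

section \<open>Smooth functions\<close>

definition partial_deriv :: "'m::finite \<Rightarrow> (real ^ 'm \<Rightarrow> real) \<Rightarrow> real ^ 'm \<Rightarrow> real" where
  "partial_deriv i f x = frechet_derivative f (at x) (axis i 1)"

text \<open>\<open>Ck_on k S f\<close> is meant for open \<open>S\<close> only.\<close>

primrec Ck_on :: "nat \<Rightarrow> (real ^ 'm::finite) set \<Rightarrow> (real ^ 'm \<Rightarrow> real) \<Rightarrow> bool" where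
  "Ck_on 0 S f \<longleftrightarrow> continuous_on S f"
| "Ck_on (Suc k) S f \<longleftrightarrow> f differentiable_on S \<and> (\<forall>i. Ck_on k S (partial_deriv i f))"

text \<open>Smoothness on the embedded submanifold \<open>sphere 0 1\<close>: existence of a smooth extension to an
  open neighbourhood.\<close>

definition smooth_on_sphere :: "(real ^ 'm::finite \<Rightarrow> real) \<Rightarrow> bool" where
  "smooth_on_sphere f \<longleftrightarrow>
     (\<exists>S F. open S \<and> sphere 0 1 \<subseteq> S \<and> (\<forall>k. Ck_on k S F) \<and> (\<forall>x\<in>sphere 0 1. F x = f x))"


section \<open>Volume measure of the round sphere\<close>

text \<open>The Riemannian volume of the unit sphere, given by polar coordinates
  \<open>dy = r ^ (CARD('m) - 1) dr dV(x)\<close>, \<open>y = r x\<close>: the volume of a subset of the sphere is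
  \<open>CARD('m)\<close> times the Lebesgue measure of the cone over it inside the unit ball. Note that
  \<open>sgn y = y /\<^sub>R norm y\<close> in a normed space.\<close>

definition sphere_measure :: "(real ^ 'm::finite) measure" where
  "sphere_measure = scale_measure (of_nat CARD('m))
     (distr (restrict_space lborel (ball 0 1 - {0})) (restrict_space borel (sphere 0 1)) sgn)"


section \<open>Spherical harmonics and the operators \<open>P\<^sub>\<sigma>\<close>\<close>

definition laplacian :: "(real ^ 'm::finite \<Rightarrow> real) \<Rightarrow> real ^ 'm \<Rightarrow> real" where
  "laplacian f x = (\<Sum>i\<in>UNIV. partial_deriv i (partial_deriv i f) x)"

text \<open>The spherical harmonics of degree \<open>k\<close> are the restrictions to the sphere of the homogeneous
  harmonic polynomials of degree \<open>k\<close>; a spherical harmonic is represented by that polynomial,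
  which it determines.\<close>

definition spherical_harmonics :: "nat \<Rightarrow> (real ^ 'm::finite \<Rightarrow> real) set" where
  "spherical_harmonics k =
     {p. real_polynomial_function p \<and> (\<forall>c x. p (c *\<^sub>R x) = c ^ k * p x) \<and> (\<forall>x. laplacian p x = 0)}"

text \<open>The degree \<open>k\<close> component of \<open>\<phi>\<close>: its \<open>L\<^sup>2\<close>-orthogonal projection to the
  (finite-dimensional) space of spherical harmonics of degree \<open>k\<close>.\<close>

definition harmonic_component ::
    "nat \<Rightarrow> (real ^ 'm::finite \<Rightarrow> real) \<Rightarrow> real ^ 'm \<Rightarrow> real" where
  "harmonic_component k \<phi> =
     (THE p. p \<in> spherical_harmonics k \<and>
        (\<forall>q\<in>spherical_harmonics k. (\<integral>x. (\<phi> x - p x) * q x \<partial>sphere_measure) = 0))"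

text \<open>The operator acting on spherical harmonics of degree \<open>k\<close> as multiplication by
  \<open>\<Gamma>(k + n/2 + \<sigma>) / \<Gamma>(k + n/2 - \<sigma>)\<close>, applied termwise to the expansion
  \<open>\<phi> = (\<Sum>k. harmonic_component k \<phi>)\<close> on the sphere. For smooth \<open>\<phi>\<close> the components decay faster than
  any power of \<open>k\<close>, so that the series converges absolutely and uniformly on the sphere.\<close>

definition P_op :: "nat \<Rightarrow> real \<Rightarrow> (real ^ 'm::finite \<Rightarrow> real) \<Rightarrow> real ^ 'm \<Rightarrow> real" where
  "P_op n \<sigma> \<phi> x =
     (\<Sum>k. Gamma (real k + real n / 2 + \<sigma>) / Gamma (real k + real n / 2 - \<sigma>)
            * harmonic_component k \<phi> x)"

text \<open>\<open>P\<^sub>\<sigma>\<^sup>g\<close> and \<open>R\<^sub>\<sigma>\<^sup>g\<close> for the metric \<open>g = u powr (4 / (n - 2\<sigma>))\<close> times the round metric; the metric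
  enters through \<open>u\<close>.\<close>

definition P_conf ::
    "nat \<Rightarrow> real \<Rightarrow> (real ^ 'm::finite \<Rightarrow> real) \<Rightarrow> (real ^ 'm \<Rightarrow> real) \<Rightarrow> real ^ 'm \<Rightarrow> real" where
  "P_conf n \<sigma> u \<phi> x =
     u x powr (- ((real n + 2 * \<sigma>) / (real n - 2 * \<sigma>))) * P_op n \<sigma> (\<lambda>z. u z * \<phi> z) x"

definition R_conf :: "nat \<Rightarrow> real \<Rightarrow> (real ^ 'm::finite \<Rightarrow> real) \<Rightarrow> real ^ 'm \<Rightarrow> real" where
  "R_conf n \<sigma> u x = P_conf n \<sigma> u (\<lambda>_. 1) x"


section \<open>The extension operator \<open>Q\<^sub>\<sigma>\<close>\<close>

text \<open>The integral is over the space of dimension \<open>n\<close>, represented as functions on \<open>{..<n}\<close> with the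
  product Lebesgue measure; \<open>t\<close> is the coordinate \<open>x\<^sub>n\<^sub>+\<^sub>1\<close>.\<close>

definition beta_const :: "nat \<Rightarrow> real \<Rightarrow> real" where
  "beta_const n \<sigma> =
     (THE b. \<forall>t>0. b * (\<integral>x. t powr (2 * \<sigma>) /
                 ((\<Sum>i<n. (x i)\<^sup>2) + t\<^sup>2) powr ((real n + 2 * \<sigma>) / 2)
              \<partial>(\<Pi>\<^sub>M i\<in>{..<n}. (lborel :: real measure))) = 1)"

definition Q_op :: "nat \<Rightarrow> real \<Rightarrow> (real ^ 'm::finite \<Rightarrow> real) \<Rightarrow> real ^ 'm \<Rightarrow> real" where
  "Q_op n \<sigma> w y =
     2 powr (- 2 * \<sigma>) * beta_const n \<sigma> *
       (\<integral>x. (1 - (norm y)\<^sup>2) powr (2 * \<sigma>) / norm (x - y) powr (real n + 2 * \<sigma>) * w x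
          \<partial>sphere_measure)"

definition N_const :: "real \<Rightarrow> real" where
  "N_const \<sigma> = 2 powr (1 - 2 * \<sigma>) * Gamma (1 - \<sigma>) / Gamma \<sigma>"


section \<open>Riemannian metrics on open subsets of the ambient space\<close>

text \<open>A metric assigns to each point a bilinear form on \<open>real ^ 'm\<close>, positive definite on the open
  set of interest.\<close>

type_synonym 'm metric_tensor = "real ^ 'm \<Rightarrow> real ^ 'm \<Rightarrow> real ^ 'm \<Rightarrow> real"

definition conf_flat :: "(real ^ 'm::finite \<Rightarrow> real) \<Rightarrow> 'm metric_tensor" where
  "conf_flat \<phi> y v w = \<phi> y * (v \<bullet> w)"

definition riem_grad ::
    "'m::finite metric_tensor \<Rightarrow> (real ^ 'm \<Rightarrow> real) \<Rightarrow> real ^ 'm \<Rightarrow> real ^ 'm" where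
  "riem_grad G f y = (THE w. \<forall>z. G y w z = frechet_derivative f (at y) z)"

definition vol_density :: "'m::finite metric_tensor \<Rightarrow> real ^ 'm \<Rightarrow> real" where
  "vol_density G y = sqrt (det (\<chi> i j. G y (axis i 1) (axis j 1)))"

definition riem_div ::
    "'m::finite metric_tensor \<Rightarrow> (real ^ 'm \<Rightarrow> real ^ 'm) \<Rightarrow> real ^ 'm \<Rightarrow> real" where
  "riem_div G X y =
     (\<Sum>i\<in>UNIV. partial_deriv i (\<lambda>z. vol_density G z * X z $ i) y) / vol_density G y"

text \<open>Derivative at \<open>y \<noteq> 0\<close> in the outward radial direction, normalized to unit length for \<open>G\<close>.\<close>

definition radial_deriv ::
    "'m::finite metric_tensor \<Rightarrow> (real ^ 'm \<Rightarrow> real) \<Rightarrow> real ^ 'm \<Rightarrow> real" where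
  "radial_deriv G f y = frechet_derivative f (at y) ((1 / sqrt (G y y y)) *\<^sub>R y)"

text \<open>\<open>has_conormal_deriv \<sigma> a U G f x L\<close>: the limit defining the conormal derivative of \<open>f\<close> at the
  boundary point \<open>x\<close> exists and equals \<open>L\<close>.\<close>

definition has_conormal_deriv ::
    "real \<Rightarrow> real \<Rightarrow> (real ^ 'm::finite \<Rightarrow> real) \<Rightarrow> 'm metric_tensor \<Rightarrow> (real ^ 'm \<Rightarrow> real)
       \<Rightarrow> real ^ 'm \<Rightarrow> real \<Rightarrow> bool" where
  "has_conormal_deriv \<sigma> a U G f x L \<longleftrightarrow>
     ((\<lambda>\<tau>. (1 - (norm (\<tau> *\<^sub>R x))\<^sup>2) powr (1 - 2 * \<sigma>) * U (\<tau> *\<^sub>R x) powr a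
             * radial_deriv G f (\<tau> *\<^sub>R x)) \<longlongrightarrow> L) (at_left 1)"

end

theory Submission
  imports Defs "HOL-Probability.Distributions" "HOL-Real_Asymp.Real_Asymp"
begin

text \<open>
  With \<open>\<alpha> = n / 2 + \<sigma> - 1\<close>, expanding in zonal harmonics (the Poisson kernel, integrated against a power
  weight in the radius, is a Riesz kernel) shows that \<open>P\<^sub>\<sigma>\<close> is, up to a constant, the Riesz potential
  with kernel \<open>\<bar>x - y\<bar> powr (- 2 * \<alpha>)\<close> composed with the second-order operator
  \<open>\<alpha> * (n - 1 - \<alpha>)\<close> minus the Laplacian of the sphere. On the other side, the function \<open>b\<close> of the radius with
  \<open>\<bar>x - \<tau> *\<^sub>R e\<bar>\<^sup>2 = 2 * \<tau> * (b - x \<bullet> e)\<close> turns the extension along a ray into a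
  singular integral \<open>(b\<^sup>2 - 1) powr \<sigma> * \<integral> (b - x \<bullet> e) powr (- n / 2 - \<sigma>) * w x\<close>, and Green's identity on
  the sphere expresses its derivative in \<open>b\<close> through the same operator with the milder kernel
  \<open>(b - x \<bullet> e) powr (- \<alpha>)\<close>. This kernel converges to the Riesz kernel as \<open>b\<close> tends to 1, so the conormal
  derivative of \<open>V / U\<close> is a Wronskian-type combination of \<open>P\<^sub>\<sigma> (u * v)\<close> and \<open>P\<^sub>\<sigma> u\<close>; the constants agree by
  Legendre's duplication formula. In the interior, \<open>U\<close> and \<open>V\<close> satisfy the same linear equation
  \<open>div ((1 - |y|\<^sup>2) powr (1 - 2 * \<sigma>) \<nabla>W) = (n - 2 * \<sigma>) * (1 - 2 * \<sigma>) * (1 - |y|\<^sup>2) powr (- 2 * \<sigma>) * W\<close>, so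
  \<open>(1 - |y|\<^sup>2) powr (1 - 2 * \<sigma>) (U \<nabla>V - V \<nabla>U)\<close> is divergence free, and the powers of \<open>U\<close> in the weight,
  the metric and the volume combine to exactly this field.
\<close>

section \<open>The surface measure of the sphere\<close>

text \<open>The kernel of \<open>P\<^sub>\<sigma>\<close> itself would be a multiple of |x - y|^(- n
  - 2 \<sigma>), which is not integrable on the sphere; this obstacle shapes the proof. Splitting
  off a second-order operator leaves the integrable exponent 2 \<alpha> = n + 2 \<sigma> - 2 < n,
  and the eigenvalues match because (k + \<alpha>) (k + n - 1 - \<alpha>) Beta(k + \<alpha>, 2 - 2
  \<sigma>) is \<Gamma>(2 - 2 \<sigma>) times the required Gamma quotient. Along a ray an extension
  is (2 \<tau>)^(\<sigma> - n / 2) times a function of b. The first factor is common to U and V and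
  cancels in V / U. For U alone its derivative would be a regular term that the weight (1 -
  |y|^2)^(1 - 2 \<sigma>) makes infinite when \<sigma> > 1/2; hence the conormal derivative of a
  quotient, whose second term becomes the curvature term. The singular kernel of the extension has a
  finite total mass in the limit. It is found from a symmetry between the exponents n / 2 + \<sigma>
  and n / 2 - \<sigma>, the second of which is integrable at b = 1.\<close>

lemma distr_lborel_orthogonal_transformation:
  fixes T :: "'a::euclidean_space \<Rightarrow> 'a"
  assumes T: "orthogonal_transformation T"
  shows "distr lborel borel T = lborel"
proof -
  have linT: "linear T" using T orthogonal_transformation_linear by blast
  have contT: "continuous_on UNIV T" using linT by (rule linear_continuous_on[OF linear_conv_bounded_linear[THEN iffD1]])
  then have mT[measurable]: "T \<in> borel_measurable borel" by (rule borel_measurable_continuous_onI)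
  define \<mu> where "\<mu> = distr lborel borel T"
  define B where "B = ball (0::'a) 1"
  have sets_mu[measurable_cong, simp]: "sets \<mu> = sets borel" "space \<mu> = UNIV" by (auto simp: \<mu>_def)
  have B: "B \<in> sets borel" by (simp add: B_def)
  then have iB[measurable]: "(indicator B :: 'a \<Rightarrow> ennreal) \<in> borel_measurable borel" by simp
  obtain T' where T': "orthogonal_transformation T'" "\<And>x. T (T' x) = x" "\<And>x. T' (T x) = x"
    using T orthogonal_transformation_inv orthogonal_transformation_surj orthogonal_transformation_inj
    by (metis inv_f_f surj_f_inv_f)
  have trans: "(\<integral>\<^sup>+x. f (x + y) \<partial>\<mu>) = (\<integral>\<^sup>+x. f x \<partial>\<mu>)" if [measurable]: "f \<in> borel_measurable borel" for f y
  proof -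
    have "(\<integral>\<^sup>+x. f x \<partial>\<mu>) = (\<integral>\<^sup>+x. f (T x) \<partial>distr lborel borel ((+) (T' y)))"
      unfolding lborel_distr_plus by (simp add: \<mu>_def nn_integral_distr)
    also have "\<dots> = (\<integral>\<^sup>+x. f (T x + y) \<partial>lborel)"
      by (subst nn_integral_distr) (auto simp: linear_add[OF linT] T' add.commute)
    finally show ?thesis by (simp add: \<mu>_def nn_integral_distr)
  qed
  have trans': "(\<integral>\<^sup>+x. f (x + y) \<partial>lborel) = (\<integral>\<^sup>+x. f x \<partial>lborel)" if [measurable]: "f \<in> borel_measurable borel" for f and y::'a
    by (subst lborel_distr_plus[of y, symmetric]) (simp add: nn_integral_distr add.commute)
  have muB: "emeasure \<mu> B = emeasure lborel B"
  proof -
    have "T -` B = B" using T by (auto simp: B_def orthogonal_transformation_norm)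
    then show ?thesis using B by (simp add: \<mu>_def emeasure_distr)
  qed
  have sfin: "sigma_finite_measure \<mu>"
  proof (rule sigma_finite_measure.intro, rule exI, intro conjI)
    show "countable (range (\<lambda>n. ball (0::'a) (real n)))" by simp
    show "range (\<lambda>n. ball (0::'a) (real n)) \<subseteq> sets \<mu>" by auto
    show "\<Union> (range (\<lambda>n. ball (0::'a) (real n))) = space \<mu>"
      by (auto simp: reals_Archimedean2)
    have "T -` ball 0 r = ball 0 r" for r using T by (auto simp: orthogonal_transformation_norm)
    then show "\<forall>a\<in>range (\<lambda>n. ball (0::'a) (real n)). emeasure \<mu> a \<noteq> \<infinity>"
      using emeasure_bounded_finite[OF bounded_ball, of "0::'a"] by (auto simp: \<mu>_def emeasure_distr less_top)
  qed
  interpret sm: sigma_finite_measure \<mu> by (rule sfin)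
  interpret P: pair_sigma_finite lborel \<mu> by unfold_locales
  have B0: "emeasure lborel B > 0" "emeasure lborel B < \<infinity>"
    unfolding B_def by (auto intro: emeasure_bounded_finite simp: emeasure_ball ennreal_mult_less_top)
  have ev: "indicator B (y - x) = (indicator B (x - y) :: ennreal)" for x y :: 'a
    by (simp add: B_def indicator_def norm_minus_commute)
  show ?thesis unfolding \<mu>_def[symmetric]
  proof (rule measure_eqI)
    fix A assume "A \<in> sets \<mu>" then have A: "A \<in> sets borel" by simp
    then have iA[measurable]: "(indicator A :: 'a \<Rightarrow> ennreal) \<in> borel_measurable borel" by simp
    have m1: "(\<lambda>(x,y). indicator B x * indicator A (y + x) :: ennreal) \<in> borel_measurable (lborel \<Otimes>\<^sub>M \<mu>)"
      by measurable
    have m2: "(\<lambda>(x,y). indicator B (x - y) * indicator A x :: ennreal) \<in> borel_measurable (lborel \<Otimes>\<^sub>M \<mu>)"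
      by measurable
    \<comment> \<open>Uniqueness of a translation invariant measure by double counting: the product
      of the two masses is rewritten by Fubini, translating each measure once and reflecting the
      ball B in between. An isometry leaves the mass of B unchanged, so B can be cancelled.\<close>
    have "emeasure lborel B * emeasure \<mu> A = (\<integral>\<^sup>+x. indicator B x * emeasure \<mu> A \<partial>lborel)"
      using B by (simp add: nn_integral_multc)
    also have "\<dots> = (\<integral>\<^sup>+x. (\<integral>\<^sup>+y. indicator B x * indicator A (y + x) \<partial>\<mu>) \<partial>lborel)"
      using trans[OF iA] A by (subst nn_integral_cmult) auto
    also have "\<dots> = (\<integral>\<^sup>+y. (\<integral>\<^sup>+x. indicator B x * indicator A (y + x) \<partial>lborel) \<partial>\<mu>)"
      using P.Fubini[OF m1] by simp
    also have "\<dots> = (\<integral>\<^sup>+y. (\<integral>\<^sup>+x. indicator B (x - y) * indicator A x \<partial>lborel) \<partial>\<mu>)"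
    proof (rule nn_integral_cong)
      fix y
      have "(\<lambda>x. indicator B (x - y) * indicator A x :: ennreal) \<in> borel_measurable borel" by measurable
      from trans'[OF this, of y]
      show "(\<integral>\<^sup>+x. indicator B x * indicator A (y + x) \<partial>lborel) = (\<integral>\<^sup>+x. indicator B (x - y) * indicator A x \<partial>lborel)"
        by (simp add: add.commute)
    qed
    also have "\<dots> = (\<integral>\<^sup>+x. (\<integral>\<^sup>+y. indicator B (x - y) * indicator A x \<partial>\<mu>) \<partial>lborel)"
      using P.Fubini[OF m2] by simp
    also have "\<dots> = (\<integral>\<^sup>+x. (\<integral>\<^sup>+y. indicator B (y - x) \<partial>\<mu>) * indicator A x \<partial>lborel)"
      by (subst nn_integral_multc) (auto simp: ev)
    also have "\<dots> = (\<integral>\<^sup>+x. emeasure lborel B * indicator A x \<partial>lborel)"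
      using trans[of "indicator B" "- x" for x] muB B by simp
    also have "\<dots> = emeasure lborel B * emeasure lborel A" using A by (simp add: nn_integral_cmult)
    finally show "emeasure \<mu> A = emeasure lborel A"
      using B0 by (auto simp: ennreal_mult_cancel_left)
  qed simp
qed

lemma sgn_measurable_sphere:
  "sgn \<in> measurable (restrict_space lborel (ball 0 1 - {0 :: 'a::euclidean_space})) (restrict_space borel (sphere 0 1))"
proof (rule measurable_restrict_space2)
  show "sgn \<in> space (restrict_space lborel (ball 0 1 - {0 :: 'a})) \<rightarrow> sphere 0 1"
    by (auto simp: space_restrict_space norm_sgn)
  show "sgn \<in> borel_measurable (restrict_space lborel (ball 0 1 - {0 :: 'a}))"
    by (rule measurable_restrict_space1) measurable
qed

text \<open>Scaling is rewritten as a constant density, so that the rules for integrals and null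
  sets of densities apply.\<close>

lemma sphere_measure_eq_density:
  "(sphere_measure :: (real^'m::finite) measure)
     = density (distr (restrict_space lborel (ball 0 1 - {0})) (restrict_space borel (sphere 0 1)) sgn)
         (\<lambda>_. ennreal (real CARD('m)))"
  unfolding sphere_measure_def
  by (rule measure_eqI) (auto simp: emeasure_density_const ennreal_of_nat_eq_real_of_nat)

lemma space_sphere_measure [simp]: "space (sphere_measure :: (real^'m::finite) measure) = sphere 0 1"
  by (simp add: sphere_measure_def space_scale_measure space_restrict_space)

lemma sets_sphere_measure [measurable_cong]:
  "sets (sphere_measure :: (real^'m::finite) measure) = sets (restrict_space borel (sphere 0 1))"
  by (simp add: sphere_measure_def)

lemma emeasure_sphere_measure_space:
  "emeasure (sphere_measure :: (real^'m::finite) measure) (sphere 0 1)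
     = ennreal (CARD('m) * unit_ball_vol CARD('m))"
proof -
  have 1: "sphere (0::real^'m) 1 \<in> sets (restrict_space borel (sphere 0 1))"
    by (simp add: sets_restrict_space_iff)
  have "sgn -` sphere 0 1 \<inter> (ball 0 1 - {0}) = ball 0 1 - {0 :: real^'m}"
    by (auto simp: norm_sgn)
  then have "emeasure (sphere_measure :: (real^'m) measure) (sphere 0 1)
      = of_nat CARD('m) * emeasure lborel (ball 0 1 - {0 :: real^'m})"
    unfolding sphere_measure_def emeasure_scale_measure emeasure_distr[OF sgn_measurable_sphere 1]
    by (simp add: space_restrict_space emeasure_restrict_space)
  also have "emeasure lborel (ball 0 1 - {0 :: real^'m}) = emeasure lborel (ball (0::real^'m) 1)"
    by (rule emeasure_Diff_null_set) auto
  finally show ?thesis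
    by (simp add: emeasure_ball ennreal_mult' flip: ennreal_of_nat_eq_real_of_nat)
qed

interpretation sphere_measure: finite_measure "sphere_measure :: (real^'m::finite) measure"
  by (rule finite_measureI) (simp add: emeasure_sphere_measure_space)

lemma borel_measurable_sphere_measure_continuous:
  "continuous_on (sphere 0 1) f \<Longrightarrow> f \<in> borel_measurable (sphere_measure :: (real^'m::finite) measure)"
  for f :: "real^'m::finite \<Rightarrow> 'b::topological_space"
  using borel_measurable_continuous_on_restrict measurable_cong_sets[OF sets_sphere_measure refl]
  by blast

lemma integrable_sphere_continuous:
  fixes f :: "real^'m::finite \<Rightarrow> 'b::{banach,second_countable_topology}"
  assumes "continuous_on (sphere 0 1) f"
  shows "integrable sphere_measure f"
proof -
  have "bounded (f ` sphere 0 1)"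
    using assms by (intro compact_imp_bounded compact_continuous_image) auto
  then obtain B where "\<And>x. x \<in> sphere 0 1 \<Longrightarrow> norm (f x) \<le> B" unfolding bounded_iff by blast
  then show ?thesis
    by (intro sphere_measure.integrable_const_bound[of _ B] AE_I2)
       (auto intro: borel_measurable_sphere_measure_continuous assms)
qed

lemma integral_sphere_measure:
  fixes f :: "real^'m::finite \<Rightarrow> 'b::{banach,second_countable_topology}"
  assumes [measurable]: "f \<in> borel_measurable sphere_measure"
  shows "(\<integral>x. f x \<partial>sphere_measure)
    = real CARD('m) *\<^sub>R (\<integral>y. indicator (ball 0 1 - {0}) y *\<^sub>R f (sgn y) \<partial>lborel)"
proof -
  have m: "f \<in> borel_measurable (restrict_space borel (sphere 0 1))"
    using assms measurable_cong_sets[OF sets_sphere_measure refl] by blast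
  have "(\<integral>x. f x \<partial>sphere_measure) = real CARD('m) *\<^sub>R
     (\<integral>x. f x \<partial>distr (restrict_space lborel (ball 0 1 - {0 :: real^'m})) (restrict_space borel (sphere 0 1)) sgn)"
    unfolding sphere_measure_eq_density by (subst integral_density) (auto simp: m)
  also have "(\<integral>x. f x \<partial>distr (restrict_space lborel (ball 0 1 - {0 :: real^'m})) (restrict_space borel (sphere 0 1)) sgn)
     = (\<integral>y. f (sgn y) \<partial>restrict_space lborel (ball 0 1 - {0}))"
    by (rule integral_distr[OF sgn_measurable_sphere m])
  also have "\<dots> = (\<integral>y. indicator (ball 0 1 - {0}) y *\<^sub>R f (sgn y) \<partial>lborel)"
    by (rule integral_restrict_space) auto
  finally show ?thesis .
qed

text \<open>T preserves the punctured ball and commutes with \<open>sgn\<close>, so the claim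
  reduces to invariance of Lebesgue measure. Integration by parts on the sphere rests on this
  invariance.\<close>

lemma integral_sphere_orthogonal_transformation:
  fixes f :: "real^'m::finite \<Rightarrow> real" and T :: "real^'m \<Rightarrow> real^'m"
  assumes T: "orthogonal_transformation T" and cf: "continuous_on (sphere 0 1) f"
  shows "(\<integral>x. f (T x) \<partial>sphere_measure) = (\<integral>x. f x \<partial>sphere_measure)"
proof -
  have linT: "linear T" using T orthogonal_transformation_linear by blast
  have contT: "continuous_on UNIV T" using linT by (rule linear_continuous_on[OF linear_conv_bounded_linear[THEN iffD1]])
  then have mT[measurable]: "T \<in> borel_measurable borel" by (rule borel_measurable_continuous_onI)
  have nT: "norm (T x) = norm x" for x using T by (simp add: orthogonal_transformation_norm)
  have cfT: "continuous_on (sphere 0 1) (\<lambda>x. f (T x))"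
    by (rule continuous_on_compose2[OF cf continuous_on_subset[OF contT]]) (auto simp: nT)
  have sgnT: "sgn (T y) = T (sgn y)" for y by (simp add: sgn_div_norm nT linear_cmul[OF linT])
  have m: "(\<lambda>y. indicator (ball 0 1 - {0}) y *\<^sub>R f (sgn y)) \<in> borel_measurable borel"
  proof -
    have "(\<lambda>y. f (sgn y)) \<in> borel_measurable (restrict_space lborel (ball 0 1 - {0 :: real^'m}))"
      using measurable_comp[OF sgn_measurable_sphere borel_measurable_continuous_on_restrict[OF cf]]
      by (simp add: comp_def)
    then show ?thesis by (subst (asm) borel_measurable_restrict_space_iff) auto
  qed
  have T0: "T x = 0 \<longleftrightarrow> x = 0" for x using nT[of x] by (metis norm_eq_zero)
  have ind: "indicator (ball 0 1 - {0}) (T y) = (indicator (ball 0 1 - {0}) y :: real)" for y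
    by (auto simp: indicator_def nT T0)
  have "(\<integral>y. indicator (ball 0 1 - {0}) y *\<^sub>R f (sgn y) \<partial>lborel)
      = (\<integral>y. indicator (ball 0 1 - {0}) y *\<^sub>R f (sgn y) \<partial>distr lborel borel T)"
    by (simp add: distr_lborel_orthogonal_transformation[OF T])
  also have "\<dots> = (\<integral>y. indicator (ball 0 1 - {0}) y *\<^sub>R f (T (sgn y)) \<partial>lborel)"
    by (subst integral_distr) (use m in \<open>auto simp: ind sgnT\<close>)
  finally show ?thesis
    by (simp add: integral_sphere_measure borel_measurable_sphere_measure_continuous cf cfT)
qed

text \<open>Pulled back to the ball, the set where f is nonzero is open and Lebesgue null, hence
  empty. The pointwise conclusion yields uniqueness of harmonic projections and strict positivity of
  the extension.\<close>

lemma integral_sphere_eq_0_iff: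
  fixes f :: "real^'m::finite \<Rightarrow> real"
  assumes cf: "continuous_on (sphere 0 1) f" and nn: "\<And>x. x \<in> sphere 0 1 \<Longrightarrow> 0 \<le> f x"
    and 0: "(\<integral>x. f x \<partial>sphere_measure) = 0" and x: "x \<in> sphere 0 1"
  shows "f x = 0"
proof -
  define M where "M = restrict_space lborel (ball 0 1 - {0 :: real^'m})"
  have mf: "f \<in> borel_measurable (restrict_space borel (sphere 0 1))"
    by (rule borel_measurable_continuous_on_restrict[OF cf])
  have "AE x in sphere_measure. f x = 0"
    using 0 by (subst (asm) integral_nonneg_eq_0_iff_AE)
      (auto intro!: integrable_sphere_continuous cf AE_I2 nn)
  then have "AE x in distr M (restrict_space borel (sphere 0 1)) sgn. f x = 0"
    unfolding sphere_measure_eq_density M_def[symmetric] by (subst (asm) AE_density) auto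
  then have "AE y in M. f (sgn y) = 0"
    by (rule AE_distrD[OF sgn_measurable_sphere[where 'a="real^'m", folded M_def]])
  then have "AE y in lborel. y \<in> ball 0 1 - {0} \<longrightarrow> f (sgn y) = 0"
    unfolding M_def by (subst (asm) AE_restrict_space_iff) auto
  moreover define W where "W = {y \<in> ball 0 1 - {0}. f (sgn y) \<noteq> 0}"
  have cfs: "continuous_on (ball 0 1 - {0}) (\<lambda>y. f (sgn y))"
  proof (rule continuous_on_compose2[OF cf])
    show "continuous_on (ball 0 1 - {0}) (sgn :: real^'m \<Rightarrow> real^'m)"
      unfolding sgn_div_norm[abs_def] by (auto intro!: continuous_intros)
  qed (auto simp: norm_sgn split: if_splits)
  have oW: "open W"
  proof -
    have "W = (ball 0 1 - {0}) \<inter> (\<lambda>y. f (sgn y)) -` (- {0})" by (auto simp: W_def)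
    then show ?thesis using continuous_open_preimage[OF cfs, of "- {0}"] by auto
  qed
  ultimately have "AE y in lborel. y \<notin> W" unfolding W_def by auto
  then have "emeasure lborel W = 0"
    using oW by (subst (asm) AE_iff_measurable[of W]) auto
  then have "negligible W" 
    using oW by (simp add: negligible_iff_null_sets null_sets_def)
  then have "W = {}" using oW open_not_negligible by blast
  \<comment> \<open>A point of the punctured ball on the ray over x, which \<open>sgn\<close> sends
    back to x.\<close>
  moreover have "(1/2) *\<^sub>R x \<in> ball 0 1 - {0}" "sgn ((1/2) *\<^sub>R x) = x"
    using x by (auto simp: sgn_div_norm)
  ultimately show ?thesis unfolding W_def by (metis (mono_tags, lifting) empty_iff mem_Collect_eq)
qed

text \<open>The gradient is uniformly continuous on a compact ball times the sphere, so the mean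
  value inequality bounds the linearisation error uniformly in x, and the bound integrates. The
  parameter space is an arbitrary Euclidean space because the rule is applied to rotation angles, to
  the real parameter b and to points y.\<close>

lemma has_derivative_integral_sphere:
  fixes f :: "'a::euclidean_space \<Rightarrow> real^'m::finite \<Rightarrow> real"
  assumes S: "open S" and y: "y \<in> S"
    and cf: "\<And>y. y \<in> S \<Longrightarrow> continuous_on (sphere 0 1) (f y)"
    and der: "\<And>y x. y \<in> S \<Longrightarrow> x \<in> sphere 0 1 \<Longrightarrow> ((\<lambda>y. f y x) has_derivative (\<lambda>h. g y x \<bullet> h)) (at y)"
    and cg: "continuous_on (S \<times> sphere 0 1) (\<lambda>(y,x). g y x)"
  shows "((\<lambda>y. \<integral>x. f y x \<partial>sphere_measure) has_derivative (\<lambda>h. (\<integral>x. g y x \<partial>sphere_measure) \<bullet> h)) (at y)"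
proof -
  obtain r where r: "r > 0" "cball y r \<subseteq> S" using S y open_contains_cball by blast
  have cgx: "continuous_on (sphere 0 1) (g y)" if "y \<in> S" for y
    using continuous_on_compose2[OF cg, of "sphere 0 1" "\<lambda>x. (y,x)"] that
      continuous_on_Pair[OF continuous_on_const continuous_on_id, of "sphere 0 1" y] by auto
  have uc: "uniformly_continuous_on (cball y r \<times> sphere 0 1) (\<lambda>(y,x). g y x)"
    using r by (intro compact_uniformly_continuous continuous_on_subset[OF cg] compact_Times) auto
  note if_ = integrable_sphere_continuous[OF cf] and ig = integrable_sphere_continuous[OF cgx]
  define \<omega> where "\<omega> = measure (sphere_measure :: (real^'m) measure) (sphere 0 1)"
  have \<omega>: "\<omega> \<ge> 0" by (simp add: \<omega>_def)
  show ?thesis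
    unfolding has_derivative_at_alt
  proof (intro conjI allI impI)
    show "bounded_linear (\<lambda>h. (\<integral>x. g y x \<partial>sphere_measure) \<bullet> h)" by (rule bounded_linear_inner_right)
    fix e :: real assume e: "e > 0"
    \<comment> \<open>Adding 1 keeps the denominator positive whatever the total mass
      \<omega>.\<close>
    define e' where "e' = e / (\<omega> + 1)"
    have e': "e' > 0" using e \<omega> by (simp add: e'_def)
    obtain d where d: "d > 0" "\<And>p q. p \<in> cball y r \<times> sphere 0 1 \<Longrightarrow> q \<in> cball y r \<times> sphere 0 1 \<Longrightarrow> dist q p < d
        \<Longrightarrow> dist (case q of (y,x) \<Rightarrow> g y x) (case p of (y,x) \<Rightarrow> g y x) < e'"
      using uc e' unfolding uniformly_continuous_on_def by metis
    have key: "norm (f z x - f y x - g y x \<bullet> (z - y)) \<le> norm (z - y) * e'"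
      if z: "norm (z - y) < min d r" and x: "x \<in> sphere 0 1" for z x
    proof -
      define S' where "S' = ball y (min d r)"
      have S': "S' \<subseteq> cball y r" "S' \<subseteq> S" using r by (auto simp: S'_def)
      have yS: "y \<in> S'" "z \<in> S'" using z d r by (auto simp: S'_def dist_norm norm_minus_commute)
      have seg: "y + t *\<^sub>R (z - y) \<in> S'" if "t \<in> {0..1}" for t
      proof -
        have "convex S'" by (simp add: S'_def)
        then show ?thesis using yS that unfolding convex_alt
          by (metis (no_types, opaque_lifting) add.commute atLeastAtMost_iff diff_add_eq scaleR_diff_left scaleR_diff_right scaleR_one add_diff_eq)
      qed
      have "onorm (\<lambda>h. g w x \<bullet> h - g y x \<bullet> h) \<le> e'" if w: "w \<in> S'" for w
      proof (rule onorm_le)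
        fix h :: 'a
        have "dist (g w x) (g y x) < e'"
          using d(2)[of "(y,x)" "(w,x)"] w S' r x yS by (auto simp: S'_def dist_commute dist_Pair_Pair)
        then have "norm (g w x - g y x) * norm h \<le> e' * norm h"
          by (intro mult_right_mono) (auto simp: dist_norm)
        then show "norm (g w x \<bullet> h - g y x \<bullet> h) \<le> e' * norm h"
          by (metis Cauchy_Schwarz_ineq2 inner_diff_left order_trans real_norm_def)
      qed
      then have on: "onorm ((\<bullet>) (g w x) - (\<bullet>) (g y x)) \<le> e'" if "w \<in> S'" for w
        using that by (simp add: fun_diff_def)
      have "((\<lambda>y. f y x) has_derivative (\<bullet>) (g w x)) (at w within S')" if "w \<in> S'" for w
        by (rule has_derivative_at_withinI[OF der[OF subsetD[OF S'(2) that] x]])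
      from differentiable_bound_linearization[of y z S' "\<lambda>y. f y x" "\<lambda>y h. g y x \<bullet> h" y e', OF seg this on yS(1)]
      show ?thesis .
    qed
    have "norm ((\<integral>x. f z x \<partial>sphere_measure) - (\<integral>x. f y x \<partial>sphere_measure) - (\<integral>x. g y x \<partial>sphere_measure) \<bullet> (z - y))
       \<le> e * norm (z - y)" if z: "norm (z - y) < min d r" for z
    proof -
      have zS: "z \<in> S" using z r by (auto simp: dist_norm norm_minus_commute subset_eq)
      have "(\<integral>x. f z x \<partial>sphere_measure) - (\<integral>x. f y x \<partial>sphere_measure) - (\<integral>x. g y x \<partial>sphere_measure) \<bullet> (z - y)
        = (\<integral>x. f z x - f y x - g y x \<bullet> (z - y) \<partial>sphere_measure)"
        using if_[OF zS] if_[OF y] ig[OF y] by simp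
      also have "norm \<dots> \<le> (\<integral>x. norm (f z x - f y x - g y x \<bullet> (z - y)) \<partial>sphere_measure)"
        by (rule integral_norm_bound)
      also have "\<dots> \<le> (\<integral>x. norm (z - y) * e' \<partial>(sphere_measure :: (real^'m) measure))"
        using if_[OF zS] if_[OF y] ig[OF y] key[OF z] by (intro integral_mono) auto
      also have "\<dots> = \<omega> * e' * norm (z - y)" by (simp add: \<omega>_def)
      also have "\<dots> \<le> e * norm (z - y)"
      proof (rule mult_right_mono)
        have "\<omega> * e' = e * (\<omega> / (\<omega> + 1))" by (simp add: e'_def)
        also have "\<dots> \<le> e * 1" using e \<omega> by (intro mult_left_mono) auto
        finally show "\<omega> * e' \<le> e" by simp
      qed simp
      finally show ?thesis .
    qed
    then show "\<exists>d>0. \<forall>z. norm (z - y) < d \<longrightarrow> norm ((\<integral>x. f z x \<partial>sphere_measure) - (\<integral>x. f y x \<partial>sphere_measure)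
         - (\<integral>x. g y x \<partial>sphere_measure) \<bullet> (z - y)) \<le> e * norm (z - y)"
      using d(1) r(1) by (intro exI[of _ "min d r"]) simp
  qed
qed


section \<open>Differential calculus on the sphere\<close>

lemma partial_deriv_eqI:
  "(f has_derivative f') (at x) \<Longrightarrow> partial_deriv i f x = f' (axis i 1)"
  unfolding partial_deriv_def by (metis frechet_derivative_at)

definition gradient :: "(real ^ 'm::finite \<Rightarrow> real) \<Rightarrow> real ^ 'm \<Rightarrow> real ^ 'm" where
  "gradient f x = (\<chi> i. partial_deriv i f x)"

lemma gradient_nth [simp]: "gradient f x $ i = partial_deriv i f x"
  by (simp add: gradient_def)

lemma linear_eq_inner_axis:
  fixes f' :: "real ^ 'm::finite \<Rightarrow> real"
  assumes "linear f'" shows "f' h = (\<chi> i. f' (axis i 1)) \<bullet> h"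
proof -
  have "f' h = f' (\<Sum>i\<in>UNIV. (h $ i) *\<^sub>R axis i 1)"
    by (simp add: basis_expansion[of h, unfolded scalar_mult_eq_scaleR])
  also have "\<dots> = (\<Sum>i\<in>UNIV. h $ i * f' (axis i 1))"
    by (simp add: linear_sum[OF assms] linear_cmul[OF assms])
  finally show ?thesis by (simp add: inner_vec_def mult.commute)
qed

lemma has_derivative_gradient:
  assumes "f differentiable (at x)"
  shows "(f has_derivative (\<lambda>h. gradient f x \<bullet> h)) (at x)"
proof -
  obtain f' where f': "(f has_derivative f') (at x)" using assms by (auto simp: differentiable_def)
  have "f' h = gradient f x \<bullet> h" for h
    unfolding gradient_def partial_deriv_eqI[OF f'] by (rule linear_eq_inner_axis[OF has_derivative_linear[OF f']])
  then have "f' = (\<lambda>h. gradient f x \<bullet> h)" by (rule ext)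
  then show ?thesis using f' by simp
qed

lemma gradient_eqI:
  assumes "(f has_derivative (\<lambda>h. g \<bullet> h)) (at x)" shows "gradient f x = g"
  using partial_deriv_eqI[OF assms] by (simp add: vec_eq_iff inner_axis)

lemma partial_deriv_cong:
  assumes "open S" "x \<in> S" "\<And>y. y \<in> S \<Longrightarrow> f y = g y"
  shows "partial_deriv i f x = partial_deriv i g x"
proof -
  have "frechet_derivative f (at x) = frechet_derivative g (at x)"
    unfolding frechet_derivative_def
    using has_derivative_transform_within_open[OF _ assms(1,2), of f _ UNIV g]
      has_derivative_transform_within_open[OF _ assms(1,2), of g _ UNIV f] assms(3)
    by (metis (no_types, lifting))
  then show ?thesis by (simp add: partial_deriv_def)
qed

lemma differentiable_on_open_at:
  "f differentiable_on S \<Longrightarrow> open S \<Longrightarrow> x \<in> S \<Longrightarrow> f differentiable (at x)"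
  by (simp add: differentiable_on_eq_differentiable_at)

lemma partial_deriv_add:
  assumes "f differentiable (at x)" "g differentiable (at x)"
  shows "partial_deriv i (\<lambda>x. f x + g x) x = partial_deriv i f x + partial_deriv i g x"
  using partial_deriv_eqI[OF has_derivative_add[OF assms[THEN has_derivative_gradient]], of i]
  by (simp add: inner_axis)

lemma partial_deriv_mult:
  assumes "f differentiable (at x)" "g differentiable (at x)"
  shows "partial_deriv i (\<lambda>x. f x * g x) x = f x * partial_deriv i g x + partial_deriv i f x * g x"
  using partial_deriv_eqI[OF has_derivative_mult[OF assms[THEN has_derivative_gradient]], of i]
  by (simp add: inner_axis)

lemma partial_deriv_sum:
  assumes "finite A" "\<And>a. a \<in> A \<Longrightarrow> f a differentiable (at x)"
  shows "partial_deriv i (\<lambda>x. \<Sum>a\<in>A. f a x) x = (\<Sum>a\<in>A. partial_deriv i (f a) x)"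
  using partial_deriv_eqI[OF has_derivative_sum[of A f, OF has_derivative_gradient[OF assms(2)]], of i]
  by (simp add: inner_axis)

lemma partial_deriv_const [simp]: "partial_deriv i (\<lambda>x. c) x = 0"
  using has_derivative_const by (subst partial_deriv_eqI) auto

lemma partial_deriv_bounded_linear:
  "bounded_linear f \<Longrightarrow> partial_deriv i f x = f (axis i 1)"
  by (rule partial_deriv_eqI) (rule bounded_linear_imp_has_derivative)

lemma partial_deriv_component [simp]:
  "partial_deriv i (\<lambda>x. x $ j) x = (if i = j then 1 else 0)"
  by (subst partial_deriv_bounded_linear) (auto simp: axis_def bounded_linear_vec_nth)

lemma partial_deriv_cmult:
  assumes "f differentiable (at x)"
  shows "partial_deriv i (\<lambda>x. c * f x) x = c * partial_deriv i f x"
  using partial_deriv_mult[of "\<lambda>_. c" x f i] assms by simp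

lemma partial_deriv_diff:
  assumes "f differentiable (at x)" "g differentiable (at x)"
  shows "partial_deriv i (\<lambda>x. f x - g x) x = partial_deriv i f x - partial_deriv i g x"
  using partial_deriv_eqI[OF has_derivative_diff[OF assms[THEN has_derivative_gradient]], of i]
  by (simp add: inner_axis)

section \<open>Stability of \<open>Ck_on\<close> under algebraic operations\<close>

lemma Ck_on_cong:
  assumes "open S" "\<And>y. y \<in> S \<Longrightarrow> f y = g y" "Ck_on k S f"
  shows "Ck_on k S g"
  using assms(2,3)
proof (induction k arbitrary: f g)
  case 0 then show ?case by (simp cong: continuous_on_cong)
next
  case (Suc k)
  have "g differentiable_on S"
    using Suc.prems differentiable_transform_within[of f _ S 1 g] by (simp add: differentiable_on_def)
  moreover have "Ck_on k S (partial_deriv i g)" for i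
  proof (rule Suc.IH)
    show "Ck_on k S (partial_deriv i f)" using Suc.prems by simp
    show "partial_deriv i f y = partial_deriv i g y" if "y \<in> S" for y
      by (rule partial_deriv_cong[OF assms(1) that Suc.prems(1)])
  qed
  ultimately show ?case by simp
qed

lemma Ck_on_Suc_imp: "Ck_on (Suc k) S f \<Longrightarrow> Ck_on k S f"
proof (induction k arbitrary: f)
  case 0 then show ?case by (simp add: differentiable_imp_continuous_on)
next
  case (Suc k)
  then have "f differentiable_on S" "\<And>i. Ck_on k S (partial_deriv i f)" by simp_all
  then show ?case by simp
qed

lemma Ck_on_le: "Ck_on k S f \<Longrightarrow> j \<le> k \<Longrightarrow> Ck_on j S f"
proof (induction k)
  case (Suc k)
  then show ?case using Ck_on_Suc_imp[of k S f] by (cases "j = Suc k") (auto simp del: Ck_on.simps)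
qed (simp del: Ck_on.simps)

lemma Ck_on_subset: "Ck_on k S f \<Longrightarrow> T \<subseteq> S \<Longrightarrow> Ck_on k T f"
proof (induction k arbitrary: f)
  case 0 then show ?case by (auto intro: continuous_on_subset)
next
  case (Suc k) then show ?case by (auto intro: differentiable_on_subset)
qed

lemma Ck_on_const: "Ck_on k S (\<lambda>x. c)"
proof (induction k arbitrary: c)
  case (Suc k)
  have "partial_deriv i (\<lambda>x. c) = (\<lambda>x. 0)" for i :: 'a by (rule ext) simp
  with Suc show ?case by simp
qed simp

lemma Ck_on_bounded_linear: 
  assumes "bounded_linear f" shows "Ck_on k S f"
proof (cases k)
  case 0 then show ?thesis using assms by (simp add: linear_continuous_on)
next
  case (Suc j)
  have "partial_deriv i f = (\<lambda>x. f (axis i 1))" for i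
    by (rule ext) (simp add: partial_deriv_bounded_linear assms)
  with Suc assms show ?thesis
    by (simp add: Ck_on_const bounded_linear_imp_differentiable_on)
qed

lemma Ck_on_add:
  assumes "open S" "Ck_on k S f" "Ck_on k S g" shows "Ck_on k S (\<lambda>x. f x + g x)"
  using assms(2,3)
proof (induction k arbitrary: f g)
  case 0 then show ?case by (auto intro: continuous_intros)
next
  case (Suc k)
  then have d: "f differentiable_on S" "g differentiable_on S" by auto
  have "Ck_on k S (partial_deriv i (\<lambda>x. f x + g x))" for i
  proof (rule Ck_on_cong[OF assms(1)])
    show "Ck_on k S (\<lambda>x. partial_deriv i f x + partial_deriv i g x)"
      using Suc.prems by (intro Suc.IH) simp_all
    show "partial_deriv i f y + partial_deriv i g y = partial_deriv i (\<lambda>x. f x + g x) y" if "y \<in> S" for y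
      using d[THEN differentiable_on_open_at, OF assms(1) that] by (simp add: partial_deriv_add)
  qed
  with d show ?case by (simp add: differentiable_on_add)
qed

lemma Ck_on_mult:
  assumes "open S" "Ck_on k S f" "Ck_on k S g" shows "Ck_on k S (\<lambda>x. f x * g x)"
  using assms(2,3)
proof (induction k arbitrary: f g)
  case 0 then show ?case by (auto intro: continuous_intros)
next
  case (Suc k)
  then have d: "f differentiable_on S" "g differentiable_on S" by auto
  have l: "Ck_on k S f" "Ck_on k S g" using Suc.prems by (auto intro: Ck_on_Suc_imp simp del: Ck_on.simps)
  have "Ck_on k S (partial_deriv i (\<lambda>x. f x * g x))" for i
  proof (rule Ck_on_cong[OF assms(1)])
    show "Ck_on k S (\<lambda>x. f x * partial_deriv i g x + partial_deriv i f x * g x)"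
      using Suc.prems l by (intro Ck_on_add[OF assms(1)] Suc.IH) simp_all
    show "f y * partial_deriv i g y + partial_deriv i f y * g y = partial_deriv i (\<lambda>x. f x * g x) y" if "y \<in> S" for y
      using d[THEN differentiable_on_open_at, OF assms(1) that] by (simp add: partial_deriv_mult)
  qed
  with d show ?case by (simp add: differentiable_on_mult)
qed

lemma Ck_on_cmult: "open S \<Longrightarrow> Ck_on k S f \<Longrightarrow> Ck_on k S (\<lambda>x. c * f x)"
  by (rule Ck_on_mult[OF _ Ck_on_const])

lemma Ck_on_diff:
  assumes "open S" "Ck_on k S f" "Ck_on k S g" shows "Ck_on k S (\<lambda>x. f x - g x)"
  using Ck_on_add[OF assms(1,2) Ck_on_cmult[OF assms(1,3), of "-1"]] by simp

lemma Ck_on_sum: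
  assumes "open S" "\<And>a. a \<in> A \<Longrightarrow> Ck_on k S (f a)" shows "Ck_on k S (\<lambda>x. \<Sum>a\<in>A. f a x)"
  using assms(2)
proof (induction A rule: infinite_finite_induct)
  case (insert a A) then show ?case using Ck_on_add[OF assms(1), of k "f a"] by (simp del: Ck_on.simps)
qed (simp_all add: Ck_on_const del: Ck_on.simps)

lemma Ck_on_real_polynomial_function:
  assumes "real_polynomial_function f" "open S" shows "Ck_on k S f"
  using assms(1)
proof (induction rule: real_polynomial_function.induct)
  case (linear f) then show ?case by (rule Ck_on_bounded_linear)
qed (rule Ck_on_const Ck_on_add[OF assms(2)] Ck_on_mult[OF assms(2)]; assumption?)+

section \<open>Rotation fields and the Laplacian of the sphere\<close>

definition rot_deriv :: "'m \<Rightarrow> 'm \<Rightarrow> (real ^ 'm::finite \<Rightarrow> real) \<Rightarrow> real ^ 'm \<Rightarrow> real" where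
  "rot_deriv i j f x = x $ i * partial_deriv j f x - x $ j * partial_deriv i f x"

text \<open>The Casimir operator of the rotation group. Each plane occurs as (i, j) and as (j, i),
  whence the factor 1/2; the diagonal fields are zero. The rotation fields are tangent to the sphere
  and generate measure preserving flows, so neither charts nor a divergence theorem are
  involved.\<close>

definition sphere_laplacian :: "(real ^ 'm::finite \<Rightarrow> real) \<Rightarrow> real ^ 'm \<Rightarrow> real" where
  "sphere_laplacian f x = (\<Sum>i\<in>UNIV. \<Sum>j\<in>UNIV. rot_deriv i j (rot_deriv i j f) x) / 2"

lemma Ck_on_component: "Ck_on k S (\<lambda>x. x $ i)"
  by (rule Ck_on_bounded_linear) (rule bounded_linear_vec_nth)

lemma Ck_on_rot_deriv: "open S \<Longrightarrow> Ck_on (Suc k) S f \<Longrightarrow> Ck_on k S (rot_deriv i j f)"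
  unfolding rot_deriv_def[abs_def] by (intro Ck_on_diff Ck_on_mult Ck_on_component) auto

lemma Ck_on_sphere_laplacian:
  assumes "open S" "Ck_on (Suc (Suc k)) S f" shows "Ck_on k S (sphere_laplacian f)"
proof -
  have "Ck_on k S (\<lambda>x. (1/2) * (\<Sum>i\<in>UNIV. \<Sum>j\<in>UNIV. rot_deriv i j (rot_deriv i j f) x))"
    using assms by (intro Ck_on_cmult Ck_on_sum Ck_on_rot_deriv) auto
  then show ?thesis unfolding sphere_laplacian_def[abs_def] by simp
qed

text \<open>The identity is corrected by multiples of the projection of x to the (i, j) plane and of
  its quarter turn. This form separates the angle from x, and its derivative at angle 0 is the
  quarter turn, that is, the rotation field at x.\<close>

lemma orthogonal_transformation_plane_rotation:
  fixes i j :: "'m::finite"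
  assumes "i \<noteq> j"
  shows "orthogonal_transformation (\<lambda>x :: real^'m. x + (cos \<theta> - 1) *\<^sub>R (x$i *\<^sub>R axis i 1 + x$j *\<^sub>R axis j 1)
           + sin \<theta> *\<^sub>R (x$i *\<^sub>R axis j 1 - x$j *\<^sub>R axis i 1))" (is "orthogonal_transformation ?T")
  unfolding orthogonal_transformation
proof (intro conjI allI)
  show "linear ?T"
    by (rule linearI) (simp_all add: algebra_simps)
  fix x :: "real^'m"
  define p q where "p = x$i *\<^sub>R axis i 1 + x$j *\<^sub>R (axis j 1 :: real^'m)"
    and "q = x$i *\<^sub>R axis j 1 - x$j *\<^sub>R (axis i 1 :: real^'m)"
  have ax: "axis i (1::real) $ j = 0" "axis j (1::real) $ i = 0" using assms by (auto simp: axis_def)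
  have ip: "p \<bullet> p = (x$i)\<^sup>2 + (x$j)\<^sup>2" "q \<bullet> q = (x$i)\<^sup>2 + (x$j)\<^sup>2" "p \<bullet> q = 0"
      "x \<bullet> p = (x$i)\<^sup>2 + (x$j)\<^sup>2" "x \<bullet> q = 0"
    using assms ax by (auto simp: p_def q_def inner_add_left inner_add_right inner_diff_left inner_diff_right
        inner_axis_axis inner_axis power2_eq_square)
  define c s where "c = cos \<theta>" and "s = sin \<theta>"
  have cs: "c\<^sup>2 + s\<^sup>2 = 1" by (simp add: c_def s_def)
  have "(x + (c - 1) *\<^sub>R p + s *\<^sub>R q) \<bullet> (x + (c - 1) *\<^sub>R p + s *\<^sub>R q)
      = x \<bullet> x + (c - 1)\<^sup>2 * (p \<bullet> p) + s\<^sup>2 * (q \<bullet> q) + 2 * (c - 1) * (x \<bullet> p) + 2 * s * (x \<bullet> q) + 2 * (c-1) * s * (p \<bullet> q)"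
    by (simp add: inner_add_left inner_add_right inner_commute power2_eq_square algebra_simps)
  also have "\<dots> = x \<bullet> x + (c\<^sup>2 + s\<^sup>2 - 1) * ((x$i)\<^sup>2 + (x$j)\<^sup>2)"
    by (simp add: ip power2_eq_square algebra_simps)
  finally show "norm (?T x) = norm x"
    unfolding p_def[symmetric] q_def[symmetric] c_def[symmetric] s_def[symmetric] norm_eq_sqrt_inner by (simp add: cs)
qed

lemma continuous_on_gradient:
  "\<forall>i. continuous_on S (partial_deriv i f) \<Longrightarrow> continuous_on S (gradient f)"
  unfolding gradient_def[abs_def] by (intro continuous_on_vec_lambda) auto

text \<open>The rotations in the \<open>(i, j)\<close> plane preserve the measure, and \<open>rot_deriv i j f\<close> is the
  derivative of \<open>f\<close> along this flow.\<close>

lemma integral_rot_deriv: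
  assumes S: "open S" "sphere 0 1 \<subseteq> S" and F: "Ck_on 1 S F"
  shows "(\<integral>x. rot_deriv i j F x \<partial>sphere_measure) = 0"
proof (cases "i = j")
  case True then show ?thesis by (simp add: rot_deriv_def)
next
  case False
  define p q where "p x = x$i *\<^sub>R axis i 1 + x$j *\<^sub>R (axis j 1 :: real^'a)"
    and "q x = x$i *\<^sub>R axis j 1 - x$j *\<^sub>R (axis i 1 :: real^'a)" for x :: "real^'a"
  define T where "T \<theta> x = x + (cos \<theta> - 1) *\<^sub>R p x + sin \<theta> *\<^sub>R q x" for \<theta> x
  define T' where "T' \<theta> x = (- sin \<theta>) *\<^sub>R p x + cos \<theta> *\<^sub>R q x" for \<theta> x
  have orth: "orthogonal_transformation (T \<theta>)" for \<theta>
    unfolding T_def[abs_def] p_def q_def by (rule orthogonal_transformation_plane_rotation[OF False])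
  have TS: "T \<theta> x \<in> S" if "x \<in> sphere 0 1" for \<theta> x
    using orth[of \<theta>] S that by (auto simp: orthogonal_transformation subset_eq)
  have F': "F differentiable_on S" "\<forall>i. continuous_on S (partial_deriv i F)" using F by auto
  have cF: "continuous_on S F" using F' differentiable_imp_continuous_on by blast
  define g where "g \<theta> x = gradient F (T \<theta> x) \<bullet> T' \<theta> x" for \<theta> x
  have "((\<lambda>\<theta>. \<integral>x. F (T \<theta> x) \<partial>sphere_measure) has_derivative (\<lambda>h. (\<integral>x. g 0 x \<partial>sphere_measure) \<bullet> h)) (at 0)"
  proof (rule has_derivative_integral_sphere[where S=UNIV])
    have cT: "continuous_on X (\<lambda>(\<theta>,x). T \<theta> x)" "continuous_on X (\<lambda>(\<theta>,x). T' \<theta> x)" "continuous_on Y (T \<theta>)" for X Y \<theta>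
      by (auto simp: T_def T'_def p_def q_def split_beta' intro!: continuous_intros)
    show "continuous_on (sphere 0 1) (\<lambda>x. F (T y x))" for y
      by (rule continuous_on_compose2[OF cF cT(3)]) (use TS in auto)
    show "continuous_on (UNIV \<times> sphere 0 1) (\<lambda>(y, x). g y x)"
      unfolding g_def split_beta'
    proof (intro continuous_on_inner)
      show "continuous_on (UNIV \<times> sphere 0 1) (\<lambda>p. gradient F (T (fst p) (snd p)))"
        by (rule continuous_on_compose2[OF continuous_on_gradient[OF F'(2)] cT(1)[unfolded split_beta']]) (use TS in auto)
    qed (use cT(2) in \<open>simp add: split_beta'\<close>)
    fix \<theta> x assume x: "x \<in> sphere (0::real^'a) 1"
    have 1: "(F has_derivative (\<lambda>h. gradient F (T \<theta> x) \<bullet> h)) (at (T \<theta> x))"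
      using F'(1) S(1) TS[OF x] by (intro has_derivative_gradient differentiable_on_open_at)
    have 2: "((\<lambda>\<theta>. T \<theta> x) has_derivative (\<lambda>h. h *\<^sub>R T' \<theta> x)) (at \<theta>)"
      unfolding T_def T'_def by (auto intro!: derivative_eq_intros simp: algebra_simps)
    show "((\<lambda>\<theta>. F (T \<theta> x)) has_derivative (\<lambda>h. g \<theta> x \<bullet> h)) (at \<theta>)"
      using has_derivative_compose[OF 2 1] by (simp add: g_def mult.commute)
  qed auto
  moreover have "(\<integral>x. F (T \<theta> x) \<partial>sphere_measure) = (\<integral>x. F x \<partial>sphere_measure)" for \<theta>
    by (rule integral_sphere_orthogonal_transformation[OF orth continuous_on_subset[OF cF S(2)]])
  ultimately have "((\<lambda>\<theta>::real. \<integral>x. F x \<partial>sphere_measure) has_derivative (\<lambda>h. (\<integral>x. g 0 x \<partial>sphere_measure) \<bullet> h)) (at 0)"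
    by simp
  from has_derivative_unique[OF this has_derivative_const] have "(\<integral>x. g 0 x \<partial>sphere_measure) = 0"
    by (metis inner_real_def mult.right_neutral)
  moreover have "g 0 x = rot_deriv i j F x" for x
    by (simp add: g_def T_def T'_def q_def rot_deriv_def inner_diff_right inner_axis)
  ultimately show ?thesis by simp
qed

lemma rot_deriv_mult:
  assumes "f differentiable (at x)" "g differentiable (at x)"
  shows "rot_deriv i j (\<lambda>x. f x * g x) x = f x * rot_deriv i j g x + rot_deriv i j f x * g x"
  by (simp add: rot_deriv_def partial_deriv_mult[OF assms] algebra_simps)

lemma integral_rot_deriv_by_parts:
  assumes S: "open S" "sphere 0 1 \<subseteq> S" and F: "Ck_on 1 S F" and G: "Ck_on 1 S G"
  shows "(\<integral>x. F x * rot_deriv i j G x \<partial>sphere_measure) = - (\<integral>x. rot_deriv i j F x * G x \<partial>sphere_measure)"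
proof -
  have d: "F differentiable_on S" "G differentiable_on S" using F G by auto
  have c: "Ck_on 0 S (\<lambda>x. F x * rot_deriv i j G x)" "Ck_on 0 S (\<lambda>x. rot_deriv i j F x * G x)"
    using F G S(1) Ck_on_Suc_imp[of 0 S F] Ck_on_Suc_imp[of 0 S G]
      by (intro Ck_on_mult Ck_on_rot_deriv; simp)+
  then have int: "integrable sphere_measure (\<lambda>x. F x * rot_deriv i j G x)" "integrable sphere_measure (\<lambda>x. rot_deriv i j F x * G x)"
    using S by (auto intro!: integrable_sphere_continuous intro: continuous_on_subset)
  have "0 = (\<integral>x. rot_deriv i j (\<lambda>x. F x * G x) x \<partial>sphere_measure)"
    using integral_rot_deriv[OF S Ck_on_mult[OF S(1) F G]] by simp
  also have "\<dots> = (\<integral>x. F x * rot_deriv i j G x + rot_deriv i j F x * G x \<partial>sphere_measure)"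
    using S d by (intro Bochner_Integration.integral_cong refl) (auto intro!: rot_deriv_mult differentiable_on_open_at[of _ S])
  also have "\<dots> = (\<integral>x. F x * rot_deriv i j G x \<partial>sphere_measure) + (\<integral>x. rot_deriv i j F x * G x \<partial>sphere_measure)"
    by (rule Bochner_Integration.integral_add[OF int])
  finally show ?thesis by simp
qed

text \<open>Each rotation field is antisymmetric under the integral; moving both factors of its
  square across changes the sign twice.\<close>

lemma integral_sphere_laplacian_symmetric:
  assumes S: "open S" "sphere 0 1 \<subseteq> S" and F: "Ck_on 2 S F" and G: "Ck_on 2 S G"
  shows "(\<integral>x. F x * sphere_laplacian G x \<partial>sphere_measure) = (\<integral>x. sphere_laplacian F x * G x \<partial>sphere_measure)"
proof -
  have F1: "Ck_on 1 S F" "Ck_on 1 S G" using Ck_on_le[OF F, of 1] Ck_on_le[OF G, of 1] by (simp_all del: Ck_on.simps)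
  have R1: "Ck_on 1 S (rot_deriv i j F)" "Ck_on 1 S (rot_deriv i j G)" for i j
    using F G S(1) unfolding One_nat_def numeral_2_eq_2 by - (intro Ck_on_rot_deriv; assumption)+
  have R2: "Ck_on 0 S (rot_deriv i j (rot_deriv i j F))" "Ck_on 0 S (rot_deriv i j (rot_deriv i j G))" for i j
    using Ck_on_rot_deriv[OF S(1) R1(1)[of i j, unfolded One_nat_def]] Ck_on_rot_deriv[OF S(1) R1(2)[of i j, unfolded One_nat_def]]
    by auto
  have F0: "Ck_on 0 S F" "Ck_on 0 S G" using Ck_on_le[OF F, of 0] Ck_on_le[OF G, of 0] by (simp_all del: Ck_on.simps)
  have int: "integrable sphere_measure (\<lambda>x. F x * rot_deriv i j (rot_deriv i j G) x)"
      "integrable sphere_measure (\<lambda>x. rot_deriv i j (rot_deriv i j F) x * G x)" for i j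
    using Ck_on_mult[OF S(1) F0(1) R2(2)[of i j]] Ck_on_mult[OF S(1) R2(1)[of i j] F0(2)] S
    by (auto intro!: integrable_sphere_continuous intro: continuous_on_subset)
  have eq: "(\<integral>x. F x * rot_deriv i j (rot_deriv i j G) x \<partial>sphere_measure)
      = (\<integral>x. rot_deriv i j (rot_deriv i j F) x * G x \<partial>sphere_measure)" for i j
    using integral_rot_deriv_by_parts[OF S F1(1) R1(2), of i j] integral_rot_deriv_by_parts[OF S R1(1) F1(2), of i j] by simp
  show ?thesis
    by (simp add: sphere_laplacian_def sum_distrib_left sum_distrib_right Bochner_Integration.integral_sum int eq)
qed

section \<open>Functions of \<open>x \<bullet> e\<close>\<close>

lemma partial_deriv_zonal:
  assumes "(k has_real_derivative k') (at (x \<bullet> e))"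
  shows "partial_deriv i (\<lambda>x. k (x \<bullet> e)) x = k' * e $ i" "(\<lambda>x. k (x \<bullet> e)) differentiable (at x)"
proof -
  have 1: "(k has_derivative (\<lambda>h. k' * h)) (at (x \<bullet> e))"
    using assms by (simp add: has_field_derivative_def)
  have "((\<lambda>x. k (x \<bullet> e)) has_derivative (\<lambda>h. k' * (h \<bullet> e))) (at x)"
    by (rule has_derivative_compose[of "\<lambda>x. x \<bullet> e" "\<lambda>h. h \<bullet> e" x UNIV k "\<lambda>h. k' * h", OF _ 1])
      (auto intro!: derivative_eq_intros)
  then show "partial_deriv i (\<lambda>x. k (x \<bullet> e)) x = k' * e $ i" "(\<lambda>x. k (x \<bullet> e)) differentiable (at x)"
    using partial_deriv_eqI[where i=i] by (force simp: differentiable_def inner_axis')+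
qed

text \<open>The profile k is controlled on I alone, since the kernels to come, powers of b - t, live
  on t < b.\<close>

lemma Ck_on_2_zonal:
  assumes S: "open S" "\<And>x. x \<in> S \<Longrightarrow> x \<bullet> e \<in> I"
    and k: "\<And>t. t \<in> I \<Longrightarrow> (k has_real_derivative k' t) (at t)"
    and k': "\<And>t. t \<in> I \<Longrightarrow> (k' has_real_derivative k'' t) (at t)"
    and ck'': "continuous_on I k''"
  shows "Ck_on 2 S (\<lambda>x. k (x \<bullet> e))"
proof -
  have "Ck_on 1 S (\<lambda>x. k' (x \<bullet> e))"
  proof -
    have "Ck_on 0 S (partial_deriv i (\<lambda>x. k' (x \<bullet> e)))" for i
    proof (rule Ck_on_cong[OF S(1)])
      show "Ck_on 0 S (\<lambda>x. k'' (x \<bullet> e) * e $ i)"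
        using S(2) by (auto intro!: continuous_intros continuous_on_compose2[OF ck''])
      show "k'' (y \<bullet> e) * e $ i = partial_deriv i (\<lambda>x. k' (x \<bullet> e)) y" if "y \<in> S" for y
        by (rule partial_deriv_zonal(1)[OF k'[OF S(2)[OF that]], symmetric])
    qed
    moreover have "(\<lambda>x. k' (x \<bullet> e)) differentiable_on S"
      using S(1) partial_deriv_zonal(2)[OF k'[OF S(2)]] by (simp add: differentiable_on_eq_differentiable_at)
    ultimately show ?thesis by simp
  qed
  then have "Ck_on 1 S (\<lambda>x. e $ i * k' (x \<bullet> e))" for i by (rule Ck_on_cmult[OF S(1)])
  from Ck_on_cong[OF S(1) _ this] have "Ck_on 1 S (partial_deriv i (\<lambda>x. k (x \<bullet> e)))" for i
    using partial_deriv_zonal(1)[OF k[OF S(2)], of _ i] by (metis mult.commute)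
  moreover have "(\<lambda>x. k (x \<bullet> e)) differentiable_on S"
    using S(1) partial_deriv_zonal(2)[OF k[OF S(2)]] by (simp add: differentiable_on_eq_differentiable_at)
  ultimately show ?thesis by (simp add: numeral_2_eq_2)
qed

text \<open>The ultraspherical operator in t = x \<bullet> e. Its leading coefficient is Lagrange's
  identity: for unit vectors the squares of x_i e_j - x_j e_i, summed over all pairs, give 2 (1 -
  t^2).\<close>

lemma sphere_laplacian_zonal:
  fixes e x :: "real ^ 'm::finite"
  assumes S: "open S" "\<And>x. x \<in> S \<Longrightarrow> x \<bullet> e \<in> I"
    and k: "\<And>t. t \<in> I \<Longrightarrow> (k has_real_derivative k' t) (at t)"
    and k': "\<And>t. t \<in> I \<Longrightarrow> (k' has_real_derivative k'' t) (at t)"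
    and e: "norm e = 1" and x: "norm x = 1" "x \<in> S"
  shows "sphere_laplacian (\<lambda>x. k (x \<bullet> e)) x
     = (1 - (x \<bullet> e)\<^sup>2) * k'' (x \<bullet> e) - (real CARD('m) - 1) * (x \<bullet> e) * k' (x \<bullet> e)"
proof -
  define t where "t = x \<bullet> e"
  have R1: "rot_deriv i j (\<lambda>x. k (x \<bullet> e)) y = (y$i * e$j - y$j * e$i) * k' (y \<bullet> e)" if "y \<in> S" for i j y
    using partial_deriv_zonal(1)[OF k[OF S(2)[OF that]]] by (simp add: rot_deriv_def algebra_simps)
  \<comment> \<open>The last summand corrects the diagonal, where the field is zero: for i = j it
    cancels the first-order term.\<close>
  have R2: "rot_deriv i j (rot_deriv i j (\<lambda>x. k (x \<bullet> e))) x
     = (x$i * e$j - x$j * e$i)\<^sup>2 * k'' t - (x$i * e$i + x$j * e$j) * k' t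
       + (if i = j then (x$i * e$j + x$j * e$i) * k' t else 0)" for i j
  proof -
    have k't: "(k' has_real_derivative k'' t) (at (x \<bullet> e))" using k' S x by (simp add: t_def)
    have dl: "(\<lambda>y. y$i * e$j - y$j * e$i) differentiable (at x)"
      by (intro differentiable_diff differentiable_mult) (auto simp: bounded_linear_imp_differentiable bounded_linear_vec_nth)
    have pl: "partial_deriv l (\<lambda>y. y$i * e$j - y$j * e$i) x = (if l = i then e$j else 0) - (if l = j then e$i else 0)" for l
    proof -
      have "bounded_linear (\<lambda>y. y$i * e$j - y$j * e$i)"
        by (intro bounded_linear_sub bounded_linear_mult_left[THEN bounded_linear_compose] bounded_linear_vec_nth)
      then show ?thesis by (subst partial_deriv_bounded_linear) (auto simp: axis_def)
    qed
    have P: "partial_deriv l (rot_deriv i j (\<lambda>x. k (x \<bullet> e))) x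
       = (x$i * e$j - x$j * e$i) * (k'' t * e$l) + ((if l = i then e$j else 0) - (if l = j then e$i else 0)) * k' t" for l
      using partial_deriv_cong[OF S(1) x(2), of "rot_deriv i j (\<lambda>x. k (x \<bullet> e))", OF R1]
        partial_deriv_mult[OF dl partial_deriv_zonal(2)[OF k't], of l] partial_deriv_zonal(1)[OF k't, of l] pl
      by (simp add: t_def)
    show ?thesis unfolding rot_deriv_def[of i j "rot_deriv i j _"] P
      by (auto simp: power2_eq_square algebra_simps)
  qed
  have s: "(\<Sum>i\<in>UNIV. x$i * x$i) = 1" "(\<Sum>i\<in>UNIV. e$i * e$i) = 1" "(\<Sum>i\<in>UNIV. x$i * e$i) = t" "(\<Sum>i\<in>UNIV. e$i * x$i) = t"
    using x e by (auto simp: norm_eq_sqrt_inner t_def inner_vec_def mult.commute)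
  have A: "(\<Sum>i\<in>UNIV. \<Sum>j\<in>UNIV. (x$i * e$j - x$j * e$i)\<^sup>2) = 2 * (1 - t\<^sup>2)"
  proof -
    have "(\<Sum>i\<in>UNIV. \<Sum>j\<in>UNIV. (x$i * e$j - x$j * e$i)\<^sup>2)
      = (\<Sum>i\<in>UNIV. \<Sum>j\<in>UNIV. (x$i * x$i) * (e$j * e$j) + (e$i * e$i) * (x$j * x$j) - 2 * ((x$i * e$i) * (x$j * e$j)))"
      by (intro sum.cong refl) (simp add: power2_eq_square algebra_simps)
    also have "\<dots> = 2 * (1 - t\<^sup>2)"
      by (simp add: sum.distrib sum_subtractf s flip: sum_distrib_left sum_distrib_right) (simp add: power2_eq_square)
    finally show ?thesis .
  qed
  have B: "(\<Sum>i\<in>UNIV. \<Sum>j\<in>UNIV. x$i * e$i + x$j * e$j) = 2 * real CARD('m) * t"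
    by (simp add: sum.distrib s flip: sum_distrib_left)
  have C: "(\<Sum>i\<in>UNIV. \<Sum>j\<in>UNIV. if i = j then (x$i * e$j + x$j * e$i) * k' t else 0) = 2 * t * k' t"
    by (simp add: s flip: sum_distrib_left sum_distrib_right)
  have gen: "(\<Sum>i\<in>UNIV. \<Sum>j\<in>UNIV. a i j * c - b i j * d + f i j)
      = (\<Sum>i\<in>UNIV. \<Sum>j\<in>UNIV. a i j) * c - (\<Sum>i\<in>UNIV. \<Sum>j\<in>UNIV. b i j) * d + (\<Sum>i\<in>UNIV. \<Sum>j\<in>UNIV. f i j)"
    for a b f :: "'m \<Rightarrow> 'm \<Rightarrow> real" and c d
    by (simp add: sum.distrib sum_subtractf sum_distrib_right)
  have "sphere_laplacian (\<lambda>x. k (x \<bullet> e)) x =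
     ((\<Sum>i\<in>UNIV. \<Sum>j\<in>UNIV. (x$i * e$j - x$j * e$i)\<^sup>2) * k'' t
      - (\<Sum>i\<in>UNIV. \<Sum>j\<in>UNIV. x$i * e$i + x$j * e$j) * k' t
      + (\<Sum>i\<in>UNIV. \<Sum>j\<in>UNIV. if i = j then (x$i * e$j + x$j * e$i) * k' t else 0)) / 2"
    unfolding sphere_laplacian_def R2 gen ..
  then show ?thesis unfolding A B C t_def[symmetric] by (simp add: algebra_simps)
qed

lemma euler_homogeneous:
  fixes q :: "real ^ 'm::finite \<Rightarrow> real"
  assumes dq: "q differentiable (at y)" and hom: "\<And>c. q (c *\<^sub>R y) = c ^ k * q y"
  shows "y \<bullet> gradient q y = real k * q y"
proof -
  have 1: "((\<lambda>c. q (c *\<^sub>R y)) has_derivative (\<lambda>h. gradient q (1 *\<^sub>R y) \<bullet> (h *\<^sub>R y))) (at 1)"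
    by (rule has_derivative_compose[OF _ has_derivative_gradient]) (use dq in \<open>auto intro!: derivative_eq_intros\<close>)
  have 2: "((\<lambda>c. q (c *\<^sub>R y)) has_derivative (\<lambda>h. real k * q y * h)) (at 1)"
    unfolding hom by (auto intro!: derivative_eq_intros)
  from has_derivative_unique[OF 1 2] have "gradient q (1 *\<^sub>R y) \<bullet> (1 *\<^sub>R y) = real k * q y * 1"
    by meson
  then show ?thesis by (simp add: inner_commute)
qed

text \<open>The split of the flat Laplacian into a radial and a spherical part, read on |x| = 1:
  Euler's identity evaluates the radial first and second derivatives of a homogeneous polynomial,
  and the flat Laplacian vanishes.\<close>

lemma sphere_laplacian_homogeneous_harmonic:
  fixes q :: "real ^ 'm::finite \<Rightarrow> real"
  assumes q: "q \<in> spherical_harmonics k" and x: "norm x = 1"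
  shows "sphere_laplacian q x = - (real k * (real k + real CARD('m) - 2)) * q x"
proof -
  have pq: "real_polynomial_function q" and hom: "\<And>c x. q (c *\<^sub>R x) = c ^ k * q x" and lap: "laplacian q x = 0"
    using q by (auto simp: spherical_harmonics_def)
  have Ck: "Ck_on j UNIV q" for j by (rule Ck_on_real_polynomial_function[OF pq]) simp
  have dq: "q differentiable (at y)" for y using Ck[of 1] by (simp add: differentiable_on_eq_differentiable_at)
  have ddq: "partial_deriv i q differentiable (at y)" for i y 
    using Ck[of 2] by (simp add: numeral_2_eq_2 differentiable_on_eq_differentiable_at)
  have dc: "(\<lambda>y::real^'m. y $ i) differentiable (at y)" for i y
    by (simp add: bounded_linear_imp_differentiable bounded_linear_vec_nth)
  have euler: "(\<Sum>i\<in>UNIV. y $ i * partial_deriv i q y) = real k * q y" for y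
    using euler_homogeneous[OF dq hom, of y] by (simp add: inner_vec_def)
  define D where "D i j = partial_deriv i (partial_deriv j q) x" for i j
  define d where "d i = partial_deriv i q x" for i
  have e1: "(\<Sum>i\<in>UNIV. x$i * d i) = real k * q x" "(\<Sum>i\<in>UNIV. d i * x$i) = real k * q x"
    using euler[of x] by (simp_all add: d_def mult.commute)
  have e2: "(\<Sum>j\<in>UNIV. \<Sum>i\<in>UNIV. x$i * x$j * D j i) = real k * (real k - 1) * q x"
  proof -
    \<comment> \<open>Euler's identity differentiated in direction j; it exhibits the partial
      derivatives as homogeneous of degree k - 1.\<close>
    have "d j + (\<Sum>i\<in>UNIV. x$i * D j i) = real k * d j" for j
    proof -
      have "partial_deriv j (\<lambda>y. \<Sum>i\<in>UNIV. y $ i * partial_deriv i q y) x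
          = (\<Sum>i\<in>UNIV. x $ i * D j i + (if j = i then 1 else 0) * d i)"
        by (subst partial_deriv_sum) (auto simp: partial_deriv_mult dc ddq D_def d_def intro!: differentiable_mult)
      also have "\<dots> = (\<Sum>i\<in>UNIV. x$i * D j i) + d j" by (simp add: sum.distrib if_distrib[of "\<lambda>c. c * _"] cong: if_cong)
      finally show ?thesis unfolding euler using partial_deriv_cmult[OF dq, of j "real k" x] by (simp add: d_def)
    qed
    then have dj: "(\<Sum>i\<in>UNIV. x$i * D j i) = (real k - 1) * d j" for j
      by (metis add_diff_cancel_left' left_diff_distrib mult_1)
    have "(\<Sum>j\<in>UNIV. x$j * (\<Sum>i\<in>UNIV. x$i * D j i)) = (\<Sum>j\<in>UNIV. (real k - 1) * (x$j * d j))"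
      unfolding dj by (intro sum.cong) auto
    also have "\<dots> = (real k - 1) * (real k * q x)" by (simp add: e1 flip: sum_distrib_left)
    finally show ?thesis by (simp add: sum_distrib_left mult_ac)
  qed
  have e2': "(\<Sum>i\<in>UNIV. \<Sum>j\<in>UNIV. x$i * x$j * D j i) = real k * (real k - 1) * q x"
    using e2 by (subst sum.swap) (simp add: mult_ac)
  have e2'': "(\<Sum>i\<in>UNIV. \<Sum>j\<in>UNIV. x$i * x$j * D i j) = real k * (real k - 1) * q x"
    using e2 by (simp add: mult_ac)
  have P: "partial_deriv l (rot_deriv i j q) x
     = x$i * D l j + (if l = i then 1 else 0) * d j - x$j * D l i - (if l = j then 1 else 0) * d i" for i j l
    unfolding rot_deriv_def[abs_def]
    by (subst partial_deriv_diff) (auto simp: partial_deriv_mult dc ddq D_def d_def intro!: differentiable_mult)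
  have R: "rot_deriv i j (rot_deriv i j q) x
     = (x$i)\<^sup>2 * D j j + (x$j)\<^sup>2 * D i i - x$i * x$j * D j i - x$i * x$j * D i j
       - x$i * d i - x$j * d j + (if i = j then x$i * d j + x$j * d i else 0)" for i j
    unfolding rot_deriv_def[of i j "rot_deriv i j _"] P by (auto simp: power2_eq_square algebra_simps)
  have s: "(\<Sum>i\<in>UNIV. (x$i)\<^sup>2) = 1"
    using x by (auto simp: norm_eq_sqrt_inner inner_vec_def power2_eq_square)
  have l: "(\<Sum>i\<in>UNIV. D i i) = 0" using lap by (simp add: laplacian_def D_def)
  have "(\<Sum>i\<in>UNIV. \<Sum>j\<in>UNIV. rot_deriv i j (rot_deriv i j q) x)
     = - 2 * (real k * (real k - 1) * q x) - 2 * real CARD('m) * (real k * q x) + 2 * (real k * q x)"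
    unfolding R
    by (simp add: sum.distrib sum_subtractf s l e1 e2' e2'' flip: sum_distrib_left sum_distrib_right)
  then show ?thesis by (simp add: sphere_laplacian_def algebra_simps)
qed


section \<open>Zonal harmonics and the Poisson kernel\<close>

lemma real_polynomial_function_partial_deriv:
  "real_polynomial_function f \<Longrightarrow> real_polynomial_function (partial_deriv i f)"
proof (induction rule: real_polynomial_function.induct)
  case (linear f)
  then have "partial_deriv i f = (\<lambda>x. f (axis i 1))" by (intro ext partial_deriv_bounded_linear)
  then show ?case by auto
next
  case (const c)
  have "partial_deriv i (\<lambda>x. c) = (\<lambda>x. 0)" by (rule ext) simp
  then show ?case by auto
next
  case (add f g)
  have "partial_deriv i (\<lambda>x. f x + g x) = (\<lambda>x. partial_deriv i f x + partial_deriv i g x)"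
    using add by (intro ext partial_deriv_add differentiable_at_real_polynomial_function)
  then show ?case using add by auto
next
  case (mult f g)
  have "partial_deriv i (\<lambda>x. f x * g x) = (\<lambda>x. f x * partial_deriv i g x + partial_deriv i f x * g x)"
    using mult by (intro ext partial_deriv_mult differentiable_at_real_polynomial_function)
  then show ?case using mult by auto
qed

lemma real_polynomial_function_inner: "real_polynomial_function (\<lambda>y. y \<bullet> e)"
  by (rule real_polynomial_function.intros(1)) (rule bounded_linear_inner_left)

lemma real_polynomial_function_inner_self: "real_polynomial_function (\<lambda>y :: real^'m::finite. y \<bullet> y)"
  unfolding inner_vec_def inner_real_def
  by (rule real_polynomial_function_sum, simp, rule real_polynomial_function.intros(4))
    (rule real_polynomial_function.intros(1)[OF bounded_linear_vec_nth])+

lemma laplacian_add: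
  assumes "real_polynomial_function f" "real_polynomial_function g"
  shows "laplacian (\<lambda>x. f x + g x) x = laplacian f x + laplacian g x"
proof -
  have "partial_deriv i (\<lambda>x. f x + g x) = (\<lambda>x. partial_deriv i f x + partial_deriv i g x)" for i
    using assms by (intro ext partial_deriv_add differentiable_at_real_polynomial_function)
  then show ?thesis using assms
    by (simp add: laplacian_def partial_deriv_add differentiable_at_real_polynomial_function
        real_polynomial_function_partial_deriv sum.distrib)
qed

lemma laplacian_mult:
  assumes "real_polynomial_function f" "real_polynomial_function g"
  shows "laplacian (\<lambda>x. f x * g x) x
    = f x * laplacian g x + 2 * (gradient f x \<bullet> gradient g x) + laplacian f x * g x"
proof -
  have 1: "partial_deriv i (\<lambda>x. f x * g x) = (\<lambda>x. f x * partial_deriv i g x + partial_deriv i f x * g x)" for i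
    using assms by (intro ext partial_deriv_mult differentiable_at_real_polynomial_function)
  have "partial_deriv i (partial_deriv i (\<lambda>x. f x * g x)) x
    = f x * partial_deriv i (partial_deriv i g) x + 2 * (partial_deriv i f x * partial_deriv i g x)
      + partial_deriv i (partial_deriv i f) x * g x" for i
    using assms[THEN differentiable_at_real_polynomial_function]
      assms[THEN real_polynomial_function_partial_deriv, THEN differentiable_at_real_polynomial_function]
    by (simp add: 1 partial_deriv_add partial_deriv_mult differentiable_mult)
  then show ?thesis
    by (simp add: laplacian_def inner_vec_def sum.distrib sum_distrib_left sum_distrib_right)
qed

lemma laplacian_const [simp]: "laplacian (\<lambda>x. c) x = 0"
proof -
  have "partial_deriv i (\<lambda>x. c) = (\<lambda>x. 0)" for i :: 'a by (rule ext) simp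
  then show ?thesis by (simp add: laplacian_def)
qed

lemma laplacian_cmult:
  assumes "real_polynomial_function f"
  shows "laplacian (\<lambda>x. c * f x) x = c * laplacian f x"
proof -
  have "gradient (\<lambda>x. c) x = 0" by (simp add: gradient_def vec_eq_iff)
  then show ?thesis using laplacian_mult[of "\<lambda>_. c" f x] assms by auto
qed

lemma gradient_inner [simp]: "gradient (\<lambda>y. y \<bullet> e) x = e"
  by (rule gradient_eqI) (auto intro!: derivative_eq_intros simp: inner_commute)

lemma gradient_inner_self [simp]: "gradient (\<lambda>y. y \<bullet> y) x = 2 *\<^sub>R x"
  by (rule gradient_eqI) (auto intro!: derivative_eq_intros simp: inner_commute)

lemma laplacian_inner [simp]: "laplacian (\<lambda>y. y \<bullet> e) x = 0"
proof -
  have "partial_deriv i (\<lambda>y. y \<bullet> e) = (\<lambda>y. e $ i)" for i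
    using gradient_inner[of e] by (metis gradient_nth)
  then show ?thesis by (simp add: laplacian_def)
qed

lemma laplacian_inner_self [simp]: "laplacian (\<lambda>y. y \<bullet> y) (x :: real^'m::finite) = 2 * real CARD('m)"
proof -
  have "partial_deriv i (\<lambda>y. y \<bullet> y) = (\<lambda>y :: real^'m. 2 * y $ i)" for i
    using gradient_inner_self by (metis gradient_nth vector_scaleR_component real_scaleR_def)
  moreover have "(\<lambda>y::real^'m. y $ i) differentiable (at y)" for i y
    by (simp add: bounded_linear_imp_differentiable bounded_linear_vec_nth)
  ultimately show ?thesis by (simp add: laplacian_def partial_deriv_cmult)
qed

text \<open>Homogenised Gegenbauer polynomials: the coefficient of \<open>r ^ k\<close> in \<open>(1 - 2 T r + R r\<^sup>2) powr (-\<nu>)\<close>.\<close>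

fun gegenbauer :: "real \<Rightarrow> real \<Rightarrow> real \<Rightarrow> nat \<Rightarrow> real" where
  "gegenbauer \<nu> T R 0 = 1"
| "gegenbauer \<nu> T R (Suc 0) = 2 * \<nu> * T"
| "gegenbauer \<nu> T R (Suc (Suc k)) =
     (2 * (real k + 1 + \<nu>) * (T * gegenbauer \<nu> T R (Suc k)) - (real k + 2 * \<nu>) * (R * gegenbauer \<nu> T R k)) / (real k + 2)"

text \<open>The arguments stand for T = y \<bullet> e and R = |y|^2, which scale with weights 1 and
  2.\<close>

lemma gegenbauer_homogeneous: "gegenbauer \<nu> (c * T) (c\<^sup>2 * R) k = c ^ k * gegenbauer \<nu> T R k"
  by (induction \<nu> T R k rule: gegenbauer.induct) (simp_all add: field_simps power2_eq_square)

lemma real_polynomial_function_gegenbauer: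
  "real_polynomial_function (\<lambda>y :: real^'m::finite. gegenbauer \<nu> (y \<bullet> e) (y \<bullet> y) k)"
\<comment> \<open>The zeros are placeholders: what is wanted from the induction rule is the two-step
  recursion in k.\<close>
proof (induction \<nu> "0::real" "0::real" k rule: gegenbauer.induct)
  case (3 \<nu> k)
  then show ?case unfolding gegenbauer.simps
    by (intro real_polynomial_function_divide real_polynomial_function_diff real_polynomial_function.intros(4)
        real_polynomial_function.intros(2) real_polynomial_function_inner real_polynomial_function_inner_self)
qed (auto intro: real_polynomial_function_inner)

text \<open>The Laplacian of the recursion involves the derivative in direction e, so harmonicity is
  carried through the induction together with the lowering rule for that derivative. The remaining
  terms cancel because the dimension is 2 \<nu> + 2, for which the generating function is the
  Newtonian kernel. Two consecutive degrees are stated at once because the recursion has two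
  steps.\<close>

lemma gegenbauer_solid_harmonic:
  fixes e :: "real^'m::finite"
  assumes e: "norm e = 1" and d: "real CARD('m) = 2 * \<nu> + 2"
  defines "C k \<equiv> \<lambda>y :: real^'m. gegenbauer \<nu> (y \<bullet> e) (y \<bullet> y) k"
  shows "e \<bullet> gradient (C (Suc k)) y = (real k + 2 * \<nu>) * C k y
     \<and> e \<bullet> gradient (C k) y = (real k - 1 + 2 * \<nu>) * (if k = 0 then 0 else C (k - 1) y)
     \<and> laplacian (C (Suc k)) y = 0 \<and> laplacian (C k) y = 0"
proof (induction k)
  have ee: "e \<bullet> e = 1" using e by (simp add: norm_eq_sqrt_inner)
  have dC: "C k differentiable (at y)" for k
    unfolding C_def by (intro differentiable_at_real_polynomial_function real_polynomial_function_gegenbauer)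
  have dT: "(\<lambda>y :: real^'m. y \<bullet> e) differentiable (at y)" "(\<lambda>y :: real^'m. y \<bullet> y) differentiable (at y)"
    by (intro differentiable_at_real_polynomial_function real_polynomial_function_inner real_polynomial_function_inner_self)+
  note pC = real_polynomial_function_gegenbauer[of \<nu> e]
  have C1: "C (Suc 0) = (\<lambda>y. 2 * \<nu> * (y \<bullet> e))" "C 0 = (\<lambda>y. 1)" by (simp_all add: C_def)
  {
    case 0
    have "gradient (C (Suc 0)) y = (2 * \<nu>) *\<^sub>R e"
      unfolding C1 by (rule gradient_eqI) (auto intro!: derivative_eq_intros simp: inner_commute)
    moreover have "laplacian (C (Suc 0)) y = 0"
      unfolding C1 by (subst laplacian_cmult) (auto intro: real_polynomial_function_inner)
    moreover have "gradient (C 0) y = 0" unfolding C1 by (rule gradient_eqI) simp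
    ultimately show ?case by (simp add: ee C1)
  next
    case (Suc k)
    define g1 g0 where "g1 = gradient (C (Suc k)) y" and "g0 = gradient (C k) y"
    define c1 c0 cm where "c1 = C (Suc k) y" and "c0 = C k y" and "cm = (if k = 0 then 0 else C (k - 1) y)"
    define T R where "T = y \<bullet> e" and "R = y \<bullet> y"
    define a b where "a = 2 * (real k + 1 + \<nu>) / (real k + 2)" and "b = - (real k + 2 * \<nu>) / (real k + 2)"
    have C2: "C (Suc (Suc k)) = (\<lambda>y. a * ((y \<bullet> e) * C (Suc k) y) + b * ((y \<bullet> y) * C k y))"
      by (rule ext) (simp add: C_def a_def b_def divide_simps; simp add: algebra_simps)
    have p1: "real_polynomial_function (\<lambda>y. (y \<bullet> e) * C (Suc k) y)"
      and p2: "real_polynomial_function (\<lambda>y. (y \<bullet> y) * C k y)"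
      and p: "real_polynomial_function (C j)" for j
      unfolding C_def by (intro real_polynomial_function.intros(4) pC real_polynomial_function_inner real_polynomial_function_inner_self)+
    have pp: "partial_deriv i (\<lambda>y. y \<bullet> e) y = e $ i" "partial_deriv i (\<lambda>y. y \<bullet> y) y = 2 * y $ i" for i
      using gradient_inner[of e y] gradient_inner_self[of y] by (metis gradient_nth vector_scaleR_component real_scaleR_def)+
    have G: "gradient (C (Suc (Suc k))) y = a *\<^sub>R (c1 *\<^sub>R e + T *\<^sub>R g1) + b *\<^sub>R ((2 * c0) *\<^sub>R y + R *\<^sub>R g0)"
    proof -
      have "partial_deriv i (C (Suc (Suc k))) y = a * (T * g1 $ i + e $ i * c1) + b * (R * g0 $ i + 2 * y $ i * c0)" for i
        unfolding C2 
        by (subst partial_deriv_add, (intro differentiable_mult differentiable_const dT dC)+,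
            subst partial_deriv_cmult, (intro differentiable_mult dT dC)+,
            subst partial_deriv_cmult, (intro differentiable_mult dT dC)+,
            subst partial_deriv_mult[OF dT(1) dC], subst partial_deriv_mult[OF dT(2) dC])
          (simp add: pp c1_def c0_def T_def R_def g1_def g0_def)
      then show ?thesis by (simp add: vec_eq_iff algebra_simps)
    qed
    have L: "laplacian (C (Suc (Suc k))) y = a * (2 * (e \<bullet> g1)) + b * (4 * (y \<bullet> g0) + 2 * real CARD('m) * c0)"
      unfolding C2
      by (subst laplacian_add[OF real_polynomial_function.intros(4)[OF real_polynomial_function.intros(2) p1]
             real_polynomial_function.intros(4)[OF real_polynomial_function.intros(2) p2]],
          subst laplacian_cmult[OF p1], subst laplacian_cmult[OF p2],
          subst laplacian_mult[OF real_polynomial_function_inner p],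
          subst laplacian_mult[OF real_polynomial_function_inner_self p])
        (use Suc.IH in \<open>simp add: g1_def g0_def c0_def c1_def\<close>)
    have hom: "C j (c *\<^sub>R y) = c ^ j * C j y" for c j
      using gegenbauer_homogeneous[of \<nu> c "y \<bullet> e" "y \<bullet> y" j] by (simp add: C_def power2_eq_square mult.assoc)
    have E: "y \<bullet> g0 = real k * c0" unfolding g0_def c0_def by (rule euler_homogeneous[OF dC hom])
    have I1: "e \<bullet> g1 = (real k + 2 * \<nu>) * c0" and I0: "e \<bullet> g0 = (real k - 1 + 2 * \<nu>) * cm"
      using Suc.IH by (simp_all add: g1_def g0_def c0_def cm_def)
    \<comment> \<open>The recursion one step lower; for k = 0 the value 0 of \<open>cm\<close>
      stands in for the missing degree -1.\<close>
    have key: "(real k + 1) * c1 = 2 * (real k + \<nu>) * (T * c0) - (real k - 1 + 2 * \<nu>) * (R * cm)"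
    proof (cases k)
      case (Suc j)
      have "real j + 2 \<noteq> 0" by linarith
      with Suc show ?thesis by (simp add: C_def c0_def c1_def cm_def T_def R_def field_simps)
    qed (simp add: C_def c0_def c1_def cm_def T_def R_def)
    have k2: "real k + 2 \<noteq> 0" by linarith
    have "(real k + 2) * (e \<bullet> gradient (C (Suc (Suc k))) y)
       = 2 * (real k + 1 + \<nu>) * (c1 + T * ((real k + 2 * \<nu>) * c0))
         - (real k + 2 * \<nu>) * (2 * c0 * T + R * ((real k - 1 + 2 * \<nu>) * cm))"
      unfolding G inner_add_right inner_scaleR_right I1 I0 ee a_def b_def T_def[symmetric] inner_commute[of e y]
      using k2 by (simp add: divide_simps) (simp add: algebra_simps)
    also have "\<dots> = 2 * (real k + 1 + \<nu>) * c1
         + (real k + 2 * \<nu>) * (2 * (real k + \<nu>) * (T * c0) - (real k - 1 + 2 * \<nu>) * (R * cm))"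
      by (simp add: algebra_simps)
    also have "\<dots> = (real k + 2) * ((real k + 1 + 2 * \<nu>) * c1)"
      unfolding key[symmetric] by (simp add: algebra_simps)
    finally have 1: "e \<bullet> gradient (C (Suc (Suc k))) y = (real k + 1 + 2 * \<nu>) * c1"
      using k2 mult_left_cancel by blast
    have 2: "laplacian (C (Suc (Suc k))) y = 0"
      unfolding L E I1 d a_def b_def by (simp add: field_simps)
    show ?case using 1 2 Suc.IH by (simp add: c1_def add_ac)
  }
qed

text \<open>The factor is (k + \<nu>) / \<nu> with \<nu> = (n - 1) / 2, the normalisation for which
  the series in r sums to the Poisson kernel. Divided by the area of the sphere, this is the
  reproducing kernel of the harmonics of degree k.\<close>

definition zonal_harmonic :: "nat \<Rightarrow> nat \<Rightarrow> real \<Rightarrow> real \<Rightarrow> real" where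
  "zonal_harmonic n k T R = (1 + 2 * real k / (real n - 1)) * gegenbauer ((real n - 1) / 2) T R k"

lemma zonal_harmonic_in_spherical_harmonics:
  fixes e :: "real^'m::finite"
  assumes "norm e = 1" "CARD('m) = n + 1"
  shows "(\<lambda>y. zonal_harmonic n k (y \<bullet> e) (y \<bullet> y)) \<in> spherical_harmonics k"
proof -
  have d: "real CARD('m) = 2 * ((real n - 1) / 2) + 2"
    unfolding assms(2) by (simp add: field_simps)
  note p = real_polynomial_function_gegenbauer[of "(real n - 1) / 2" e k]
  show ?thesis
    using gegenbauer_solid_harmonic[OF assms(1) d] p
      gegenbauer_homogeneous[of "(real n - 1) / 2" c "y \<bullet> e" "y \<bullet> y" k for c y]
    by (auto simp: spherical_harmonics_def zonal_harmonic_def laplacian_cmult power2_eq_square mult.assoc)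
qed

text \<open>These are the coefficients of (1 - w)^(-\<nu>). Consecutive ones have ratio (\<nu> + j)
  / (j + 1), which Bernoulli's inequality bounds by ((j + 2) / (j + 1))^M, and the product of these
  bounds telescopes.\<close>

lemma gegenbauer_coeff_bound:
  assumes "0 \<le> \<nu>" "\<nu> \<le> real M"
  shows "0 \<le> pochhammer \<nu> j / fact j" "pochhammer \<nu> j / fact j \<le> (real j + 1) ^ M"
proof -
  show nn: "0 \<le> pochhammer \<nu> j / fact j" for j
    using assms by (auto simp: pochhammer_prod intro!: divide_nonneg_pos prod_nonneg)
  show "pochhammer \<nu> j / fact j \<le> (real j + 1) ^ M"
  proof (induction j)
    case (Suc j)
    have "pochhammer \<nu> (Suc j) / fact (Suc j) = pochhammer \<nu> j / fact j * ((\<nu> + real j) / (real j + 1))"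
      by (simp add: pochhammer_Suc divide_simps)
    also have "\<dots> \<le> (real j + 1) ^ M * (1 + 1 / (real j + 1)) ^ M"
    proof (rule mult_mono[OF Suc.IH])
      have "(\<nu> + real j) / (real j + 1) \<le> 1 + real M * (1 / (real j + 1))"
        using assms by (simp add: divide_simps)
      also have "\<dots> \<le> (1 + 1 / (real j + 1)) ^ M"
        by (rule Bernoulli_inequality) (simp add: order_trans[of _ 0])
      finally show "(\<nu> + real j) / (real j + 1) \<le> (1 + 1 / (real j + 1)) ^ M" .
    qed (use assms in auto)
    also have "\<dots> = (real (Suc j) + 1) ^ M"
    proof -
      have "(real j + 1) * (1 + 1 / (real j + 1)) = real (Suc j) + 1" by (simp add: field_simps)
      then show ?thesis by (metis power_mult_distrib)
    qed
    finally show ?case .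
  qed simp
qed

text \<open>For t = Re z with |z| = 1 the quadratic 1 - 2 t r + r^2 factors as (1 - z r) (1 - r /
  z), so its power -\<nu> is a product of two binomial series. The argument is formal: the product
  satisfies a first-order differential equation whose coefficients obey the recursion of
  \<open>gegenbauer\<close>.\<close>

lemma gegenbauer_eq_sum:
  fixes t :: real
  assumes t: "\<bar>t\<bar> \<le> 1"
  obtains z :: complex where "norm z = 1" "Re z = t"
    "\<And>k. of_real (gegenbauer \<nu> t 1 k) = (\<Sum>j\<le>k. of_real (pochhammer \<nu> j / fact j) * z ^ j
        * (of_real (pochhammer \<nu> (k - j) / fact (k - j)) * cnj z ^ (k - j)))"
proof -
  define z where "z = cis (arccos t)"
  have z: "norm z = 1" "Re z = t" using t by (auto simp: z_def cos_arccos_abs)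
  have zz: "z + cnj z = 2 * of_real t" "z * cnj z = 1"
    using z by (auto simp: complex_add_cnj complex_norm_square[symmetric])
  define A where "A j = (of_real (pochhammer \<nu> j / fact j) :: complex)" for j
  have A: "of_nat (Suc j) * A (Suc j) = (of_real \<nu> + of_nat j) * A j" for j
    by (simp add: A_def pochhammer_Suc divide_simps del: of_nat_Suc)
  define F where "F w = Abs_fps (\<lambda>j. A j * w ^ j)" for w :: complex
  \<comment> \<open>The logarithmic derivative of the binomial series (1 - w X)^(-\<nu>), cleared of
    denominators.\<close>
  have F: "(1 - fps_const w * fps_X) * fps_deriv (F w) = fps_const (of_real \<nu> * w) * F w" for w
  proof (rule fps_ext)
    fix m
    show "fps_nth ((1 - fps_const w * fps_X) * fps_deriv (F w)) m = fps_nth (fps_const (of_real \<nu> * w) * F w) m"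
    proof (cases m)
      case 0 then show ?thesis using A[of 0] by (simp add: F_def algebra_simps)
    next
      case (Suc j)
      have "of_nat (Suc m) * A (Suc m) * w ^ Suc m - w * (of_nat m * A m * w ^ m) = of_real \<nu> * w * (A m * w ^ m)"
        unfolding A[of m] by (simp add: algebra_simps)
      then show ?thesis using Suc
        by (simp add: F_def algebra_simps fps_mult_left_const_nth)
    qed
  qed
  define H where "H = F z * F (cnj z)"
  have D: "(1 - fps_const z * fps_X) * (1 - fps_const (cnj z) * fps_X) = 1 - fps_const (2 * of_real t) * fps_X + fps_X ^ 2"
  proof -
    have "(1 - fps_const z * fps_X) * (1 - fps_const (cnj z) * fps_X)
      = 1 - (fps_const z + fps_const (cnj z)) * fps_X + (fps_const z * fps_const (cnj z)) * fps_X ^ 2"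
      by (simp add: algebra_simps power2_eq_square)
    then show ?thesis by (simp add: zz)
  qed
  have alg1: "(1 - a * x) * (1 - b * x) * (f' * g + f * g') = (1 - b * x) * ((1 - a * x) * f') * g + (1 - a * x) * ((1 - b * x) * g') * f"
    for a b x f g f' g' :: "complex fps" by (simp add: algebra_simps)
  have alg2: "(1 - b * x) * (N * a * f) * g + (1 - a * x) * (N * b * g) * f = N * ((a + b) - 2 * (a * b) * x) * (f * g)"
    for a b x f g N :: "complex fps" by (simp add: algebra_simps)
  have "(1 - fps_const (2 * of_real t) * fps_X + fps_X ^ 2) * fps_deriv H
      = (1 - fps_const (cnj z) * fps_X) * ((1 - fps_const z * fps_X) * fps_deriv (F z)) * F (cnj z)
        + (1 - fps_const z * fps_X) * ((1 - fps_const (cnj z) * fps_X) * fps_deriv (F (cnj z))) * F z"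
    unfolding D[symmetric] H_def fps_deriv_mult by (subst alg1[symmetric]) (simp add: add.commute)
  also have "\<dots> = fps_const (of_real \<nu>) * ((fps_const z + fps_const (cnj z)) - 2 * (fps_const z * fps_const (cnj z)) * fps_X) * H"
    unfolding F fps_const_mult[symmetric] alg2 H_def ..
  also have "\<dots> = fps_const (of_real \<nu>) * (fps_const (2 * of_real t) - fps_const 2 * fps_X) * H"
    by (simp add: zz numeral_fps_const)
  finally have ODE: "(1 - fps_const (2 * of_real t) * fps_X + fps_X ^ 2) * fps_deriv H
     = fps_const (of_real \<nu>) * (fps_const (2 * of_real t) - fps_const 2 * fps_X) * H" .
  have H01: "fps_nth H 0 = 1" "fps_nth H 1 = 2 * of_real \<nu> * of_real t"
  proof -
    show "fps_nth H 0 = 1" by (simp add: H_def F_def A_def)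
    then show "fps_nth H 1 = 2 * of_real \<nu> * of_real t"
      using arg_cong[OF ODE, of "\<lambda>f. fps_nth f 0"] by simp
  qed
  \<comment> \<open>Coefficient k + 1 of the differential equation, which is the defining recursion
    at R = 1.\<close>
  have rec: "of_nat (k + 2) * fps_nth H (k + 2) = 2 * of_real (real k + 1 + \<nu>) * of_real t * fps_nth H (k + 1) - of_real (real k + 2 * \<nu>) * fps_nth H k" for k
  proof -
    have "fps_nth ((1 - fps_const (2 * of_real t) * fps_X + fps_X ^ 2) * fps_deriv H) (k+1)
       = of_nat (k+2) * fps_nth H (k+2) - 2 * of_real t * (of_nat (k+1) * fps_nth H (k+1)) + of_nat k * fps_nth H k"
      by (cases k) (simp_all add: distrib_right left_diff_distrib fps_mult_left_const_nth mult.assoc fps_X_power_mult_nth numeral_2_eq_2)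
    moreover have "fps_nth (fps_const (of_real \<nu>) * (fps_const (2 * of_real t) - fps_const 2 * fps_X) * H) (k+1)
       = 2 * of_real \<nu> * (of_real t * fps_nth H (k+1) - fps_nth H k)"
      by (simp add: mult.assoc left_diff_distrib)
    ultimately show ?thesis unfolding ODE by (simp add: algebra_simps)
  qed
  have "of_real (gegenbauer \<nu> t 1 k) = fps_nth H k" for k
  proof (induction k rule: induct_nat_012)
    case (ge2 k)
    have "(real k + 2) * gegenbauer \<nu> t 1 (k + 2)
      = 2 * (real k + 1 + \<nu>) * t * gegenbauer \<nu> t 1 (k + 1) - (real k + 2 * \<nu>) * gegenbauer \<nu> t 1 k"
      by (simp add: add_pos_nonneg[THEN less_imp_neq, symmetric])
    from arg_cong[OF this, of complex_of_real]
    have "of_nat (k + 2) * of_real (gegenbauer \<nu> t 1 (k + 2)) = of_nat (k + 2) * fps_nth H (k + 2)"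
      unfolding rec using ge2 by (simp add: add.commute del: gegenbauer.simps)
    moreover have "(of_nat (k + 2) :: complex) \<noteq> 0" by (subst of_nat_eq_0_iff) simp
    ultimately have "of_real (gegenbauer \<nu> t 1 (k + 2)) = fps_nth H (k + 2)" using mult_left_cancel by blast
    then show ?case by (simp del: gegenbauer.simps)
  qed (use H01 in \<open>simp_all\<close>)
  moreover have "fps_nth H k = (\<Sum>j\<le>k. A j * z ^ j * (A (k - j) * cnj z ^ (k - j)))" for k
    by (simp add: H_def F_def fps_mult_nth atMost_atLeast0)
  ultimately show thesis using that z unfolding A_def by simp
qed

text \<open>The binomial coefficients are nonnegative and z has modulus one, so each of the k + 1
  terms of the Cauchy product is at most (k + 1)^(2 M).\<close>

lemma gegenbauer_bound:
  assumes "\<bar>t\<bar> \<le> 1" "0 \<le> \<nu>" "\<nu> \<le> real M"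
  shows "\<bar>gegenbauer \<nu> t 1 k\<bar> \<le> (real k + 1) ^ (2 * M + 1)"
proof -
  define A where "A j = pochhammer \<nu> j / fact j" for j
  note Ab = gegenbauer_coeff_bound[OF assms(2,3), folded A_def]
  obtain z :: complex where z: "norm z = 1" 
    "\<And>k. of_real (gegenbauer \<nu> t 1 k) = (\<Sum>j\<le>k. of_real (A j) * z ^ j * (of_real (A (k - j)) * cnj z ^ (k - j)))"
    by (rule gegenbauer_eq_sum[OF assms(1), of \<nu>, folded A_def]) (rule that)
  have "\<bar>gegenbauer \<nu> t 1 k\<bar> = norm (\<Sum>j\<le>k. of_real (A j) * z ^ j * (of_real (A (k - j)) * cnj z ^ (k - j)))"
    unfolding z(2)[symmetric] by simp
  also have "\<dots> \<le> (\<Sum>j\<le>k. A j * A (k - j))"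
    by (rule order_trans[OF norm_sum]) (auto intro!: sum_mono simp: norm_mult norm_power z Ab)
  also have "\<dots> \<le> (\<Sum>j\<le>k. (real k + 1) ^ M * (real k + 1) ^ M)"
    by (intro sum_mono mult_mono order_trans[OF Ab(2)] power_mono) (auto simp: Ab)
  also have "\<dots> = (real k + 1) ^ (2 * M + 1)" by (simp add: power_add mult_2 flip: power_mult_distrib)
  finally show ?thesis .
qed

text \<open>The convergent counterpart of the formal factorisation: both binomial series converge
  absolutely for |r| < 1, and their sums are complex conjugates, so the product is a squared
  modulus.\<close>

lemma gegenbauer_generating_function:
  assumes t: "\<bar>t\<bar> \<le> 1" and r: "\<bar>r\<bar> < 1"
  shows "(\<lambda>k. gegenbauer \<nu> t 1 k * r ^ k) sums ((1 - 2 * r * t + r\<^sup>2) powr (- \<nu>))"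
proof -
  define A where "A j = pochhammer \<nu> j / fact j" for j
  obtain z :: complex where z: "norm z = 1" "Re z = t"
    "\<And>k. of_real (gegenbauer \<nu> t 1 k) = (\<Sum>j\<le>k. of_real (A j) * z ^ j * (of_real (A (k - j)) * cnj z ^ (k - j)))"
    by (rule gegenbauer_eq_sum[OF t, of \<nu>, folded A_def]) (rule that)
  have A: "((- of_real \<nu>) gchoose j) * (- w) ^ j = of_real (A j) * w ^ j" for j and w :: complex
  proof -
    have "(-1) ^ j * (-1) ^ j = (1 :: complex)" by (simp flip: power_mult_distrib)
    then have "(-1) ^ j * pochhammer (of_real \<nu>) j / fact j * ((-1) ^ j * w ^ j) = pochhammer (of_real \<nu>) j / fact j * w ^ j"
      by (metis (no_types, lifting) mult.assoc mult.left_commute mult_1 times_divide_eq_left times_divide_eq_right)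
    then show ?thesis
      unfolding A_def gbinomial_pochhammer power_minus[of w] by (simp add: pochhammer_of_real)
  qed
  have S: "(\<lambda>j. of_real (A j) * w ^ j) sums ((1 - w) powr (- of_real \<nu>))" 
    "summable (\<lambda>j. norm (of_real (A j) * w ^ j))" if w: "norm w < 1" for w :: complex
  proof -
    have s: "(\<lambda>j. of_real (A j) * w ^ j) sums ((1 - w) powr (- of_real \<nu>))" if "norm w < 1" for w :: complex
      using gen_binomial_complex[of "- w" "- of_real \<nu>"] that by (simp add: A)
    then show "(\<lambda>j. of_real (A j) * w ^ j) sums ((1 - w) powr (- of_real \<nu>))" using w .
    obtain \<rho> where \<rho>: "norm w < \<rho>" "\<rho> < 1" using w dense by blast
    then have "summable (\<lambda>j. of_real (A j) * of_real \<rho> ^ j :: complex)"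
      using s[of "of_real \<rho>"] norm_ge_zero[of w] by (auto simp: sums_iff)
    then show "summable (\<lambda>j. norm (of_real (A j) * w ^ j))"
      by (rule powser_insidea) (use \<rho> norm_ge_zero[of w] in auto)
  qed
  have n1: "norm (z * of_real r) < 1" "norm (cnj z * of_real r) < 1" using r z by (auto simp: norm_mult)
  have "(\<lambda>k. \<Sum>j\<le>k. (of_real (A j) * (z * of_real r) ^ j) * (of_real (A (k - j)) * (cnj z * of_real r) ^ (k - j)))
     sums ((\<Sum>j. of_real (A j) * (z * of_real r) ^ j) * (\<Sum>j. of_real (A j) * (cnj z * of_real r) ^ j))"
    by (rule Cauchy_product_sums[OF S(2)[OF n1(1)] S(2)[OF n1(2)]])
  also have "(\<Sum>j. of_real (A j) * (z * of_real r) ^ j) = (1 - z * of_real r) powr (- of_real \<nu>)"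
    using S(1)[OF n1(1)] by (rule sums_unique[symmetric])
  also have "(\<Sum>j. of_real (A j) * (cnj z * of_real r) ^ j) = (1 - cnj z * of_real r) powr (- of_real \<nu>)"
    using S(1)[OF n1(2)] by (rule sums_unique[symmetric])
  also have "(1 - z * of_real r) powr (- of_real \<nu>) * (1 - cnj z * of_real r) powr (- of_real \<nu>)
     = of_real ((1 - 2 * r * t + r\<^sup>2) powr (- \<nu>))"
  proof -
    define w where "w = 1 - z * of_real r"
    have "\<bar>t * r\<bar> \<le> \<bar>r\<bar>" using t by (simp add: abs_mult mult_left_le_one_le)
    \<comment> \<open>A positive real part keeps w off the branch cut, which lets conjugation pass
      through \<open>powr\<close>.\<close>
    then have Re: "Re w > 0" using z r by (simp add: w_def)
    then have w0: "w \<noteq> 0" by auto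
    have "(1 - cnj z * of_real r) powr (- of_real \<nu>) = cnj (w powr (- of_real \<nu>))"
      using Re by (subst cnj_powr) (auto simp: w_def complex_nonpos_Reals_iff)
    then have "w powr (- of_real \<nu>) * (1 - cnj z * of_real r) powr (- of_real \<nu>) = of_real ((norm (w powr (- of_real \<nu>)))\<^sup>2)"
      unfolding complex_norm_square by simp
    also have "norm (w powr (- of_real \<nu>)) = norm w powr (- \<nu>)"
      using w0 by (simp add: powr_def)
    also have "(norm w powr (- \<nu>))\<^sup>2 = ((norm w)\<^sup>2) powr (- \<nu>)"
      using w0 by (simp add: power2_eq_square powr_mult)
    also have "(norm w)\<^sup>2 = 1 - 2 * r * t + r\<^sup>2"
    proof -
      have "(Re z)\<^sup>2 + (Im z)\<^sup>2 = 1" using z(1) by (metis cmod_power2 one_power2)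
      then have "r\<^sup>2 * ((Re z)\<^sup>2 + (Im z)\<^sup>2) = r\<^sup>2" by simp
      then show ?thesis using z(2) unfolding w_def cmod_power2 by (simp add: power2_eq_square algebra_simps)
    qed
    finally show ?thesis by (simp add: w_def)
  qed
  also have "(\<lambda>k. \<Sum>j\<le>k. (of_real (A j) * (z * of_real r) ^ j) * (of_real (A (k - j)) * (cnj z * of_real r) ^ (k - j)))
     = (\<lambda>k. of_real (gegenbauer \<nu> t 1 k * r ^ k))"
  proof
    fix k
    have "of_real (A j) * (z * of_real r) ^ j * (of_real (A (k - j)) * (cnj z * of_real r) ^ (k - j))
       = of_real (A j) * z ^ j * (of_real (A (k - j)) * cnj z ^ (k - j)) * of_real r ^ k" if "j \<le> k" for j
    proof -
      have "(of_real r :: complex) ^ k = of_real r ^ j * of_real r ^ (k - j)" using that by (simp flip: power_add)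
      then show ?thesis by (simp add: power_mult_distrib)
    qed
    then show "(\<Sum>j\<le>k. of_real (A j) * (z * of_real r) ^ j * (of_real (A (k - j)) * (cnj z * of_real r) ^ (k - j)))
       = complex_of_real (gegenbauer \<nu> t 1 k * r ^ k)"
      unfolding of_real_mult z(3) of_real_power sum_distrib_right by (intro sum.cong refl) auto
  qed
  finally show ?thesis by (simp only: sums_of_real_iff)
qed

text \<open>With t = x \<bullet> e the base is |x - r e|^2, so this is the Poisson kernel of the
  unit ball of dimension n + 1, multiplied by the area of its boundary.\<close>

definition poisson_kernel :: "nat \<Rightarrow> real \<Rightarrow> real \<Rightarrow> real" where
  "poisson_kernel n r t = (1 - r\<^sup>2) * (1 - 2 * r * t + r\<^sup>2) powr (- ((real n + 1) / 2))"

lemma poisson_base_pos: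
  fixes t r :: real
  assumes "\<bar>t\<bar> \<le> 1" "\<bar>r\<bar> < 1" shows "0 < 1 - 2 * r * t + r\<^sup>2"
proof -
  have "\<bar>r * t\<bar> \<le> \<bar>r\<bar>" using assms by (simp add: abs_mult mult_left_le)
  then have "1 - 2 * r * t + r\<^sup>2 \<ge> 1 - 2 * \<bar>r\<bar> + \<bar>r\<bar>\<^sup>2" by simp
  moreover have "1 - 2 * \<bar>r\<bar> + \<bar>r\<bar>\<^sup>2 = (1 - \<bar>r\<bar>)\<^sup>2" by (simp add: power2_eq_square algebra_simps)
  moreover have "(1 - \<bar>r\<bar>)\<^sup>2 > 0" using assms by simp
  ultimately show ?thesis by linarith
qed

text \<open>The Poisson kernel is \<open>N + r N' / \<nu>\<close> with the Newtonian kernel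
  \<open>N = (1 - 2 r t + r\<^sup>2) powr (-\<nu>)\<close>, \<open>\<nu> = (n - 1) / 2\<close>.\<close>

lemma poisson_kernel_sums:
  assumes t: "\<bar>t\<bar> \<le> 1" and r: "\<bar>r\<bar> < 1" and n: "n \<ge> 2"
  shows "(\<lambda>k. zonal_harmonic n k t 1 * r ^ k) sums poisson_kernel n r t"
proof -
  define \<nu> where "\<nu> = (real n - 1) / 2"
  have \<nu>: "\<nu> > 0" using n by (simp add: \<nu>_def)
  define c where "c k = gegenbauer \<nu> t 1 k" for k
  define D where "D r = 1 - 2 * r * t + r\<^sup>2" for r
  have D: "D r > 0" using poisson_base_pos[OF t r] by (simp add: D_def)
  have s: "(\<lambda>k. c k * r ^ k) sums (D r powr (- \<nu>))" if "norm r < 1" for r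
    using gegenbauer_generating_function[OF t, of r \<nu>] that by (simp add: c_def D_def)
  have der: "((\<lambda>r. D r powr (- \<nu>)) has_field_derivative (- \<nu> * D r powr (- \<nu> - 1) * (2 * r - 2 * t))) (at r)"
    using D unfolding D_def by (auto intro!: derivative_eq_intros simp: field_simps powr_diff)
  have "(\<lambda>k. diffs c k * r ^ k) sums (- \<nu> * D r powr (- \<nu> - 1) * (2 * r - 2 * t))"
    by (rule termdiffs_sums_strong[of 1, OF s der]) (use r in auto)
  from sums_mult[OF this, of r] have "(\<lambda>k. real (Suc k) * c (Suc k) * r ^ Suc k) sums (r * (- \<nu> * D r powr (- \<nu> - 1) * (2 * r - 2 * t)))"
    by (simp add: diffs_def mult_ac)
  then have "(\<lambda>k. real k * c k * r ^ k) sums (r * (- \<nu> * D r powr (- \<nu> - 1) * (2 * r - 2 * t)))"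
    by (subst (asm) sums_Suc_iff) simp
  from sums_add[OF s[of r] sums_mult[OF this, of "1 / \<nu>"]]
  have 1: "(\<lambda>k. (1 + real k / \<nu>) * c k * r ^ k) sums (D r powr (- \<nu>) + 1 / \<nu> * (r * (- \<nu> * D r powr (- \<nu> - 1) * (2 * r - 2 * t))))"
    using r by (simp add: algebra_simps)
  have "D r powr (- \<nu>) = D r * D r powr (- \<nu> - 1)"
    using D by (simp add: powr_diff)
  then have "D r powr (- \<nu>) + 1 / \<nu> * (r * (- \<nu> * D r powr (- \<nu> - 1) * (2 * r - 2 * t))) = (D r - r * (2 * r - 2 * t)) * D r powr (- \<nu> - 1)"
    using \<nu> by (simp add: algebra_simps)
  moreover have "D r - r * (2 * r - 2 * t) = 1 - r\<^sup>2" by (simp add: D_def power2_eq_square algebra_simps)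
  moreover have "- \<nu> - 1 = - ((real n + 1) / 2)" by (simp add: \<nu>_def field_simps)
  ultimately have 2: "D r powr (- \<nu>) + 1 / \<nu> * (r * (- \<nu> * D r powr (- \<nu> - 1) * (2 * r - 2 * t))) = poisson_kernel n r t"
    by (simp only: poisson_kernel_def D_def)
  have "(\<lambda>k. (1 + real k / \<nu>) * c k * r ^ k) = (\<lambda>k. zonal_harmonic n k t 1 * r ^ k)"
    by (simp add: zonal_harmonic_def c_def \<nu>_def mult.commute)
  with 1 show ?thesis unfolding 2 by metis
qed

text \<open>A crude bound, taking M = n above (n - 1) / 2; the summability arguments draw on
  polynomial growth in k.\<close>

lemma zonal_harmonic_bound:
  assumes n: "n \<ge> 2" and t: "\<bar>t\<bar> \<le> 1"
  shows "\<bar>zonal_harmonic n k t 1\<bar> \<le> 2 * (real k + 1) ^ (2 * n + 2)"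
proof -
  have "2 * real k / (real n - 1) \<le> 2 * real k / 1" using n by (intro divide_left_mono) auto
  then have "1 + 2 * real k / (real n - 1) \<le> 2 * (real k + 1)" by simp
  moreover have "\<bar>gegenbauer ((real n - 1) / 2) t 1 k\<bar> \<le> (real k + 1) ^ (2 * n + 1)"
    by (rule gegenbauer_bound[OF t]) (use n in auto)
  ultimately have "\<bar>zonal_harmonic n k t 1\<bar> \<le> (2 * (real k + 1)) * (real k + 1) ^ (2 * n + 1)"
    using n unfolding zonal_harmonic_def abs_mult by (intro mult_mono) auto
  then show ?thesis by (simp add: algebra_simps)
qed


section \<open>Parameter integrals of polynomials\<close>

text \<open>Polynomials in both variables form a class closed under differentiation in y. The last
  clause supplies the differentiability of the slices that the sum and product rules require in the
  induction.\<close>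

lemma real_polynomial_function_partial_deriv_fst:
  fixes P :: "(real^'m::finite) \<times> 'b::real_normed_vector \<Rightarrow> real"
  assumes "real_polynomial_function P"
  shows "\<exists>Q. real_polynomial_function Q \<and> (\<forall>y x. partial_deriv i (\<lambda>y. P (y, x)) y = Q (y, x))
     \<and> (\<forall>x. real_polynomial_function (\<lambda>y. P (y, x)))"
  using assms
proof (induction rule: real_polynomial_function.induct)
  case (linear f)
  interpret bounded_linear f by fact
  have split: "f (y, x) = f (y, 0) + f (0, x)" for y x by (simp flip: add)
  have b: "bounded_linear (\<lambda>y. f (y, 0))"
    by (rule bounded_linear_compose[OF bounded_linear_axioms]) (rule bounded_linear_Pair[OF bounded_linear_ident bounded_linear_zero])
  have p: "real_polynomial_function (\<lambda>y. f (y, x))" for x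
    by (subst split) (intro real_polynomial_function.intros b)
  have "partial_deriv i (\<lambda>y. f (y, x)) y = f (axis i 1, 0)" for x y
  proof -
    have "((\<lambda>y. f (y, x)) has_derivative (\<lambda>h. f (h, 0))) (at y)"
      by (subst split) (auto intro!: derivative_eq_intros bounded_linear_imp_has_derivative b)
    then show ?thesis by (rule partial_deriv_eqI)
  qed
  with p show ?case by (intro exI[of _ "\<lambda>_. f (axis i 1, 0)"]) auto
next
  case (const c)
  show ?case by (intro exI[of _ "\<lambda>_. 0"]) auto
next
  case (add f g)
  then obtain F G where FG: "real_polynomial_function F" "real_polynomial_function G"
     "\<And>y x. partial_deriv i (\<lambda>y. f (y, x)) y = F (y, x)" "\<And>y x. partial_deriv i (\<lambda>y. g (y, x)) y = G (y, x)"
     "\<And>x. real_polynomial_function (\<lambda>y. f (y, x))" "\<And>x. real_polynomial_function (\<lambda>y. g (y, x))" by blast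
  then show ?case
    by (intro exI[of _ "\<lambda>p. F p + G p"])
      (auto simp: partial_deriv_add differentiable_at_real_polynomial_function)
next
  case (mult f g)
  then obtain F G where FG: "real_polynomial_function F" "real_polynomial_function G"
     "\<And>y x. partial_deriv i (\<lambda>y. f (y, x)) y = F (y, x)" "\<And>y x. partial_deriv i (\<lambda>y. g (y, x)) y = G (y, x)"
     "\<And>x. real_polynomial_function (\<lambda>y. f (y, x))" "\<And>x. real_polynomial_function (\<lambda>y. g (y, x))" by blast
  with mult show ?case
    by (intro exI[of _ "\<lambda>p. f p * G p + F p * g p"])
      (auto simp: partial_deriv_mult differentiable_at_real_polynomial_function)
qed

text \<open>The derivative of the parameter integral is returned in the same form, with a new
  polynomial Q, so that the rule can be iterated for second derivatives.\<close>

lemma partial_deriv_integral_sphere_polynomial: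
  fixes P :: "(real^'m::finite) \<times> (real^'m) \<Rightarrow> real"
  assumes P: "real_polynomial_function P" and w: "continuous_on (sphere 0 1) w"
  shows "\<exists>Q. real_polynomial_function Q \<and> (\<forall>y x. partial_deriv i (\<lambda>y. P (y, x)) y = Q (y, x))
     \<and> (\<forall>y. partial_deriv i (\<lambda>y. \<integral>x. P (y, x) * w x \<partial>sphere_measure) y = (\<integral>x. Q (y, x) * w x \<partial>sphere_measure))"
proof -
  obtain Q where Q: "\<And>j. real_polynomial_function (Q j)" "\<And>j y x. partial_deriv j (\<lambda>y. P (y, x)) y = Q j (y, x)"
    using real_polynomial_function_partial_deriv_fst[OF P] by metis
  have PP: "\<And>x. real_polynomial_function (\<lambda>y. P (y, x))"
    using real_polynomial_function_partial_deriv_fst[OF P] by metis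
  define g where "g y x = (\<chi> j. Q j (y, x) * w x)" for y x
  have cP: "continuous_on X P" and cQ: "continuous_on X (Q j)" for X j
    using P Q(1) by (simp_all add: continuous_on_polymonial_function real_polynomial_function_eq)
  have cw: "continuous_on (UNIV \<times> sphere 0 1) (\<lambda>p::(real^'m) \<times> (real^'m). w (snd p))"
    by (rule continuous_on_compose2[OF w]) (auto intro!: continuous_intros)
  have cQP: "continuous_on (UNIV \<times> sphere 0 1) (\<lambda>(y, x). g y x)"
    unfolding g_def split_beta' by (intro continuous_on_vec_lambda continuous_on_mult cw) (simp add: cQ)
  have cg: "continuous_on (sphere 0 1) (\<lambda>x. Q i (y, x) * w x)" for y i
    by (intro continuous_on_mult w continuous_on_compose2[OF cQ[of UNIV]] continuous_intros) auto
  have D: "((\<lambda>y. \<integral>x. P (y, x) * w x \<partial>sphere_measure) has_derivative (\<lambda>h. (\<integral>x. g y x \<partial>sphere_measure) \<bullet> h)) (at y)" for y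
  proof (rule has_derivative_integral_sphere[where S=UNIV])
    show "continuous_on (sphere 0 1) (\<lambda>x. P (y, x) * w x)" for y
      by (intro continuous_on_mult w continuous_on_compose2[OF cP[of UNIV]] continuous_intros) auto
    fix y x
    have "gradient (\<lambda>y. P (y, x)) y = (\<chi> j. Q j (y, x))" by (simp add: gradient_def Q)
    then have "((\<lambda>y. P (y, x)) has_derivative (\<lambda>h. (\<chi> j. Q j (y, x)) \<bullet> h)) (at y)"
      using has_derivative_gradient[OF differentiable_at_real_polynomial_function[OF PP]] by metis
    from has_derivative_mult_left[OF this, of "w x"]
    have "((\<lambda>y. P (y, x) * w x) has_derivative (\<lambda>h. (\<chi> j. Q j (y, x)) \<bullet> h * w x)) (at y)" .
    moreover have "(\<lambda>h. (\<chi> j. Q j (y, x)) \<bullet> h * w x) = (\<lambda>h. g y x \<bullet> h)"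
      by (simp add: g_def inner_vec_def sum_distrib_left mult_ac)
    ultimately show "((\<lambda>y. P (y, x) * w x) has_derivative (\<lambda>h. g y x \<bullet> h)) (at y)" by simp
  qed (use cQP in auto)
  have "partial_deriv i (\<lambda>y. \<integral>x. P (y, x) * w x \<partial>sphere_measure) y = (\<integral>x. g y x \<partial>sphere_measure) $ i" for y
    unfolding partial_deriv_eqI[OF D] by (simp add: inner_axis)
  moreover have "(\<integral>x. g y x \<partial>sphere_measure) $ i = (\<integral>x. Q i (y, x) * w x \<partial>sphere_measure)" for y
  proof -
    have "(\<integral>x. g y x \<partial>sphere_measure) $ i = (\<integral>x. g y x $ i \<partial>sphere_measure)"
      by (rule integral_bounded_linear[OF bounded_linear_vec_nth, symmetric])
        (auto simp: g_def intro!: integrable_sphere_continuous continuous_on_vec_lambda cg)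
    then show ?thesis by (simp add: g_def)
  qed
  ultimately show ?thesis using Q by auto
qed

lemma laplacian_integral_sphere_polynomial:
  fixes P :: "(real^'m::finite) \<times> (real^'m) \<Rightarrow> real"
  assumes P: "real_polynomial_function P" and w: "continuous_on (sphere 0 1) w"
  shows "laplacian (\<lambda>y. \<integral>x. P (y, x) * w x \<partial>sphere_measure) y
     = (\<integral>x. laplacian (\<lambda>y. P (y, x)) y * w x \<partial>sphere_measure)"
proof -
  obtain Q where Q: "\<And>i. real_polynomial_function (Q i)" "\<And>i y x. partial_deriv i (\<lambda>y. P (y, x)) y = Q i (y, x)"
    "\<And>i y. partial_deriv i (\<lambda>y. \<integral>x. P (y, x) * w x \<partial>sphere_measure) y = (\<integral>x. Q i (y, x) * w x \<partial>sphere_measure)"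
    using partial_deriv_integral_sphere_polynomial[OF P w] by metis
  have "\<forall>i. \<exists>R. real_polynomial_function R \<and> (\<forall>y x. partial_deriv i (\<lambda>y. Q i (y, x)) y = R (y, x))
     \<and> (\<forall>y. partial_deriv i (\<lambda>y. \<integral>x. Q i (y, x) * w x \<partial>sphere_measure) y = (\<integral>x. R (y, x) * w x \<partial>sphere_measure))"
    using partial_deriv_integral_sphere_polynomial[OF Q(1) w] by metis
  then obtain R where R: "\<And>i. real_polynomial_function (R i)" "\<And>i y x. partial_deriv i (\<lambda>y. Q i (y, x)) y = R i (y, x)"
    "\<And>i y. partial_deriv i (\<lambda>y. \<integral>x. Q i (y, x) * w x \<partial>sphere_measure) y = (\<integral>x. R i (y, x) * w x \<partial>sphere_measure)"
    by metis
  have cR: "continuous_on UNIV (R i)" for i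
    using R(1)[of i] by (simp add: continuous_on_polymonial_function real_polynomial_function_eq)
  have "integrable sphere_measure (\<lambda>x. R i (y, x) * w x)" for i
    by (intro integrable_sphere_continuous continuous_on_mult w
       continuous_on_compose2[OF cR] continuous_intros) auto
  then have "(\<Sum>i\<in>UNIV. \<integral>x. R i (y, x) * w x \<partial>sphere_measure) = (\<integral>x. (\<Sum>i\<in>UNIV. R i (y, x)) * w x \<partial>sphere_measure)"
    by (simp add: sum_distrib_right Bochner_Integration.integral_sum)
  then show ?thesis unfolding laplacian_def Q(2,3)[abs_def] R(2,3) .
qed

text \<open>The recursion multiplies by y \<bullet> x, the sum of the products y_l x_l. The factor
  y_l leaves the integral and x_l is absorbed into the weight, which is why w is arbitrary in the
  induction.\<close>

lemma real_polynomial_function_integral_gegenbauer: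
  fixes w :: "real^'m::finite \<Rightarrow> real"
  assumes "continuous_on (sphere 0 1) w"
  shows "real_polynomial_function (\<lambda>y. \<integral>x. gegenbauer \<nu> (y \<bullet> x) (y \<bullet> y) k * w x \<partial>sphere_measure)"
  using assms
proof (induction k arbitrary: w rule: induct_nat_012)
  have int: "integrable sphere_measure (\<lambda>x. gegenbauer \<nu> (y \<bullet> x) (y \<bullet> y) k * w x)"
    if "continuous_on (sphere 0 1) w" for w :: "real^'m \<Rightarrow> real" and y k
  proof -
    have "continuous_on A (\<lambda>x. gegenbauer \<nu> (y \<bullet> x) (y \<bullet> y) k)" for A
      by (induction k rule: induct_nat_012) (auto intro!: continuous_intros)
    with that show ?thesis by (intro integrable_sphere_continuous continuous_on_mult)
  qed
  {
    case 0 then show ?case by auto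
  next
    case 1
    have eq: "(\<lambda>y. \<integral>x. gegenbauer \<nu> (y \<bullet> x) (y \<bullet> y) (Suc 0) * w x \<partial>sphere_measure)
       = (\<lambda>y. y \<bullet> ((2 * \<nu>) *\<^sub>R (\<integral>x. w x *\<^sub>R x \<partial>sphere_measure)))"
    proof
      fix y :: "real^'m"
      have "(\<integral>x. y \<bullet> (w x *\<^sub>R x) \<partial>sphere_measure) = y \<bullet> (\<integral>x. w x *\<^sub>R x \<partial>sphere_measure)"
        by (intro integral_inner_right impI integrable_sphere_continuous continuous_intros 1)
      moreover have "(\<integral>x. gegenbauer \<nu> (y \<bullet> x) (y \<bullet> y) (Suc 0) * w x \<partial>sphere_measure)
         = (\<integral>x. (2 * \<nu>) * (y \<bullet> (w x *\<^sub>R x)) \<partial>sphere_measure)"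
        by (simp add: mult_ac)
      ultimately show "(\<integral>x. gegenbauer \<nu> (y \<bullet> x) (y \<bullet> y) (Suc 0) * w x \<partial>sphere_measure)
        = y \<bullet> ((2 * \<nu>) *\<^sub>R (\<integral>x. w x *\<^sub>R x \<partial>sphere_measure))" by simp
    qed
    show ?case unfolding eq by (rule real_polynomial_function.intros(1)) (rule bounded_linear_inner_left)
  next
    case (ge2 k)
    define a b where "a = 2 * (real k + 1 + \<nu>) / (real k + 2)" and "b = - (real k + 2 * \<nu>) / (real k + 2)"
    have cl: "continuous_on (sphere 0 1) (\<lambda>x. x $ l * w x)" for l :: 'm by (intro continuous_intros ge2.prems)
    have rec: "gegenbauer \<nu> (y \<bullet> x) (y \<bullet> y) (Suc (Suc k)) * w x
        = a * (\<Sum>l\<in>UNIV. y $ l * (gegenbauer \<nu> (y \<bullet> x) (y \<bullet> y) (Suc k) * (x $ l * w x)))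
           + b * ((y \<bullet> y) * (gegenbauer \<nu> (y \<bullet> x) (y \<bullet> y) k * w x))" for x y :: "real^'m"
    proof -
      have "(\<Sum>l\<in>UNIV. y $ l * (gegenbauer \<nu> (y \<bullet> x) (y \<bullet> y) (Suc k) * (x $ l * w x)))
        = (\<Sum>l\<in>UNIV. (y $ l * x $ l) * (gegenbauer \<nu> (y \<bullet> x) (y \<bullet> y) (Suc k) * w x))"
        by (intro sum.cong refl) (simp only: mult_ac)
      also have "\<dots> = (y \<bullet> x) * (gegenbauer \<nu> (y \<bullet> x) (y \<bullet> y) (Suc k) * w x)"
        by (simp add: inner_vec_def sum_distrib_right)
      finally show ?thesis
        by (simp add: a_def b_def divide_simps) (simp add: algebra_simps)
    qed
    have eq: "(\<lambda>y. \<integral>x. gegenbauer \<nu> (y \<bullet> x) (y \<bullet> y) (Suc (Suc k)) * w x \<partial>sphere_measure)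
      = (\<lambda>y. a * (\<Sum>l\<in>UNIV. y $ l * (\<integral>x. gegenbauer \<nu> (y \<bullet> x) (y \<bullet> y) (Suc k) * (x $ l * w x) \<partial>sphere_measure))
           + b * ((y \<bullet> y) * (\<integral>x. gegenbauer \<nu> (y \<bullet> x) (y \<bullet> y) k * w x \<partial>sphere_measure)))"
      unfolding rec using int[OF cl] int[OF ge2.prems]
      by (simp add: Bochner_Integration.integral_sum Bochner_Integration.integral_add del: gegenbauer.simps)
    show ?case unfolding eq
      using ge2.IH(1)[OF ge2.prems] ge2.IH(2)[OF cl]
      by (intro real_polynomial_function.intros(2-4) real_polynomial_function_sum real_polynomial_function_inner_self
          real_polynomial_function.intros(1)[OF bounded_linear_vec_nth]) auto
  }
qed

lemma real_polynomial_function_gegenbauer_prod: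
  "real_polynomial_function (\<lambda>p :: (real^'m::finite) \<times> (real^'m). gegenbauer \<nu> (fst p \<bullet> snd p) (fst p \<bullet> fst p) k)"
proof -
  have 1: "real_polynomial_function (\<lambda>p :: (real^'m) \<times> (real^'m). fst p \<bullet> snd p)"
       "real_polynomial_function (\<lambda>p :: (real^'m) \<times> (real^'m). fst p \<bullet> fst p)"
    unfolding inner_vec_def inner_real_def
    by (rule real_polynomial_function_sum, simp, rule real_polynomial_function.intros(4);
        rule real_polynomial_function.intros(1),
        intro bounded_linear_compose[OF bounded_linear_vec_nth] bounded_linear_fst bounded_linear_snd)+
  show ?thesis
  proof (induction k rule: induct_nat_012)
    case (ge2 k)
    then show ?case unfolding gegenbauer.simps
      by (intro real_polynomial_function_divide real_polynomial_function_diff real_polynomial_function.intros(4)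
          real_polynomial_function.intros(2) 1)
  qed (auto intro!: 1)
qed


section \<open>Expansion in zonal harmonics\<close>

lemma summable_poly_times_power:
  fixes r :: real
  assumes "\<bar>r\<bar> < 1"
  shows "summable (\<lambda>k. (real k + 1) ^ N * r ^ k)"
proof -
  have "summable (\<lambda>k. (real k + 1) ^ N * r ^ k)" if "norm r < 1" for r
    using that
  proof (induction N arbitrary: r)
    case 0 then show ?case by (simp add: summable_geometric)
  next
    case (Suc N)
    have "summable (\<lambda>k. diffs (\<lambda>k. (real k + 1) ^ N) k * \<bar>r\<bar> ^ k)"
      by (rule termdiff_converges[of _ 1]) (use Suc in auto)
    then show ?case
    proof (rule summable_comparison_test'[where N = 0])
      fix k :: nat
      have "(real k + 1) ^ N \<le> (real k + 2) ^ N" by (rule power_mono) auto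
      then have "(real k + 1) * (real k + 1) ^ N \<le> (real k + 1) * (real k + 2) ^ N" by (intro mult_left_mono) auto
      then show "norm ((real k + 1) ^ Suc N * r ^ k) \<le> diffs (\<lambda>k. (real k + 1) ^ N) k * \<bar>r\<bar> ^ k"
        by (auto simp: diffs_def norm_mult power_abs abs_mult add_ac intro!: mult_right_mono)
    qed
  qed
  with assms show ?thesis by simp
qed

lemma continuous_on_gegenbauer [continuous_intros]:
  assumes "continuous_on A f" "continuous_on A g"
  shows "continuous_on A (\<lambda>x. gegenbauer \<nu> (f x) (g x) k)"
  by (induction k rule: induct_nat_012) (auto intro!: continuous_intros assms)

lemma continuous_on_zonal_harmonic [continuous_intros]:
  assumes "continuous_on A f" "continuous_on A g"
  shows "continuous_on A (\<lambda>x. zonal_harmonic n k (f x) (g x))"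
  unfolding zonal_harmonic_def by (intro continuous_intros assms)

lemma continuous_on_poisson_kernel:
  assumes "continuous_on A f" "\<And>x. x \<in> A \<Longrightarrow> \<bar>f x\<bar> \<le> 1" "\<bar>r\<bar> < 1"
  shows "continuous_on A (\<lambda>x. poisson_kernel n r (f x))"
proof -
  have "1 - 2 * r * f x + r\<^sup>2 \<noteq> 0" if "x \<in> A" for x using poisson_base_pos[OF assms(2)[OF that] assms(3)] by simp
  then show ?thesis unfolding poisson_kernel_def by (intro continuous_intros assms) auto
qed

lemma abs_inner_sphere_le_1: "norm x = 1 \<Longrightarrow> norm e = 1 \<Longrightarrow> \<bar>x \<bullet> e\<bar> \<le> 1"
  using Cauchy_Schwarz_ineq2[of x e] by simp

lemma continuous_on_spherical_harmonic: "q \<in> spherical_harmonics k \<Longrightarrow> continuous_on A q"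
  by (auto simp: spherical_harmonics_def continuous_on_polymonial_function real_polynomial_function_eq)

text \<open>With the pole e fixed, values of operators at e become expansions of zonal integrals. A
  statement at another point is obtained by interpreting the locale again with that point as
  pole.\<close>

locale sphere_dim =
  fixes n :: nat and e :: "real ^ 'm::finite"
  assumes card: "CARD('m) = n + 1" and n2: "n \<ge> 2" and e: "norm e = 1"
begin

definition \<omega> :: real where "\<omega> = measure (sphere_measure :: (real^'m) measure) (sphere 0 1)"

lemma \<omega>_eq: "\<omega> = (real n + 1) * unit_ball_vol (real n + 1)"
  unfolding \<omega>_def measure_def emeasure_sphere_measure_space card by (simp add: add_ac)

lemma \<omega>_pos: "\<omega> > 0" unfolding \<omega>_eq by (simp add: add_pos_pos)

lemma measure_sphere_measure [simp]: "measure (sphere_measure :: (real^'m) measure) (sphere 0 1) = \<omega>"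
  by (simp add: \<omega>_def)

text \<open>Both functions are eigenfunctions of the symmetric Laplacian of the sphere. The
  eigenvalues differ by (j - k) (j + k + n - 1), whose second factor is positive.\<close>

lemma spherical_harmonics_orthogonal:
  fixes p q :: "real^'m \<Rightarrow> real"
  assumes p: "p \<in> spherical_harmonics j" and q: "q \<in> spherical_harmonics k" and jk: "j \<noteq> k"
  shows "(\<integral>x. p x * q x \<partial>sphere_measure) = 0"
proof -
  define I where "I = (\<integral>x. p x * q x \<partial>sphere_measure)"
  have C: "Ck_on 2 UNIV p" "Ck_on 2 UNIV q"
    using p q by (auto simp: spherical_harmonics_def intro!: Ck_on_real_polynomial_function)
  have "(\<integral>x. p x * sphere_laplacian q x \<partial>sphere_measure) = (\<integral>x. - (real k * (real k + real n - 1)) * (p x * q x) \<partial>sphere_measure)"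
    using sphere_laplacian_homogeneous_harmonic[OF q] by (intro Bochner_Integration.integral_cong) (auto simp: card)
  also have "\<dots> = - (real k * (real k + real n - 1)) * I" by (simp add: I_def)
  finally have 1: "(\<integral>x. p x * sphere_laplacian q x \<partial>sphere_measure) = - (real k * (real k + real n - 1)) * I" .
  have "(\<integral>x. sphere_laplacian p x * q x \<partial>sphere_measure) = (\<integral>x. - (real j * (real j + real n - 1)) * (p x * q x) \<partial>sphere_measure)"
    using sphere_laplacian_homogeneous_harmonic[OF p] by (intro Bochner_Integration.integral_cong) (auto simp: card)
  also have "\<dots> = - (real j * (real j + real n - 1)) * I" by (simp add: I_def)
  finally have 2: "(\<integral>x. sphere_laplacian p x * q x \<partial>sphere_measure) = - (real j * (real j + real n - 1)) * I" .
  have "- (real k * (real k + real n - 1)) * I = - (real j * (real j + real n - 1)) * I"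
    unfolding 1[symmetric] 2[symmetric] by (rule integral_sphere_laplacian_symmetric[OF open_UNIV subset_UNIV C])
  then have "((real j - real k) * (real j + real k + real n - 1)) * I = 0" by (simp add: algebra_simps)
  moreover have "(real j - real k) * (real j + real k + real n - 1) \<noteq> 0" using jk n2 by simp
  ultimately show ?thesis by (simp add: I_def)
qed

text \<open>The degree k part of the expansion of g, evaluated at the pole; for continuous g it
  turns out to be \<open>harmonic_component k g e\<close>.\<close>

definition zonal_coeff :: "nat \<Rightarrow> (real^'m \<Rightarrow> real) \<Rightarrow> real" where
  "zonal_coeff k g = (\<integral>x. zonal_harmonic n k (x \<bullet> e) 1 * g x \<partial>sphere_measure) / \<omega>"

lemma zonal_integrable:
  "continuous_on (sphere 0 1) g \<Longrightarrow> integrable sphere_measure (\<lambda>x. zonal_harmonic n k (x \<bullet> e) 1 * g x)"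
  by (intro integrable_sphere_continuous continuous_intros)

lemma zonal_in_harmonics: "(\<lambda>y. zonal_harmonic n k (y \<bullet> e) (y \<bullet> y)) \<in> spherical_harmonics k"
  by (rule zonal_harmonic_in_spherical_harmonics[OF e card])

lemma zonal_coeff_orthogonal:
  assumes q: "q \<in> spherical_harmonics k" and "j \<noteq> k"
  shows "zonal_coeff j q = 0"
proof -
  have "(\<integral>x. zonal_harmonic n j (x \<bullet> e) 1 * q x \<partial>sphere_measure)
    = (\<integral>x. zonal_harmonic n j (x \<bullet> e) (x \<bullet> x) * q x \<partial>sphere_measure)"
    by (intro Bochner_Integration.integral_cong refl) (simp add: dot_square_norm)
  also have "\<dots> = 0" by (rule spherical_harmonics_orthogonal[OF zonal_in_harmonics q assms(2)])
  finally show ?thesis by (simp add: zonal_coeff_def)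
qed

lemma zonal_coeff_bound:
  assumes g: "continuous_on (sphere 0 1) g" and B: "\<And>x. x \<in> sphere 0 1 \<Longrightarrow> \<bar>g x\<bar> \<le> B"
  shows "\<bar>zonal_coeff k g\<bar> \<le> 2 * (real k + 1) ^ (2 * n + 2) * B"
proof -
  have "\<bar>\<integral>x. zonal_harmonic n k (x \<bullet> e) 1 * g x \<partial>sphere_measure\<bar>
     \<le> (\<integral>x. \<bar>zonal_harmonic n k (x \<bullet> e) 1 * g x\<bar> \<partial>sphere_measure)" by (rule integral_abs_bound)
  also have "\<dots> \<le> (\<integral>x. 2 * (real k + 1) ^ (2 * n + 2) * B \<partial>(sphere_measure :: (real^'m) measure))"
  proof (intro integral_mono integrable_abs zonal_integrable g)
    fix x assume "x \<in> space (sphere_measure :: (real^'m) measure)"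
    then show "\<bar>zonal_harmonic n k (x \<bullet> e) 1 * g x\<bar> \<le> 2 * (real k + 1) ^ (2 * n + 2) * B"
      unfolding abs_mult using B[of x] n2 e
      by (intro mult_mono zonal_harmonic_bound abs_inner_sphere_le_1) auto
  qed simp
  finally show ?thesis using \<omega>_pos by (simp add: zonal_coeff_def divide_simps mult_ac)
qed

text \<open>The zonal expansion of the Poisson kernel is integrated against g; the geometric factor
  beats the polynomial growth of the zonal harmonics and justifies the interchange.\<close>

lemma zonal_coeff_poisson_sums:
  assumes g: "continuous_on (sphere 0 1) g" and r: "\<bar>r\<bar> < 1"
  shows "(\<lambda>k. zonal_coeff k g * r ^ k) sums ((\<integral>x. poisson_kernel n r (x \<bullet> e) * g x \<partial>sphere_measure) / \<omega>)"
proof -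
  have "bounded (g ` sphere 0 1)" using g by (intro compact_imp_bounded compact_continuous_image) auto
  then obtain B where B: "\<And>x. x \<in> sphere 0 1 \<Longrightarrow> \<bar>g x\<bar> \<le> B"
    unfolding bounded_iff real_norm_def by blast
  have B0: "B \<ge> 0" using B[of e] e by (auto intro: order_trans[OF abs_ge_zero])
  define f where "f k x = zonal_harmonic n k (x \<bullet> e) 1 * g x * r ^ k" for k and x :: "real^'m"
  define M where "M k = 2 * B * ((real k + 1) ^ (2 * n + 2) * \<bar>r\<bar> ^ k)" for k
  have sM: "summable M" unfolding M_def using r by (intro summable_mult summable_poly_times_power) auto
  have fM: "norm (f k x) \<le> M k" if x: "x \<in> sphere 0 1" for k x
  proof -
    have "norm (f k x) = \<bar>zonal_harmonic n k (x \<bullet> e) 1\<bar> * \<bar>g x\<bar> * \<bar>r\<bar> ^ k" by (simp add: f_def abs_mult power_abs)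
    also have "\<dots> \<le> (2 * (real k + 1) ^ (2 * n + 2)) * B * \<bar>r\<bar> ^ k"
      using x B[OF x] n2 e by (intro mult_mono zonal_harmonic_bound abs_inner_sphere_le_1) auto
    finally show ?thesis by (simp add: M_def mult_ac)
  qed
  have int: "integrable sphere_measure (f k)" for k
    unfolding f_def using zonal_integrable[OF g] by (intro integrable_mult_left)
  have "(\<lambda>k. \<integral>x. f k x \<partial>sphere_measure) sums (\<integral>x. (\<Sum>k. f k x) \<partial>sphere_measure)"
  proof (rule sums_integral[OF int])
    show "AE x in sphere_measure. summable (\<lambda>k. norm (f k x))"
      using fM by (intro AE_I2 summable_comparison_test'[OF sM, of 0]) auto
    show "summable (\<lambda>k. \<integral>x. norm (f k x) \<partial>sphere_measure)"
    proof (rule summable_comparison_test'[OF summable_mult2[OF sM, of \<omega>], of 0])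
      fix k
      have "(\<integral>x. norm (f k x) \<partial>sphere_measure) \<le> (\<integral>x. M k \<partial>(sphere_measure :: (real^'m) measure))"
        using int fM by (intro integral_mono integrable_norm) auto
      then show "norm (\<integral>x. norm (f k x) \<partial>sphere_measure) \<le> M k * \<omega>" by (simp add: mult.commute)
    qed
  qed
  moreover have "(\<integral>x. (\<Sum>k. f k x) \<partial>sphere_measure) = (\<integral>x. poisson_kernel n r (x \<bullet> e) * g x \<partial>sphere_measure)"
  proof (intro Bochner_Integration.integral_cong refl)
    fix x assume "x \<in> space (sphere_measure :: (real^'m) measure)"
    then have "(\<lambda>k. zonal_harmonic n k (x \<bullet> e) 1 * r ^ k * g x) sums (poisson_kernel n r (x \<bullet> e) * g x)"
      using e r n2 by (intro sums_mult2 poisson_kernel_sums abs_inner_sphere_le_1) auto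
    then show "(\<Sum>k. f k x) = poisson_kernel n r (x \<bullet> e) * g x"
      by (simp add: f_def sums_iff mult_ac)
  qed
  moreover have "(\<integral>x. f k x \<partial>sphere_measure) = zonal_coeff k g * r ^ k * \<omega>" for k
    unfolding f_def zonal_coeff_def using \<omega>_pos by simp
  ultimately have "(\<lambda>k. zonal_coeff k g * r ^ k * \<omega>) sums (\<integral>x. poisson_kernel n r (x \<bullet> e) * g x \<partial>sphere_measure)"
    by simp
  from sums_divide[OF this, of \<omega>] \<omega>_pos show ?thesis by simp
qed

lemma one_in_harmonics: "(\<lambda>x::real^'m. 1) \<in> spherical_harmonics 0"
  by (auto simp: spherical_harmonics_def)

lemma zonal_harmonic_0 [simp]: "zonal_harmonic n 0 t R = 1"
  by (simp add: zonal_harmonic_def)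

text \<open>The constant function is harmonic of degree 0, so orthogonality removes every term of
  the expansion but the first.\<close>

lemma integral_poisson_kernel:
  assumes r: "\<bar>r\<bar> < 1"
  shows "(\<integral>x. poisson_kernel n r (x \<bullet> e) \<partial>sphere_measure) = \<omega>"
proof -
  have "zonal_coeff k (\<lambda>x. 1) = (if k = 0 then 1 else 0)" for k
    using zonal_coeff_orthogonal[OF one_in_harmonics, of k] \<omega>_pos by (auto simp: zonal_coeff_def)
  then have "(\<lambda>k. (if k = 0 then 1 else 0) * r ^ k) sums ((\<integral>x. poisson_kernel n r (x \<bullet> e) * 1 \<partial>sphere_measure) / \<omega>)"
    using zonal_coeff_poisson_sums[of "\<lambda>x. 1", OF _ r] by simp
  moreover have "(\<lambda>k. (if k = 0 then 1 else 0) * r ^ k) sums 1"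
    using sums_single[of 0 "\<lambda>k. r ^ k"] by (simp add: if_distrib[of "\<lambda>c. c * _"] eq_commute cong: if_cong)
  ultimately show ?thesis using sums_unique2 \<omega>_pos by fastforce
qed

text \<open>Serves two limits, the Poisson kernel as r tends to 1 from below and the singular kernel
  as b tends to 1 from above; hence the abstract index and filter, and a limiting mass A that may
  differ from 1.\<close>

lemma sphere_approximate_identity:
  fixes K :: "'b \<Rightarrow> real \<Rightarrow> real"
  assumes cont: "\<forall>\<^sub>F b in F. continuous_on {-1..1} (K b)" and nn: "\<forall>\<^sub>F b in F. \<forall>t\<in>{-1..1}. 0 \<le> K b t"
    and A: "((\<lambda>b. \<integral>x. K b (x \<bullet> e) \<partial>sphere_measure) \<longlongrightarrow> A) F"
    and conc: "\<And>\<delta> \<eta>. 0 < \<delta> \<Longrightarrow> 0 < \<eta> \<Longrightarrow> \<forall>\<^sub>F b in F. \<forall>t\<in>{-1..1-\<delta>}. K b t \<le> \<eta>"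
    and g: "continuous_on (sphere 0 1) g"
  shows "((\<lambda>b. \<integral>x. K b (x \<bullet> e) * g x \<partial>sphere_measure) \<longlongrightarrow> A * g e) F"
proof -
  have es: "e \<in> sphere 0 1" using e by simp
  have "bounded (g ` sphere 0 1)" using g by (intro compact_imp_bounded compact_continuous_image) auto
  then obtain B where B: "\<And>x. x \<in> sphere 0 1 \<Longrightarrow> \<bar>g x\<bar> \<le> B"
    unfolding bounded_iff real_norm_def by blast
  have B0: "B \<ge> 0" using B[OF es] by (auto intro: order_trans[OF abs_ge_zero])
  have te: "x \<bullet> e \<in> {-1..1}" if "x \<in> sphere 0 1" for x
    using abs_inner_sphere_le_1[of x e] e that by (auto simp: abs_le_iff)
  define M where "M b = (\<integral>x. K b (x \<bullet> e) \<partial>sphere_measure)" for b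
  have "((\<lambda>b. (\<integral>x. K b (x \<bullet> e) * g x \<partial>sphere_measure) - M b * g e) \<longlongrightarrow> 0) F"
  proof (rule tendstoI)
    fix \<epsilon> :: real assume \<epsilon>: "\<epsilon> > 0"
    define \<epsilon>1 where "\<epsilon>1 = \<epsilon> / (2 * (\<bar>A\<bar> + 1))"
    have \<epsilon>1: "\<epsilon>1 > 0" using \<epsilon> by (simp add: \<epsilon>1_def add_nonneg_pos)
    obtain d where d: "d > 0" "\<And>x. x \<in> sphere 0 1 \<Longrightarrow> dist x e < d \<Longrightarrow> dist (g x) (g e) < \<epsilon>1"
      using g es \<epsilon>1 unfolding continuous_on_iff by metis
    \<comment> \<open>Outside the ball of radius d about e, the identity |x - e|^2 = 2 - 2 (x
      \<bullet> e) gives x \<bullet> e \<le> 1 - d^2 / 2, which lies below 1 - \<delta>.\<close>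
    define \<delta> where "\<delta> = d\<^sup>2 / 4"
    have \<delta>: "\<delta> > 0" using d by (simp add: \<delta>_def)
    define \<eta> where "\<eta> = \<epsilon> / (4 * (B * \<omega> + 1))"
    have B\<omega>: "B * \<omega> + 1 > 0" using B0 \<omega>_pos by (simp add: add_nonneg_pos)
    have \<eta>: "\<eta> > 0" using \<epsilon> B\<omega> by (simp add: \<eta>_def)
    have MA: "\<forall>\<^sub>F b in F. dist (M b) A < 1" using A unfolding M_def by (intro tendstoD) auto
    show "\<forall>\<^sub>F b in F. dist ((\<integral>x. K b (x \<bullet> e) * g x \<partial>sphere_measure) - M b * g e) 0 < \<epsilon>"
      using cont nn conc[OF \<delta> \<eta>] MA
    proof eventually_elim
      case (elim b)
      have cK: "continuous_on (sphere 0 1) (\<lambda>x. K b (x \<bullet> e))"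
        by (rule continuous_on_compose2[OF elim(1)]) (use te in \<open>auto intro!: continuous_intros\<close>)
      have i1: "integrable sphere_measure (\<lambda>x. K b (x \<bullet> e) * g x)" "integrable sphere_measure (\<lambda>x. K b (x \<bullet> e))"
        by (intro integrable_sphere_continuous continuous_intros cK g)+
      have "\<bar>(\<integral>x. K b (x \<bullet> e) * g x \<partial>sphere_measure) - M b * g e\<bar> = \<bar>\<integral>x. K b (x \<bullet> e) * g x - K b (x \<bullet> e) * g e \<partial>sphere_measure\<bar>"
        unfolding M_def using i1 by (subst Bochner_Integration.integral_diff) auto
      also have "\<dots> \<le> (\<integral>x. \<bar>K b (x \<bullet> e) * g x - K b (x \<bullet> e) * g e\<bar> \<partial>sphere_measure)"
        by (rule integral_abs_bound)
      also have "\<dots> \<le> (\<integral>x. \<epsilon>1 * K b (x \<bullet> e) + 2 * B * \<eta> \<partial>sphere_measure)"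
      proof (intro integral_mono integrable_abs Bochner_Integration.integrable_diff i1 integrable_mult_left
          Bochner_Integration.integrable_add integrable_mult_right)
        fix x assume "x \<in> space (sphere_measure :: (real^'m) measure)"
        then have x: "x \<in> sphere 0 1" by simp
        have K0: "0 \<le> K b (x \<bullet> e)" using elim(2) te[OF x] by auto
        have eq: "\<bar>K b (x \<bullet> e) * g x - K b (x \<bullet> e) * g e\<bar> = K b (x \<bullet> e) * \<bar>g x - g e\<bar>"
          using K0 by (simp add: abs_mult flip: right_diff_distrib)
        show "\<bar>K b (x \<bullet> e) * g x - K b (x \<bullet> e) * g e\<bar> \<le> \<epsilon>1 * K b (x \<bullet> e) + 2 * B * \<eta>"
        proof (cases "dist x e < d")
          case True
          then have "\<bar>g x - g e\<bar> \<le> \<epsilon>1" using d(2)[OF x] by (simp add: dist_real_def)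
          then have "K b (x \<bullet> e) * \<bar>g x - g e\<bar> \<le> K b (x \<bullet> e) * \<epsilon>1" using K0 by (intro mult_left_mono) auto
          moreover have "0 \<le> 2 * B * \<eta>" using B0 \<eta> by simp
          ultimately show ?thesis unfolding eq by (smt (verit) mult.commute)
        next
          case False
          have "(dist x e)\<^sup>2 = 2 - 2 * (x \<bullet> e)"
          proof -
            have "(dist x e)\<^sup>2 = (x - e) \<bullet> (x - e)" by (simp add: dist_norm power2_norm_eq_inner)
            also have "\<dots> = x \<bullet> x + e \<bullet> e - 2 * (x \<bullet> e)" by (simp add: inner_diff_left inner_diff_right inner_commute)
            finally show ?thesis using x e by (simp add: dot_square_norm)
          qed
          moreover have "(dist x e)\<^sup>2 \<ge> d\<^sup>2" using False d by (intro power_mono) auto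
          ultimately have "x \<bullet> e \<le> 1 - \<delta>" unfolding \<delta>_def using zero_le_power2[of d] by linarith
          then have "K b (x \<bullet> e) \<le> \<eta>" using elim(3) te[OF x] by auto
          moreover have "\<bar>g x - g e\<bar> \<le> 2 * B" using B[OF x] B[OF es] by linarith
          ultimately have "K b (x \<bullet> e) * \<bar>g x - g e\<bar> \<le> \<eta> * (2 * B)" using K0 \<eta> by (intro mult_mono) auto
          moreover have "0 \<le> \<epsilon>1 * K b (x \<bullet> e)" using \<epsilon>1 K0 by simp
          ultimately show ?thesis using eq by (simp add: mult_ac)
        qed
      qed simp
      also have "\<dots> = \<epsilon>1 * M b + 2 * B * \<eta> * \<omega>"
        unfolding M_def using i1(2) by (subst Bochner_Integration.integral_add) auto
      also have "\<dots> < \<epsilon>"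
      proof -
        have "M b < \<bar>A\<bar> + 1" using elim(4) by (simp add: dist_real_def)
        then have "\<epsilon>1 * M b < \<epsilon>1 * (\<bar>A\<bar> + 1)" using \<epsilon>1 by (intro mult_strict_left_mono) auto
        also have "\<dots> = \<epsilon> / 2" unfolding \<epsilon>1_def by (simp add: field_simps add_nonneg_pos[THEN less_imp_neq, symmetric])
        finally have "\<epsilon>1 * M b < \<epsilon> / 2" .
        moreover have "2 * B * \<eta> * \<omega> = (\<epsilon> / 2) * ((B * \<omega>) / (B * \<omega> + 1))"
          using B\<omega> unfolding \<eta>_def by (simp add: divide_simps)
        moreover have "(\<epsilon> / 2) * ((B * \<omega>) / (B * \<omega> + 1)) \<le> (\<epsilon> / 2) * 1"
          using \<epsilon> B\<omega> by (intro mult_left_mono) auto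
        ultimately show ?thesis by linarith
      qed
      finally show ?case by (simp add: dist_real_def)
    qed
  qed
  moreover have "((\<lambda>b. M b * g e) \<longlongrightarrow> A * g e) F" using A unfolding M_def by (intro tendsto_intros)
  ultimately have "((\<lambda>b. ((\<integral>x. K b (x \<bullet> e) * g x \<partial>sphere_measure) - M b * g e) + M b * g e) \<longlongrightarrow> 0 + A * g e) F"
    by (rule tendsto_add)
  then show ?thesis by simp
qed

lemma poisson_integral_tendsto:
  assumes g: "continuous_on (sphere 0 1) g"
  shows "((\<lambda>r. \<integral>x. poisson_kernel n r (x \<bullet> e) * g x \<partial>sphere_measure) \<longlongrightarrow> \<omega> * g e) (at_left 1)"
proof (rule sphere_approximate_identity[OF _ _ _ _ g])
  have ev: "\<forall>\<^sub>F r::real in at_left 1. r \<in> {1/2<..<1}"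
    by (rule eventually_at_leftI[of "1/2"]) auto
  show "\<forall>\<^sub>F r in at_left 1. continuous_on {-1..1} (poisson_kernel n r)"
    using ev by eventually_elim (auto intro!: continuous_on_poisson_kernel[of _ "\<lambda>x. x"] simp: abs_le_iff)
  show "\<forall>\<^sub>F r in at_left 1. \<forall>t\<in>{-1..1}. 0 \<le> poisson_kernel n r t"
    using ev by eventually_elim (auto simp: poisson_kernel_def abs_square_le_1 intro!: mult_nonneg_nonneg)
  show "((\<lambda>r. \<integral>x. poisson_kernel n r (x \<bullet> e) \<partial>sphere_measure) \<longlongrightarrow> \<omega>) (at_left 1)"
    using ev by (intro tendsto_eventually) (auto elim!: eventually_mono intro!: integral_poisson_kernel)
  fix \<delta> \<eta> :: real assume \<delta>: "\<delta> > 0" and \<eta>: "\<eta> > 0"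
  define c where "c = \<delta> powr (- ((real n + 1) / 2))"
  have "((\<lambda>r. (1 - r\<^sup>2) * c) \<longlongrightarrow> (1 - 1\<^sup>2) * c) (at_left 1)" by (intro tendsto_intros)
  then have "\<forall>\<^sub>F r in at_left 1. (1 - r\<^sup>2) * c < \<eta>" using \<eta> by (intro order_tendstoD(2)) auto
  with ev show "\<forall>\<^sub>F r in at_left 1. \<forall>t\<in>{-1..1 - \<delta>}. poisson_kernel n r t \<le> \<eta>"
  proof eventually_elim
    case (elim r)
    show ?case
    proof
      fix t assume t: "t \<in> {-1..1-\<delta>}"
      have "2 * r * (1 - t) \<ge> 1 * \<delta>" using elim t \<delta> by (intro mult_mono) auto
      moreover have "1 - 2 * r * t + r\<^sup>2 = (1 - r)\<^sup>2 + 2 * r * (1 - t)" by (simp add: power2_eq_square algebra_simps)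
      ultimately have "\<delta> \<le> 1 - 2 * r * t + r\<^sup>2" by (smt (verit) zero_le_power2)
      then have "(1 - 2 * r * t + r\<^sup>2) powr (- ((real n + 1) / 2)) \<le> c"
        unfolding c_def using \<delta> by (intro powr_mono2') auto
      then have "poisson_kernel n r t \<le> (1 - r\<^sup>2) * c"
        unfolding poisson_kernel_def using elim by (intro mult_left_mono) (auto simp: abs_square_le_1)
      with elim show "poisson_kernel n r t \<le> \<eta>" by simp
    qed
  qed
qed

text \<open>The Poisson integral of q at radius r is \<omega> r^k times the coefficient, all other
  degrees being orthogonal, and it tends to \<omega> q(e) because the Poisson kernel is an
  approximate identity. Comparing the limits at r = 1 gives the claim.\<close>

lemma zonal_coeff_reproducing:
  assumes q: "q \<in> spherical_harmonics k"
  shows "zonal_coeff k q = q e"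
proof -
  have cq: "continuous_on (sphere 0 1) q" by (rule continuous_on_spherical_harmonic[OF q])
  have P: "(\<integral>x. poisson_kernel n r (x \<bullet> e) * q x \<partial>sphere_measure) = \<omega> * (zonal_coeff k q * r ^ k)" if "\<bar>r\<bar> < 1" for r
  proof -
    have "(\<lambda>j. zonal_coeff j q * r ^ j) sums (zonal_coeff k q * r ^ k)"
    proof -
      have "(\<lambda>j. zonal_coeff j q * r ^ j) = (\<lambda>j. if j = k then zonal_coeff j q * r ^ j else 0)"
        by (rule ext) (simp add: zonal_coeff_orthogonal[OF q])
      then show ?thesis using sums_single[of k "\<lambda>j. zonal_coeff j q * r ^ j"] by simp
    qed
    from sums_unique2[OF this zonal_coeff_poisson_sums[OF cq that]] show ?thesis using \<omega>_pos by (simp add: field_simps)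
  qed
  have "((\<lambda>r. \<omega> * (zonal_coeff k q * r ^ k)) \<longlongrightarrow> \<omega> * (zonal_coeff k q * 1 ^ k)) (at_left 1)"
    by (intro tendsto_intros)
  moreover have "((\<lambda>r. \<omega> * (zonal_coeff k q * r ^ k)) \<longlongrightarrow> \<omega> * q e) (at_left 1)"
    by (rule Lim_transform_eventually[OF poisson_integral_tendsto[OF cq]])
      (auto intro!: eventually_at_leftI[of 0] P)
  ultimately have "\<omega> * (zonal_coeff k q * 1 ^ k) = \<omega> * q e"
    by (intro tendsto_unique[of "at_left (1::real)"]) auto
  then show ?thesis using \<omega>_pos by simp
qed

lemma zonal_coeff_sphere_laplacian:
  assumes S: "open S" "sphere 0 1 \<subseteq> S" and F: "Ck_on 2 S F"
  shows "zonal_coeff k (sphere_laplacian F) = - (real k * (real k + real n - 1)) * zonal_coeff k F"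
proof -
  \<comment> \<open>The second argument is y \<bullet> y rather than 1 so that \<open>Z\<close> is a
    homogeneous harmonic polynomial; on the sphere both agree.\<close>
  define Z where "Z y = zonal_harmonic n k (y \<bullet> e) (y \<bullet> y)" for y :: "real^'m"
  have Z: "Z \<in> spherical_harmonics k" unfolding Z_def by (rule zonal_in_harmonics)
  then have CZ: "Ck_on 2 S Z" using S by (intro Ck_on_real_polynomial_function) (auto simp: spherical_harmonics_def)
  have ZZ: "zonal_harmonic n k (x \<bullet> e) 1 = Z x" if "x \<in> sphere 0 1" for x using that by (simp add: Z_def dot_square_norm)
  have "(\<integral>x. zonal_harmonic n k (x \<bullet> e) 1 * sphere_laplacian F x \<partial>sphere_measure) = (\<integral>x. Z x * sphere_laplacian F x \<partial>sphere_measure)"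
    by (intro Bochner_Integration.integral_cong) (auto simp: ZZ)
  also have "\<dots> = (\<integral>x. sphere_laplacian Z x * F x \<partial>sphere_measure)"
    by (rule integral_sphere_laplacian_symmetric[OF S CZ F])
  also have "\<dots> = (\<integral>x. - (real k * (real k + real n - 1)) * (zonal_harmonic n k (x \<bullet> e) 1 * F x) \<partial>sphere_measure)"
    using sphere_laplacian_homogeneous_harmonic[OF Z] by (intro Bochner_Integration.integral_cong) (auto simp: card ZZ)
  finally show ?thesis by (simp add: zonal_coeff_def)
qed

lemma zonal_coeff_diff:
  "continuous_on (sphere 0 1) f \<Longrightarrow> continuous_on (sphere 0 1) g \<Longrightarrow> zonal_coeff k (\<lambda>x. f x - g x) = zonal_coeff k f - zonal_coeff k g"
  by (simp add: zonal_coeff_def right_diff_distrib diff_divide_distrib zonal_integrable)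

lemma zonal_coeff_cmult: "zonal_coeff k (\<lambda>x. c * f x) = c * zonal_coeff k f"
proof -
  have "(\<integral>x. zonal_harmonic n k (x \<bullet> e) 1 * (c * f x) \<partial>sphere_measure) = (\<integral>x. c * (zonal_harmonic n k (x \<bullet> e) 1 * f x) \<partial>sphere_measure)"
    by (intro Bochner_Integration.integral_cong) auto
  then show ?thesis by (simp add: zonal_coeff_def)
qed

text \<open>Subtracting from F its spherical Laplacian multiplies the coefficient by 1 + k (k + n -
  1) \<ge> k + 1, so each step of the induction gains a power of k + 1. The fixed loss (k + 1)^(2 n
  + 2) comes from the crude bound on zonal harmonics.\<close>

lemma zonal_coeff_rapid_decay:
  assumes S: "open S" "sphere 0 1 \<subseteq> S" and F: "\<forall>k. Ck_on k S F"
  shows "\<exists>B. \<forall>k. \<bar>zonal_coeff k F\<bar> * (real k + 1) ^ j \<le> B * (real k + 1) ^ (2 * n + 2)"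
  using F
proof (induction j arbitrary: F)
  case 0
  have g: "continuous_on (sphere 0 1) F" using spec[OF 0, of 0] S(2) by (auto intro: continuous_on_subset)
  then have "bounded (F ` sphere 0 1)" by (intro compact_imp_bounded compact_continuous_image) auto
  then obtain B where B: "\<And>x. x \<in> sphere 0 1 \<Longrightarrow> \<bar>F x\<bar> \<le> B"
    unfolding bounded_iff real_norm_def by blast
  show ?case using zonal_coeff_bound[OF g B] by (intro exI[of _ "2 * B"]) (simp add: mult_ac)
next
  case (Suc j)
  have L: "\<forall>k. Ck_on k S (\<lambda>x. F x - sphere_laplacian F x)"
    using Suc.prems S(1) by (intro allI Ck_on_diff Ck_on_sphere_laplacian) blast+
  then obtain B where B: "\<And>k. \<bar>zonal_coeff k (\<lambda>x. F x - sphere_laplacian F x)\<bar> * (real k + 1) ^ j \<le> B * (real k + 1) ^ (2 * n + 2)"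
    using Suc.IH by blast
  have c: "continuous_on (sphere 0 1) F" "continuous_on (sphere 0 1) (sphere_laplacian F)"
    using spec[OF Suc.prems, of 0] Ck_on_sphere_laplacian[OF S(1) spec[OF Suc.prems, of "Suc (Suc 0)"]] S(2)
    by (auto intro: continuous_on_subset)
  have "\<bar>zonal_coeff k F\<bar> * (real k + 1) ^ Suc j \<le> B * (real k + 1) ^ (2 * n + 2)" for k
  proof -
    have eq: "zonal_coeff k (\<lambda>x. F x - sphere_laplacian F x) = (1 + real k * (real k + real n - 1)) * zonal_coeff k F"
      unfolding zonal_coeff_diff[OF c] zonal_coeff_sphere_laplacian[OF S spec[OF Suc.prems]] by (simp add: algebra_simps)
    have "real k * 1 \<le> real k * (real k + real n - 1)" using n2 by (intro mult_left_mono) auto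
    then have *: "real k + 1 \<le> 1 + real k * (real k + real n - 1)" by simp
    then have "\<bar>zonal_coeff k F\<bar> * (real k + 1) \<le> \<bar>zonal_coeff k (\<lambda>x. F x - sphere_laplacian F x)\<bar>"
      unfolding eq abs_mult by (subst mult.commute) (intro mult_right_mono, auto)
    then have "\<bar>zonal_coeff k F\<bar> * (real k + 1) * (real k + 1) ^ j \<le> \<bar>zonal_coeff k (\<lambda>x. F x - sphere_laplacian F x)\<bar> * (real k + 1) ^ j"
      by (intro mult_right_mono) auto
    also note B[of k]
    finally show ?thesis by (simp add: mult_ac)
  qed
  then show ?case by blast
qed

lemma zonal_coeff_summable:
  assumes S: "open S" "sphere 0 1 \<subseteq> S" and F: "\<forall>k. Ck_on k S F"
  shows "summable (\<lambda>k. \<bar>zonal_coeff k F\<bar> * (real k + 1) ^ j)"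
proof -
  \<comment> \<open>The exponent pays for the loss 2 n + 2, for the j powers wanted, and for two
    more that make the remainder summable.\<close>
  obtain B where B: "\<And>k. \<bar>zonal_coeff k F\<bar> * (real k + 1) ^ (j + 2 * n + 4) \<le> B * (real k + 1) ^ (2 * n + 2)"
    using zonal_coeff_rapid_decay[OF S F] by blast
  have s: "summable (\<lambda>k. B * (1 / (real k + 1) ^ 2))"
  proof (rule summable_mult)
    have "summable (\<lambda>k. inverse (real k ^ 2))" by (rule inverse_power_summable) simp
    from summable_ignore_initial_segment[OF this, of 1]
    show "summable (\<lambda>k. 1 / (real k + 1) ^ 2)" by (simp add: inverse_eq_divide add_ac)
  qed
  show ?thesis
  proof (rule summable_comparison_test'[OF s, of 0])
    fix k :: nat
    define m where "m = real k + 1"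
    have m: "m > 0" by (simp add: m_def)
    have "m ^ (j + 2 * n + 4) = m ^ j * m ^ 2 * m ^ (2 * n + 2)" 
      unfolding power_add[symmetric] by (rule arg_cong[where f = "\<lambda>i. m ^ i"]) simp
    then have "(\<bar>zonal_coeff k F\<bar> * m ^ j * m ^ 2) * m ^ (2 * n + 2) \<le> B * m ^ (2 * n + 2)"
      using B[of k] by (simp add: m_def[symmetric] mult.assoc)
    then have "\<bar>zonal_coeff k F\<bar> * m ^ j * m ^ 2 \<le> B"
      by (rule mult_right_le_imp_le) (use m in simp)
    then show "norm (\<bar>zonal_coeff k F\<bar> * (real k + 1) ^ j) \<le> B * (1 / (real k + 1) ^ 2)"
      unfolding m_def[symmetric] using m by (simp add: field_simps)
  qed
qed

end


section \<open>Riesz potentials\<close>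

lemma borel_measurable_sphere_id [measurable]: "(\<lambda>x. x) \<in> sphere_measure \<rightarrow>\<^sub>M (borel :: (real^'m::finite) measure)"
  by (rule borel_measurable_sphere_measure_continuous) simp

lemma Fubini_sphere_zonal:
  fixes w q :: "real^'m::finite \<Rightarrow> real"
  assumes \<kappa>: "continuous_on UNIV \<kappa>" and w: "continuous_on (sphere 0 1) w" and q: "continuous_on (sphere 0 1) q"
  shows "(\<integral>y. (\<integral>x. \<kappa> (y \<bullet> x) * w x \<partial>sphere_measure) * q y \<partial>sphere_measure)
    = (\<integral>x. w x * (\<integral>y. \<kappa> (y \<bullet> x) * q y \<partial>sphere_measure) \<partial>sphere_measure)"
proof -
  let ?S = "sphere_measure :: (real^'m) measure"
  interpret P: pair_sigma_finite ?S ?S ..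
  interpret FP: finite_measure "?S \<Otimes>\<^sub>M ?S"
    by (rule finite_measure_pair_measure) unfold_locales
  have [measurable]: "w \<in> borel_measurable sphere_measure" "q \<in> borel_measurable sphere_measure"
    by (intro borel_measurable_sphere_measure_continuous w q)+
  have [measurable]: "\<kappa> \<in> borel_measurable borel" by (rule borel_measurable_continuous_onI[OF \<kappa>])
  have m: "(\<lambda>(y, x). \<kappa> (y \<bullet> x) * w x * q y) \<in> borel_measurable (?S \<Otimes>\<^sub>M ?S)"
  proof -
    have [measurable]: "(\<lambda>p. fst p \<bullet> snd p) \<in> borel_measurable (?S \<Otimes>\<^sub>M ?S)"
      by (intro borel_measurable_inner measurable_compose[OF measurable_fst borel_measurable_sphere_id]
          measurable_compose[OF measurable_snd borel_measurable_sphere_id])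
    show ?thesis unfolding split_beta' by measurable
  qed
  have "bounded ((\<lambda>(y, x). \<kappa> (y \<bullet> x) * w x * q y) ` (sphere 0 1 \<times> sphere 0 1))"
  proof (intro compact_imp_bounded compact_continuous_image compact_Times compact_sphere)
    show "continuous_on (sphere 0 1 \<times> sphere 0 1) (\<lambda>(y, x). \<kappa> (y \<bullet> x) * w x * q y)"
      unfolding split_beta'
      by (intro continuous_on_mult continuous_on_compose2[OF \<kappa>] continuous_on_compose2[OF w] continuous_on_compose2[OF q]
          continuous_intros) auto
  qed
  then obtain B where B: "\<And>y x. norm y = 1 \<Longrightarrow> norm x = 1 \<Longrightarrow> norm (\<kappa> (y \<bullet> x) * w x * q y) \<le> B"
    unfolding bounded_iff by fastforce
  have int: "integrable (?S \<Otimes>\<^sub>M ?S) (\<lambda>(y, x). \<kappa> (y \<bullet> x) * w x * q y)"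
    by (rule FP.integrable_const_bound[OF _ m, of B]) (auto simp: space_pair_measure simp del: real_norm_def intro!: AE_I2 B)
  have "(\<integral>y. (\<integral>x. \<kappa> (y \<bullet> x) * w x \<partial>?S) * q y \<partial>?S) = (\<integral>y. (\<integral>x. \<kappa> (y \<bullet> x) * w x * q y \<partial>?S) \<partial>?S)"
    by simp
  also have "\<dots> = (\<integral>x. (\<integral>y. \<kappa> (y \<bullet> x) * w x * q y \<partial>?S) \<partial>?S)"
    using P.Fubini_integral[OF int] by simp
  also have "\<dots> = (\<integral>x. w x * (\<integral>y. \<kappa> (y \<bullet> x) * q y \<partial>?S) \<partial>?S)"
    by (subst integral_mult_right_zero[symmetric]) (simp add: mult_ac)
  finally show ?thesis .
qed

lemma spherical_harmonics_diff:
  assumes "p \<in> spherical_harmonics k" "q \<in> spherical_harmonics k"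
  shows "(\<lambda>x. p x - q x) \<in> spherical_harmonics k"
proof -
  have p: "real_polynomial_function p" "real_polynomial_function q" using assms by (auto simp: spherical_harmonics_def)
  have "laplacian (\<lambda>x. p x + (-1) * q x) x = laplacian p x + (-1) * laplacian q x" for x
    unfolding laplacian_cmult[OF p(2), symmetric]
    by (intro laplacian_add real_polynomial_function.intros(2,4) p)
  then show ?thesis using assms by (auto simp: spherical_harmonics_def algebra_simps)
qed

text \<open>The definite description in \<open>harmonic_component\<close> picks a polynomial on the
  whole space, while orthogonality constrains it on the sphere. Homogeneity carries equality along
  rays, the origin being reached with factor 0.\<close>

lemma spherical_harmonics_eqI:
  fixes p q :: "real^'m::finite \<Rightarrow> real"
  assumes pq: "p \<in> spherical_harmonics k" "q \<in> spherical_harmonics k" and eq: "\<And>x. norm x = 1 \<Longrightarrow> p x = q x"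
  shows "p = q"
proof
  fix y :: "real^'m"
  have hom: "p (c *\<^sub>R x) = c ^ k * p x" "q (c *\<^sub>R x) = c ^ k * q x" for c x
    using pq by (auto simp: spherical_harmonics_def)
  obtain z :: "real^'m" where z: "norm z = 1" using norm_axis_1 by blast
  have "y = norm y *\<^sub>R (if y = 0 then z else sgn y)" by (simp add: sgn_div_norm)
  moreover have "norm (if y = 0 then z else sgn y) = 1" using z by (simp add: norm_sgn)
  ultimately show "p y = q y" using hom eq by metis
qed

lemma Beta_real_pos: "(0::real) < a \<Longrightarrow> 0 < b \<Longrightarrow> 0 < Beta a b"
  by (simp add: Beta_def Gamma_real_pos)

section \<open>Beta weights and superpositions of Poisson kernels\<close>

definition beta_weight :: "real \<Rightarrow> real \<Rightarrow> real \<Rightarrow> real" where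
  "beta_weight a b r = indicator {0<..<1} r * (r powr (a - 1) * (1 - r) powr (b - 1))"

lemma beta_weight_measurable [measurable]: "beta_weight a b \<in> borel_measurable borel"
  unfolding beta_weight_def by measurable

lemma beta_weight_nonneg [simp]: "0 \<le> beta_weight a b r"
  by (simp add: beta_weight_def)

lemma nn_integral_beta_weight:
  assumes "0 < a" "0 < b"
  shows "(\<integral>\<^sup>+r. ennreal (beta_weight a b r) \<partial>lborel) = ennreal (Beta a b)"
proof -
  have "(\<integral>\<^sup>+r. ennreal (indicator {0<..<1} r * (r powr (a - 1) * (1 - r) powr (b - 1))) \<partial>lborel) = ennreal (Beta a b)"
    using has_integral_Beta_real[OF assms]
    by (intro nn_integral_has_integral_lebesgue) (simp_all add: has_integral_Icc_iff_Ioo)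
  then show ?thesis by (simp add: beta_weight_def)
qed

lemma has_bochner_integral_beta_weight:
  assumes "0 < a" "0 < b"
  shows "has_bochner_integral lborel (beta_weight a b) (Beta a b)"
  using nn_integral_beta_weight[OF assms] Beta_real_pos[OF assms]
  by (intro has_bochner_integral_nn_integral) auto

text \<open>The substitution \<open>x = r (2 - 2 t) / (1 - 2 r t + r\<^sup>2)\<close> turns Euler's Beta integral into
  a superposition of Poisson kernels.\<close>

lemma nn_integral_poisson_subordination:
  assumes t: "-1 \<le> t" "t < 1" and \<alpha>: "0 < \<alpha>" "\<alpha> < real n / 2"
  shows "(\<integral>\<^sup>+r. ennreal (beta_weight \<alpha> (real n - 2 * \<alpha>) r * poisson_kernel n r t) \<partial>lborel)
    = ennreal (Beta \<alpha> ((real n + 1) / 2 - \<alpha>) * (2 - 2 * t) powr (- \<alpha>))"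
proof -
  define R where "R = 2 - 2 * t"
  have R: "R > 0" using t by (simp add: R_def)
  define p where "p = (real n + 1) / 2 - \<alpha>"
  have p: "p > 0" using \<alpha> by (simp add: p_def)
  define D where "D r = 1 - 2 * r * t + r\<^sup>2" for r
  have DR: "D r = (1 - r)\<^sup>2 + r * R" for r by (simp add: D_def R_def power2_eq_square algebra_simps)
  have D: "D r > 0" if "r \<in> {0..1}" for r
  proof (cases "r = 1")
    case False
    then have "(1 - r)\<^sup>2 > 0" by simp
    moreover have "r * R \<ge> 0" using that R by simp
    ultimately show ?thesis unfolding DR by linarith
  qed (use R in \<open>simp add: DR\<close>)
  define g where "g r = r * R / D r" for r
  define g' where "g' r = (1 - r\<^sup>2) * R / (D r)\<^sup>2" for r
  define f where "f x = x powr (\<alpha> - 1) * (1 - x) powr (p - 1)" for x :: real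
  have der: "(g has_real_derivative g' r) (at r)" if "r \<in> {0..1}" for r
  proof -
    have "D r \<noteq> 0" using D[OF that] by simp
    moreover have "(D has_real_derivative (2 * r - 2 * t)) (at r)"
      unfolding D_def[abs_def] by (auto intro!: derivative_eq_intros)
    ultimately have "(g has_real_derivative ((R * D r - r * R * (2 * r - 2 * t)) / (D r * D r))) (at r)"
      unfolding g_def[abs_def] by (auto intro!: derivative_eq_intros)
    moreover have "R * D r - r * R * (2 * r - 2 * t) = (1 - r\<^sup>2) * R"
      by (simp add: D_def power2_eq_square algebra_simps)
    ultimately show ?thesis by (simp add: g'_def power2_eq_square)
  qed
  have cD: "continuous_on {0..1} D" unfolding D_def[abs_def] by (intro continuous_intros)
  have cg': "continuous_on {0..1} g'"
    unfolding g'_def using D by (intro continuous_intros cD) force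
  have g01: "g 0 = 0" "g 1 = 1" using R by (simp_all add: g_def DR)
  have "(\<integral>\<^sup>+x. ennreal (f x * indicator {g 0..g 1} x) \<partial>lborel)
      = (\<integral>\<^sup>+x. ennreal (f (g x) * g' x * indicator {0..1} x) \<partial>lborel)"
  proof (rule nn_integral_substitution[OF _ der cg'])
    show "set_borel_measurable borel {g 0..g 1} f" unfolding set_borel_measurable_def f_def by measurable
    show "0 \<le> g' r" if "r \<in> {0..1}" for r
      using that R by (auto simp: g'_def abs_square_le_1 intro!: divide_nonneg_nonneg mult_nonneg_nonneg)
  qed auto
  moreover have "(\<integral>\<^sup>+x. ennreal (f x * indicator {g 0..g 1} x) \<partial>lborel) = ennreal (Beta \<alpha> p)"
    using nn_integral_has_integral_lebesgue[OF _ has_integral_Beta_real[OF \<alpha>(1) p]]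
    by (simp add: g01 f_def mult.commute)
  moreover have "f (g r) * g' r * indicator {0..1} r
     = R powr \<alpha> * (beta_weight \<alpha> (real n - 2 * \<alpha>) r * poisson_kernel n r t)" for r
  proof (cases "r \<in> {0<..<1}")
    case True
    then have r: "0 < r" "r < 1" by auto
    have Dr: "D r > 0" using D r by simp
    \<comment> \<open>Because D = (1 - r)^2 + r R, both g and 1 - g are pure powers over D; the
      powers of D from f and from g' then add up to the exponent of the Poisson kernel.\<close>
    have "1 - g r = (1 - r)\<^sup>2 / D r" using Dr unfolding g_def by (simp add: divide_simps) (simp add: DR)
    moreover have pd: "(x / D r) powr a = x powr a * D r powr (- a)" if "x > 0" for x a
      using that Dr by (simp add: powr_divide powr_minus_divide)
    ultimately have "f (g r) = (r * R / D r) powr (\<alpha> - 1) * ((1 - r)\<^sup>2 / D r) powr (p - 1)"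
      by (simp add: f_def) (simp add: g_def)
    also have "(r * R / D r) powr (\<alpha> - 1) = r powr (\<alpha> - 1) * R powr (\<alpha> - 1) * D r powr (1 - \<alpha>)"
      using pd[of "r * R" "\<alpha> - 1"] r R by (simp add: powr_mult)
    also have "((1 - r)\<^sup>2 / D r) powr (p - 1) = (1 - r) powr (2 * (p - 1)) * D r powr (1 - p)"
    proof -
      have "((1 - r)\<^sup>2) powr (p - 1) = (1 - r) powr (2 * (p - 1))"
        using r by (simp add: powr_powr flip: powr_numeral)
      then show ?thesis using pd[of "(1 - r)\<^sup>2" "p - 1"] r by simp
    qed
    finally have "f (g r) * g' r = r powr (\<alpha> - 1) * (1 - r) powr (2 * (p - 1)) * (1 - r\<^sup>2)
        * (R powr (\<alpha> - 1) * R) * (D r powr (1 - \<alpha>) * D r powr (1 - p) * D r powr (-2))"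
      using Dr by (simp add: g'_def powr_minus divide_inverse mult_ac)
    also have "R powr (\<alpha> - 1) * R = R powr \<alpha>" using R by (simp add: powr_diff)
    also have "D r powr (1 - \<alpha>) * D r powr (1 - p) * D r powr (-2) = D r powr (- ((real n + 1) / 2))"
    proof -
      have "(1 - \<alpha>) + (1 - p) + (-2) = - ((real n + 1) / 2)" by (simp add: p_def field_simps)
      then show ?thesis by (simp only: powr_add[symmetric])
    qed
    also have "2 * (p - 1) = real n - 2 * \<alpha> - 1" by (simp add: p_def field_simps)
    finally show ?thesis using r by (simp add: beta_weight_def poisson_kernel_def D_def mult_ac)
  next
    case False
    then show ?thesis using R by (auto simp: beta_weight_def indicator_def f_def g_def g'_def DR)
  qed
  ultimately have eq: "ennreal (Beta \<alpha> p) = ennreal (R powr \<alpha>) * (\<integral>\<^sup>+r. ennreal (beta_weight \<alpha> (real n - 2 * \<alpha>) r * poisson_kernel n r t) \<partial>lborel)"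
  proof -
    assume "(\<integral>\<^sup>+x. ennreal (f x * indicator {g 0..g 1} x) \<partial>lborel) = (\<integral>\<^sup>+x. ennreal (f (g x) * g' x * indicator {0..1} x) \<partial>lborel)"
     "(\<integral>\<^sup>+x. ennreal (f x * indicator {g 0..g 1} x) \<partial>lborel) = ennreal (Beta \<alpha> p)"
     "\<And>r. f (g r) * g' r * indicator {0..1} r = R powr \<alpha> * (beta_weight \<alpha> (real n - 2 * \<alpha>) r * poisson_kernel n r t)"
    then have "ennreal (Beta \<alpha> p) = (\<integral>\<^sup>+r. ennreal (R powr \<alpha> * (beta_weight \<alpha> (real n - 2 * \<alpha>) r * poisson_kernel n r t)) \<partial>lborel)"
      by simp
    also have "\<dots> = (\<integral>\<^sup>+r. ennreal (R powr \<alpha>) * ennreal (beta_weight \<alpha> (real n - 2 * \<alpha>) r * poisson_kernel n r t) \<partial>lborel)"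
      by (intro nn_integral_cong ennreal_mult') simp
    also have "\<dots> = ennreal (R powr \<alpha>) * (\<integral>\<^sup>+r. ennreal (beta_weight \<alpha> (real n - 2 * \<alpha>) r * poisson_kernel n r t) \<partial>lborel)"
      by (rule nn_integral_cmult) (simp add: poisson_kernel_def)
    finally show ?thesis .
  qed
  have "ennreal (Beta \<alpha> p * R powr (- \<alpha>)) = ennreal (R powr (- \<alpha>)) * ennreal (Beta \<alpha> p)"
    by (subst mult.commute) (simp add: ennreal_mult')
  also have "\<dots> = ennreal (R powr (- \<alpha>)) * ennreal (R powr \<alpha>) * (\<integral>\<^sup>+r. ennreal (beta_weight \<alpha> (real n - 2 * \<alpha>) r * poisson_kernel n r t) \<partial>lborel)"
    unfolding eq by (simp add: mult.assoc)
  also have "ennreal (R powr (- \<alpha>)) * ennreal (R powr \<alpha>) = 1"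
    using R by (simp flip: ennreal_mult' powr_add)
  finally show ?thesis by (simp add: p_def R_def)
qed

context sphere_dim
begin

text \<open>The projection is written down explicitly as the integral of w against the zonal kernel.
  It is harmonic because the kernel is harmonic in y for each fixed x; orthogonality of the
  remainder follows from Fubini and the reproducing property. This settles existence and uniqueness
  in the definite description.\<close>

lemma harmonic_component_eq:
  assumes w: "continuous_on (sphere 0 1) w"
  shows "harmonic_component k w e = zonal_coeff k w"
proof -
  define Z where "Z y x = zonal_harmonic n k (y \<bullet> x) (y \<bullet> y)" for y x :: "real^'m"
  define p where "p y = (\<integral>x. Z y x * w x \<partial>sphere_measure) / \<omega>" for y
  define \<nu> where "\<nu> = (real n - 1) / 2"
  define c where "c = 1 + 2 * real k / (real n - 1)"
  have Zg: "Z y x = c * gegenbauer \<nu> (y \<bullet> x) (y \<bullet> y) k" for y x by (simp add: Z_def zonal_harmonic_def c_def \<nu>_def)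
  have peq: "p = (\<lambda>y. (c / \<omega>) * (\<integral>x. gegenbauer \<nu> (y \<bullet> x) (y \<bullet> y) k * w x \<partial>sphere_measure))"
    by (rule ext) (simp add: p_def Zg mult.assoc)
  have polyp: "real_polynomial_function p"
    unfolding peq by (intro real_polynomial_function.intros(2,4) real_polynomial_function_integral_gegenbauer w)
  have homp: "p (s *\<^sub>R y) = s ^ k * p y" for s y
    using gegenbauer_homogeneous[of \<nu> s "y \<bullet> x" "y \<bullet> y" k for x]
    by (simp add: peq power2_eq_square mult.assoc)
  have lapp: "laplacian p y = 0" for y
  proof -
    have "laplacian (\<lambda>y. \<integral>x. gegenbauer \<nu> (y \<bullet> x) (y \<bullet> y) k * w x \<partial>sphere_measure) y
      = (\<integral>x. laplacian (\<lambda>y. gegenbauer \<nu> (y \<bullet> x) (y \<bullet> y) k) y * w x \<partial>sphere_measure)"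
      using laplacian_integral_sphere_polynomial[OF real_polynomial_function_gegenbauer_prod w, of \<nu> k y] by simp
    also have "\<dots> = (\<integral>x. 0 \<partial>(sphere_measure :: (real^'m) measure))"
    proof (intro Bochner_Integration.integral_cong refl)
      fix x assume "x \<in> space (sphere_measure :: (real^'m) measure)"
      then have "laplacian (\<lambda>y. gegenbauer \<nu> (y \<bullet> x) (y \<bullet> y) k) y = 0"
        using gegenbauer_solid_harmonic[of x \<nu>] card by (simp add: \<nu>_def field_simps)
      then show "laplacian (\<lambda>y. gegenbauer \<nu> (y \<bullet> x) (y \<bullet> y) k) y * w x = 0" by simp
    qed
    finally show ?thesis unfolding peq by (subst laplacian_cmult) (auto intro: real_polynomial_function_integral_gegenbauer w)
  qed
  have pH: "p \<in> spherical_harmonics k" using polyp homp lapp by (simp add: spherical_harmonics_def)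
  have cp: "continuous_on (sphere 0 1) q" if "q \<in> spherical_harmonics k" for q :: "real^'m \<Rightarrow> real"
    by (rule continuous_on_spherical_harmonic[OF that])
  have orth: "(\<integral>x. (w x - p x) * q x \<partial>sphere_measure) = 0" if q: "q \<in> spherical_harmonics k" for q :: "real^'m \<Rightarrow> real"
  proof -
    have rep: "(\<integral>y. zonal_harmonic n k (y \<bullet> x) 1 * q y \<partial>sphere_measure) = \<omega> * q x" if "norm x = 1" for x :: "real^'m"
    proof -
      \<comment> \<open>The reproducing property is wanted at every point x, so x becomes the
        pole.\<close>
      interpret X: sphere_dim n x by unfold_locales (use card n2 that in auto)
      show ?thesis using X.zonal_coeff_reproducing[OF q] \<omega>_pos
        by (simp add: X.zonal_coeff_def field_simps)
    qed
    have "(\<integral>y. p y * q y \<partial>sphere_measure) = (\<integral>y. ((\<integral>x. zonal_harmonic n k (y \<bullet> x) 1 * w x \<partial>sphere_measure) * q y) / \<omega> \<partial>sphere_measure)"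
      by (intro Bochner_Integration.integral_cong) (auto simp: p_def Z_def dot_square_norm)
    also have "\<dots> = (\<integral>y. (\<integral>x. zonal_harmonic n k (y \<bullet> x) 1 * w x \<partial>sphere_measure) * q y \<partial>sphere_measure) / \<omega>"
      by simp
    also have "\<dots> = (\<integral>x. w x * (\<integral>y. zonal_harmonic n k (y \<bullet> x) 1 * q y \<partial>sphere_measure) \<partial>sphere_measure) / \<omega>"
      by (subst Fubini_sphere_zonal[OF _ w cp[OF q]]) (auto intro!: continuous_intros)
    also have "(\<integral>x. w x * (\<integral>y. zonal_harmonic n k (y \<bullet> x) 1 * q y \<partial>sphere_measure) \<partial>sphere_measure) = (\<integral>x. \<omega> * (w x * q x) \<partial>sphere_measure)"
      by (intro Bochner_Integration.integral_cong) (auto simp: rep)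
    finally have "(\<integral>y. p y * q y \<partial>sphere_measure) = (\<integral>x. w x * q x \<partial>sphere_measure)" using \<omega>_pos by simp
    moreover have "integrable sphere_measure (\<lambda>x. w x * q x)" "integrable sphere_measure (\<lambda>x. p x * q x)"
      by (intro integrable_sphere_continuous continuous_intros w cp q pH)+
    ultimately show ?thesis by (simp add: left_diff_distrib)
  qed
  have "harmonic_component k w = p"
    unfolding harmonic_component_def
  proof (rule the_equality)
    show "p \<in> spherical_harmonics k \<and> (\<forall>q\<in>spherical_harmonics k. (\<integral>x. (w x - p x) * q x \<partial>sphere_measure) = 0)"
      using pH orth by blast
    fix p' assume p': "p' \<in> spherical_harmonics k \<and> (\<forall>q\<in>spherical_harmonics k. (\<integral>x. (w x - p' x) * q x \<partial>sphere_measure) = 0)"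
    define d where "d x = p' x - p x" for x
    have d: "d \<in> spherical_harmonics k" unfolding d_def using p' pH by (blast intro: spherical_harmonics_diff)
    have "integrable sphere_measure (\<lambda>x. (w x - p x) * d x)" "integrable sphere_measure (\<lambda>x. (w x - p' x) * d x)"
      using p' by (intro integrable_sphere_continuous continuous_intros w cp d pH; blast)+
    \<comment> \<open>Testing both orthogonality relations against the difference d of two
      candidates leaves the integral of d^2.\<close>
    then have "(\<integral>x. (w x - p x) * d x - (w x - p' x) * d x \<partial>sphere_measure) = 0"
      using orth[OF d] p' d by (subst Bochner_Integration.integral_diff) auto
    moreover have "(w x - p x) * d x - (w x - p' x) * d x = (d x)\<^sup>2" for x
      by (simp add: d_def power2_eq_square algebra_simps)
    ultimately have "(\<integral>x. (d x)\<^sup>2 \<partial>sphere_measure) = 0" by simp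
    then have "(d x)\<^sup>2 = 0" if "norm x = 1" for x
      using that by (intro integral_sphere_eq_0_iff[of "\<lambda>x. (d x)\<^sup>2" x]) (auto intro: continuous_on_power[OF cp[OF d]])
    then have "p' x = p x" if "norm x = 1" for x using that by (simp add: d_def)
    then show "p' = p" using p' pH by (intro spherical_harmonics_eqI) auto
  qed
  moreover have "p e = zonal_coeff k w"
    using e by (simp add: p_def Z_def zonal_coeff_def inner_commute dot_square_norm)
  ultimately show ?thesis by simp
qed

text \<open>The pole is a null set: the Poisson kernel is at least 1 / (1 - r) there while its
  integral is \<omega> for every r, so the mass of the pole is at most \<omega> (1 - r). Kernels
  singular at e can therefore be treated almost everywhere.\<close>

lemma AE_inner_less_1: "AE x in sphere_measure. x \<bullet> e < 1"
proof -
  let ?S = "sphere_measure :: (real^'m) measure"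
  have es: "{e} \<in> sets ?S"
    using e by (auto simp: sets_sphere_measure sets_restrict_space_iff)
  define m where "m = measure ?S {e}"
  have m0: "m \<ge> 0" by (simp add: m_def)
  have "m \<le> \<omega> * (1 - r)" if r: "0 \<le> r" "r < 1" for r
  proof -
    have ee: "e \<bullet> e = 1" using e by (simp add: dot_square_norm)
    have cP: "continuous_on (sphere 0 1) (\<lambda>x. poisson_kernel n r (x \<bullet> e))"
      using r e abs_inner_sphere_le_1 by (intro continuous_on_poisson_kernel continuous_intros) auto
    have "poisson_kernel n r 1 * m = (\<integral>x. poisson_kernel n r 1 * indicator {e} x \<partial>?S)"
      using es e by (simp add: m_def Int_absorb2)
    also have "\<dots> \<le> (\<integral>x. poisson_kernel n r (x \<bullet> e) \<partial>?S)"
    proof (rule integral_mono[OF _ integrable_sphere_continuous[OF cP]])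
      show "integrable ?S (\<lambda>x. poisson_kernel n r 1 * indicator {e} x)"
        by (intro integrable_mult_right integrable_real_indicator es) (simp add: less_top[symmetric])
      fix x assume "x \<in> space ?S"
      then have x: "norm x = 1" by simp
      have "0 \<le> poisson_kernel n r (x \<bullet> e)"
        using r by (auto simp: poisson_kernel_def abs_square_le_1 intro!: mult_nonneg_nonneg)
      then show "poisson_kernel n r 1 * indicator {e} x \<le> poisson_kernel n r (x \<bullet> e)"
        by (auto simp: indicator_def ee)
    qed
    also have "\<dots> = \<omega>" using r by (intro integral_poisson_kernel) auto
    finally have 1: "poisson_kernel n r 1 * m \<le> \<omega>" .
    have "1 / (1 - r) \<le> poisson_kernel n r 1"
    proof -
      have "(1 - 2 * r * 1 + r\<^sup>2) = (1 - r)\<^sup>2" by (simp add: power2_eq_square algebra_simps)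
      then have "(1 - 2 * r * 1 + r\<^sup>2) powr (- ((real n + 1) / 2)) = (1 - r) powr (- (real n + 1))"
        using r by (simp add: powr_powr add_divide_distrib flip: powr_numeral)
      moreover have "(1 - r) powr (-2) \<le> (1 - r) powr (- (real n + 1))"
        using r n2 by (intro powr_mono') auto
      ultimately have "(1 - r) * (1 - r) powr (-2) \<le> (1 - r\<^sup>2) * (1 - 2 * r * 1 + r\<^sup>2) powr (- ((real n + 1) / 2))"
        using r by (intro mult_mono) (auto simp: power2_eq_square mult_left_le mult_le_one)
      moreover have "(1 - r) * (1 - r) powr (-2) = 1 / (1 - r)"
        using r by (simp add: powr_minus divide_simps power2_eq_square)
      ultimately show ?thesis by (simp add: poisson_kernel_def)
    qed
    then have "1 / (1 - r) * m \<le> poisson_kernel n r 1 * m" using m0 by (rule mult_right_mono)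
    with 1 have "1 / (1 - r) * m \<le> \<omega>" by linarith
    then show ?thesis using r by (simp add: field_simps)
  qed
  note bound = this
  have "((\<lambda>r. \<omega> * (1 - r)) \<longlongrightarrow> \<omega> * (1 - 1)) (at_left (1::real))" by (intro tendsto_intros)
  then have "m \<le> \<omega> * (1 - 1)"
    by (rule tendsto_lowerbound) (auto intro!: eventually_at_leftI[of 0] bound)
  then have "m = 0" using m0 by simp
  then have "emeasure ?S {e} = 0" by (simp add: m_def sphere_measure.emeasure_eq_measure)
  moreover have "{x \<in> space ?S. \<not> x \<bullet> e < 1} \<subseteq> {e}"
  proof safe
    fix x assume x: "x \<in> space ?S" "\<not> x \<bullet> e < 1"
    then have "norm x = 1" "x \<bullet> e \<ge> 1" by auto
    then have "x \<bullet> e = norm x * norm e" using norm_cauchy_schwarz[of x e] e by simp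
    then show "x = e" using norm_cauchy_schwarz_eq[of x e] \<open>norm x = 1\<close> e by simp
  qed
  ultimately show ?thesis using es by (auto intro!: AE_I[where N="{e}"])
qed

text \<open>The Poisson expansion is multiplied by the Beta weight and integrated in r. On the
  kernel side subordination produces the Riesz kernel; on the coefficient side r^k shifts the first
  Beta parameter to k + \<alpha>. Integrability of the singular kernel against g comes out of
  Fubini.\<close>

lemma riesz_potential_expansion:
  assumes g: "continuous_on (sphere 0 1) g" and sg: "summable (\<lambda>k. \<bar>zonal_coeff k g\<bar>)"
    and \<alpha>: "0 < \<alpha>" "\<alpha> < real n / 2"
  shows "integrable sphere_measure (\<lambda>x. (2 - 2 * (x \<bullet> e)) powr (- \<alpha>) * g x)" (is ?int)
    and "(\<lambda>k. zonal_coeff k g * Beta (real k + \<alpha>) (real n - 2 * \<alpha>)) sums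
       (Beta \<alpha> ((real n + 1) / 2 - \<alpha>) * (\<integral>x. (2 - 2 * (x \<bullet> e)) powr (- \<alpha>) * g x \<partial>sphere_measure) / \<omega>)" (is ?sum)
proof -
  let ?S = "sphere_measure :: (real^'m) measure"
  define \<beta> where "\<beta> = real n - 2 * \<alpha>"
  have \<beta>: "\<beta> > 0" using \<alpha> by (simp add: \<beta>_def)
  define h where "h = beta_weight \<alpha> \<beta>"
  have h[measurable]: "h \<in> borel_measurable borel" by (simp add: h_def)
  have h0: "h r \<ge> 0" for r by (simp add: h_def)
  have hout: "h r = 0" if "\<not> (0 < r \<and> r < 1)" for r using that by (auto simp: h_def beta_weight_def)
  have inth: "integrable lborel h" using has_bochner_integral_beta_weight[OF \<alpha>(1) \<beta>] by (auto simp: h_def has_bochner_integral_iff)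
  define B0 where "B0 = Beta \<alpha> ((real n + 1) / 2 - \<alpha>)"
  have B0: "B0 > 0" unfolding B0_def by (rule Beta_real_pos) (use \<alpha> in auto)
  have gm[measurable]: "g \<in> borel_measurable ?S" by (rule borel_measurable_sphere_measure_continuous[OF g])
  have "bounded (g ` sphere 0 1)" using g by (intro compact_imp_bounded compact_continuous_image) auto
  then obtain B where B: "\<And>x. x \<in> sphere 0 1 \<Longrightarrow> \<bar>g x\<bar> \<le> B"
    unfolding bounded_iff real_norm_def by blast
  have te: "-1 \<le> x \<bullet> e" "x \<bullet> e \<le> 1" if "norm x = 1" for x
    using abs_inner_sphere_le_1[OF that e] by (auto simp: abs_le_iff)
  have ie[measurable]: "(\<lambda>x. x \<bullet> e) \<in> borel_measurable ?S"
    by (intro borel_measurable_inner borel_measurable_sphere_id borel_measurable_const)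
  interpret PS: pair_sigma_finite lborel ?S ..
  define \<Phi> where "\<Phi> r x = h r * poisson_kernel n r (x \<bullet> e) * g x" for r x
  have \<Phi>m[measurable]: "(\<lambda>(r, x). \<Phi> r x) \<in> borel_measurable (lborel \<Otimes>\<^sub>M ?S)"
  proof -
    have [measurable]: "(\<lambda>p. snd p \<bullet> e) \<in> borel_measurable (lborel \<Otimes>\<^sub>M ?S)"
      by (rule measurable_compose[OF measurable_snd ie])
    show ?thesis unfolding \<Phi>_def split_beta' poisson_kernel_def by measurable
  qed
  have P0: "0 \<le> poisson_kernel n r t" if "0 < r" "r < 1" for r t
    using that by (auto simp: poisson_kernel_def abs_square_le_1 intro!: mult_nonneg_nonneg)
  have cP: "continuous_on (sphere 0 1) (\<lambda>x. poisson_kernel n r (x \<bullet> e))" if "0 < r" "r < 1" for r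
    using that e abs_inner_sphere_le_1 by (intro continuous_on_poisson_kernel continuous_intros) auto
  have intPg: "integrable ?S (\<lambda>x. poisson_kernel n r (x \<bullet> e) * g x)" if "0 < r" "r < 1" for r
    by (intro integrable_sphere_continuous continuous_intros cP that g)
  have int\<Phi>r: "integrable ?S (\<Phi> r)" for r
  proof (cases "0 < r \<and> r < 1")
    case True
    then show ?thesis using intPg[of r] by (simp add: \<Phi>_def[abs_def] mult.assoc)
  qed (simp add: \<Phi>_def[abs_def] hout)
  have norm\<Phi>: "(\<integral>x. norm (\<Phi> r x) \<partial>?S) \<le> h r * (B * \<omega>)" for r
  proof (cases "0 < r \<and> r < 1")
    case True
    then have r: "0 < r" "r < 1" by auto
    have "(\<integral>x. norm (\<Phi> r x) \<partial>?S) \<le> (\<integral>x. h r * B * poisson_kernel n r (x \<bullet> e) \<partial>?S)"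
    proof (intro integral_mono integrable_norm int\<Phi>r integrable_mult_right integrable_sphere_continuous cP r)
      fix x assume "x \<in> space ?S"
      then have "norm (\<Phi> r x) \<le> h r * poisson_kernel n r (x \<bullet> e) * B"
        using B h0[of r] P0[OF r] unfolding \<Phi>_def norm_mult by (intro mult_mono) auto
      then show "norm (\<Phi> r x) \<le> h r * B * poisson_kernel n r (x \<bullet> e)" by (simp add: mult_ac)
    qed
    also have "\<dots> = h r * (B * \<omega>)" using r by (simp add: integral_poisson_kernel)
    finally show ?thesis .
  qed (simp add: \<Phi>_def hout)
  have int: "integrable (lborel \<Otimes>\<^sub>M ?S) (\<lambda>(r, x). \<Phi> r x)"
  proof (rule PS.Fubini_integrable[OF \<Phi>m])
    show "integrable lborel (\<lambda>r. \<integral>x. norm (case (r, x) of (r, x) \<Rightarrow> \<Phi> r x) \<partial>?S)"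
    proof (rule Bochner_Integration.integrable_bound)
      show "integrable lborel (\<lambda>r. h r * (B * \<omega>))" using inth by simp
      show "AE r in lborel. norm (\<integral>x. norm (case (r, x) of (r, x) \<Rightarrow> \<Phi> r x) \<partial>?S) \<le> norm (h r * (B * \<omega>))"
        using norm\<Phi> by (intro AE_I2) (auto intro: order_trans[OF _ abs_ge_self])
      show "(\<lambda>r. \<integral>x. norm (case (r, x) of (r, x) \<Rightarrow> \<Phi> r x) \<partial>?S) \<in> borel_measurable lborel"
        using \<Phi>m by measurable
    qed
    show "AE r in lborel. integrable ?S (\<lambda>x. case (r, x) of (r, x) \<Rightarrow> \<Phi> r x)" using int\<Phi>r by simp
  qed
  \<comment> \<open>Almost everywhere only, since the subordination formula is for x \<bullet> e <
    1.\<close>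
  have inner: "AE x in ?S. (\<integral>r. \<Phi> r x \<partial>lborel) = B0 * ((2 - 2 * (x \<bullet> e)) powr (- \<alpha>) * g x)"
    using AE_inner_less_1 AE_space
  proof eventually_elim
    case (elim x)
    have "(\<integral>\<^sup>+r. ennreal (h r * poisson_kernel n r (x \<bullet> e)) \<partial>lborel) = ennreal (B0 * (2 - 2 * (x \<bullet> e)) powr (- \<alpha>))"
      unfolding h_def \<beta>_def B0_def using elim te by (intro nn_integral_poisson_subordination \<alpha>) auto
    then have "(\<integral>r. h r * poisson_kernel n r (x \<bullet> e) \<partial>lborel) = B0 * (2 - 2 * (x \<bullet> e)) powr (- \<alpha>)"
    proof (subst integral_eq_nn_integral)
      show "AE r in lborel. 0 \<le> h r * poisson_kernel n r (x \<bullet> e)"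
        using P0 h0 hout by (intro AE_I2) (metis mult_nonneg_nonneg mult_zero_left order_refl)
      show "(\<lambda>r. h r * poisson_kernel n r (x \<bullet> e)) \<in> borel_measurable lborel" unfolding poisson_kernel_def by measurable
    qed (use B0 in simp)
    moreover have "(\<integral>r. \<Phi> r x \<partial>lborel) = (\<integral>r. h r * poisson_kernel n r (x \<bullet> e) \<partial>lborel) * g x"
      by (simp add: \<Phi>_def)
    ultimately show ?case by simp
  qed
  have snd: "integrable ?S (\<lambda>x. \<integral>r. \<Phi> r x \<partial>lborel)" using PS.integrable_snd[OF int] by simp
  have "integrable ?S (\<lambda>x. B0 * ((2 - 2 * (x \<bullet> e)) powr (- \<alpha>) * g x))"
    by (rule Bochner_Integration.integrable_cong_AE_imp[OF snd _ inner]) measurable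
  then show int1: ?int using B0 by simp
  have "B0 * (\<integral>x. (2 - 2 * (x \<bullet> e)) powr (- \<alpha>) * g x \<partial>?S) = (\<integral>x. \<integral>r. \<Phi> r x \<partial>lborel \<partial>?S)"
    using inner by (subst integral_mult_right_zero[symmetric], intro integral_cong_AE) (auto simp: snd borel_measurable_integrable)
  also have "\<dots> = (\<integral>r. \<integral>x. \<Phi> r x \<partial>?S \<partial>lborel)" using PS.Fubini_integral[OF int] by simp
  also have "\<dots> = (\<integral>r. (\<Sum>k. h r * (zonal_coeff k g * r ^ k)) * \<omega> \<partial>lborel)"
  proof (intro Bochner_Integration.integral_cong refl)
    fix r
    show "(\<integral>x. \<Phi> r x \<partial>?S) = (\<Sum>k. h r * (zonal_coeff k g * r ^ k)) * \<omega>"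
    proof (cases "0 < r \<and> r < 1")
      case True
      then have "(\<lambda>k. h r * (zonal_coeff k g * r ^ k)) sums (h r * ((\<integral>x. poisson_kernel n r (x \<bullet> e) * g x \<partial>?S) / \<omega>))"
        by (intro sums_mult zonal_coeff_poisson_sums g) auto
      then show ?thesis using \<omega>_pos by (simp add: sums_iff \<Phi>_def mult.assoc)
    qed (simp add: \<Phi>_def hout)
  qed
  finally have 1: "B0 * (\<integral>x. (2 - 2 * (x \<bullet> e)) powr (- \<alpha>) * g x \<partial>?S) / \<omega> = (\<integral>r. (\<Sum>k. h r * (zonal_coeff k g * r ^ k)) \<partial>lborel)"
    using \<omega>_pos by simp
  have bw: "h r * r ^ k = beta_weight (real k + \<alpha>) \<beta> r" for r k
  proof (cases "0 < r \<and> r < 1")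
    case True
    then show ?thesis
      by (simp add: h_def beta_weight_def powr_realpow[symmetric] mult_ac flip: powr_add)
        (simp add: add_ac add_diff_eq)
  qed (auto simp: hout beta_weight_def)
  have bwI: "has_bochner_integral lborel (\<lambda>r. h r * r ^ k) (Beta (real k + \<alpha>) \<beta>)" for k
    unfolding bw using has_bochner_integral_beta_weight[of "real k + \<alpha>" \<beta>] \<alpha> \<beta> by simp
  have "(\<lambda>k. \<integral>r. h r * (zonal_coeff k g * r ^ k) \<partial>lborel) sums (\<integral>r. (\<Sum>k. h r * (zonal_coeff k g * r ^ k)) \<partial>lborel)"
  proof (rule sums_integral)
    show i: "integrable lborel (\<lambda>r. h r * (zonal_coeff k g * r ^ k))" for k
    proof -
      have "(\<lambda>r. h r * (zonal_coeff k g * r ^ k)) = (\<lambda>r. zonal_coeff k g * (h r * r ^ k))" by (simp add: mult_ac)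
      then show ?thesis using bwI[of k] by (auto simp: has_bochner_integral_iff)
    qed
    \<comment> \<open>Bounding r^k by 1 keeps the majorant uniform up to r = 1; this is where
      absolute summability of the coefficients enters.\<close>
    have le: "norm (h r * (zonal_coeff k g * r ^ k)) \<le> \<bar>zonal_coeff k g\<bar> * h r" for k r
    proof (cases "0 < r \<and> r < 1")
      case True
      then have "h r * (\<bar>zonal_coeff k g\<bar> * r ^ k) \<le> h r * (\<bar>zonal_coeff k g\<bar> * 1)"
        using h0 by (intro mult_left_mono) (auto simp: power_le_one)
      then show ?thesis using True h0[of r] by (simp add: abs_mult mult.commute power_abs)
    qed (simp add: hout)
    show "AE r in lborel. summable (\<lambda>k. norm (h r * (zonal_coeff k g * r ^ k)))"
      using le by (intro AE_I2 summable_comparison_test'[OF summable_mult2[OF sg], of 0]) auto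
    show "summable (\<lambda>k. \<integral>r. norm (h r * (zonal_coeff k g * r ^ k)) \<partial>lborel)"
    proof (rule summable_comparison_test'[OF summable_mult2[OF sg, of "integral\<^sup>L lborel h"], of 0])
      fix k
      have "(\<integral>r. norm (h r * (zonal_coeff k g * r ^ k)) \<partial>lborel) \<le> (\<integral>r. \<bar>zonal_coeff k g\<bar> * h r \<partial>lborel)"
        using le inth i by (intro integral_mono integrable_norm) auto
      then show "norm (\<integral>r. norm (h r * (zonal_coeff k g * r ^ k)) \<partial>lborel) \<le> \<bar>zonal_coeff k g\<bar> * integral\<^sup>L lborel h" by simp
    qed
  qed
  moreover have "(\<integral>r. h r * (zonal_coeff k g * r ^ k) \<partial>lborel) = zonal_coeff k g * Beta (real k + \<alpha>) \<beta>" for k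
    using bwI[of k] by (subst mult.left_commute) (simp add: has_bochner_integral_iff)
  ultimately show ?sum unfolding 1[symmetric] B0_def \<beta>_def by simp
qed

end


section \<open>Singular integrals near the sphere\<close>

context sphere_dim
begin

definition singular_integral :: "real \<Rightarrow> (real^'m \<Rightarrow> real) \<Rightarrow> real \<Rightarrow> real" where
  "singular_integral a w b = (\<integral>x. (b - x \<bullet> e) powr (- a) * w x \<partial>sphere_measure)"

lemma inner_bounds: "norm x = 1 \<Longrightarrow> -1 \<le> x \<bullet> e" "norm x = 1 \<Longrightarrow> x \<bullet> e \<le> 1"
  using abs_inner_sphere_le_1[OF _ e] by (auto simp: abs_le_iff)

lemma continuous_on_singular_kernel:
  assumes "b > 1" "continuous_on (sphere 0 1) w"
  shows "continuous_on (sphere 0 1) (\<lambda>x. (b - x \<bullet> e) powr (- a) * w x)"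
proof -
  have "b - x \<bullet> e \<noteq> 0" if "x \<in> sphere 0 1" for x using inner_bounds(2)[of x] that assms by auto
  then show ?thesis by (intro continuous_intros assms) auto
qed

lemma has_derivative_singular_integral:
  assumes b: "b > 1" and w: "continuous_on (sphere 0 1) w"
  shows "(singular_integral a w has_real_derivative (- a * singular_integral (a + 1) w b)) (at b)"
proof -
  define g where "g b x = - a * ((b - x \<bullet> e) powr (- (a + 1)) * w x)" for b x
  have pos: "b - x \<bullet> e > 0" if "b > 1" "norm x = 1" for b :: real and x
    using inner_bounds(2)[of x] that by auto
  have "((\<lambda>b. \<integral>x. (b - x \<bullet> e) powr (- a) * w x \<partial>sphere_measure) has_derivative (\<lambda>h. (\<integral>x. g b x \<partial>sphere_measure) \<bullet> h)) (at b)"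
  proof (rule has_derivative_integral_sphere[where S="{1<..}"])
    show "continuous_on (sphere 0 1) (\<lambda>x. (b - x \<bullet> e) powr (- a) * w x)" if "b \<in> {1<..}" for b
      using continuous_on_singular_kernel[OF _ w] that by simp
    show "continuous_on ({1<..} \<times> sphere 0 1) (\<lambda>(b, x). g b x)"
    proof -
      have "continuous_on ({1<..} \<times> sphere 0 1) (\<lambda>p::real \<times> (real^'m). w (snd p))"
        by (rule continuous_on_compose2[OF w]) (auto intro!: continuous_intros)
      moreover have "\<forall>p \<in> {1<..} \<times> sphere 0 1. fst p - snd p \<bullet> e \<noteq> 0" using pos by force
      ultimately show ?thesis unfolding g_def split_beta' by (intro continuous_intros) auto
    qed
    fix b :: real and x assume "b \<in> {1<..}" "x \<in> sphere (0::real^'m) 1"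
    then have "b - x \<bullet> e > 0" using pos by auto
    then have "((\<lambda>b. (b - x \<bullet> e) powr (- a) * w x) has_real_derivative g b x) (at b)"
      unfolding g_def by (auto intro!: derivative_eq_intros simp: powr_diff powr_minus field_simps powr_add)
    then show "((\<lambda>b. (b - x \<bullet> e) powr (- a) * w x) has_derivative (\<lambda>h. g b x \<bullet> h)) (at b)"
      by (simp add: has_field_derivative_def)
  qed (use b in auto)
  moreover have "(\<integral>x. g b x \<partial>sphere_measure) = - a * singular_integral (a + 1) w b"
    by (simp add: g_def singular_integral_def)
  moreover have "(\<lambda>h. c \<bullet> h) = (*) c" for c :: real by (rule ext) simp
  moreover have "singular_integral a w = (\<lambda>b. \<integral>x. (b - x \<bullet> e) powr (- a) * w x \<partial>sphere_measure)"
    by (rule ext) (simp add: singular_integral_def)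
  ultimately show ?thesis
    unfolding has_field_derivative_def by metis
qed

text \<open>Symmetry moves the Laplacian to the kernel (b - t)^(-a). Writing t = b - y in the
  ultraspherical operator turns its polynomial coefficients into powers of y, so that the exponents
  a, a + 1 and a + 2 are the only ones to occur.\<close>

lemma singular_integral_sphere_laplacian:
  assumes b: "b > 1" and S: "open S" "sphere 0 1 \<subseteq> S" and F: "Ck_on 2 S F"
  shows "singular_integral a (sphere_laplacian F) b
    = a * (a + 1) * (1 - b\<^sup>2) * singular_integral (a + 2) F b
      + a * (2 * a + 2 - real n) * b * singular_integral (a + 1) F b
      - a * (a + 1 - real n) * singular_integral a F b"
proof -
  \<comment> \<open>The kernel is smooth where x \<bullet> e < b; as b > 1, this half space still
    contains the sphere.\<close>
  define S' where "S' = S \<inter> {x. x \<bullet> e < b}"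
  have S': "open S'" unfolding S'_def by (intro open_Int S open_Collect_less continuous_intros)
  have "x \<in> S'" if "norm x = 1" for x using inner_bounds(2)[OF that] b S that by (auto simp: S'_def)
  then have sS': "sphere 0 1 \<subseteq> S'" by auto
  have F': "Ck_on 2 S' F" by (rule Ck_on_subset[OF F]) (simp add: S'_def)
  define k where "k t = (b - t) powr (- a)" for t
  define k' where "k' t = a * (b - t) powr (- a - 1)" for t
  define k'' where "k'' t = a * (a + 1) * (b - t) powr (- a - 2)" for t
  have dk: "(k has_real_derivative k' t) (at t)" if "t \<in> {..<b}" for t
    using that unfolding k_def k'_def by (auto intro!: derivative_eq_intros)
  have dk': "(k' has_real_derivative k'' t) (at t)" if "t \<in> {..<b}" for t
    using that unfolding k'_def k''_def by (auto intro!: derivative_eq_intros simp: algebra_simps)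
  have ck'': "continuous_on {..<b} k''" unfolding k''_def by (intro continuous_intros) auto
  have xI: "x \<bullet> e \<in> {..<b}" if "x \<in> S'" for x using that by (simp add: S'_def)
  have K: "Ck_on 2 S' (\<lambda>x. k (x \<bullet> e))" by (rule Ck_on_2_zonal[OF S' xI dk dk' ck''])
  have L: "sphere_laplacian (\<lambda>x. k (x \<bullet> e)) x
     = a * (a + 1) * (1 - b\<^sup>2) * (b - x \<bullet> e) powr (- (a + 2)) + a * (2 * a + 2 - real n) * b * (b - x \<bullet> e) powr (- (a + 1))
       - a * (a + 1 - real n) * (b - x \<bullet> e) powr (- a)" if x: "norm x = 1" for x
  proof -
    define t where "t = x \<bullet> e"
    define y where "y = b - t"
    have xS': "x \<in> S'" using x sS' by auto
    then have y: "y > 0" using xI by (auto simp: y_def t_def)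
    define Y where "Y = y powr (- a - 2)"
    have Y1: "y powr (- a - 1) = y * Y"
    proof -
      have "y powr ((- a - 2) + 1) = Y * y powr 1" unfolding Y_def by (rule powr_add)
      moreover have "(- a - 2) + 1 = - a - 1" by simp
      ultimately show ?thesis using y by simp
    qed
    have Y2: "y powr (- a) = y * y * Y"
    proof -
      have "y powr ((- a - 2) + 2) = Y * y powr 2" unfolding Y_def by (rule powr_add)
      moreover have "(- a - 2) + 2 = - a" by simp
      ultimately show ?thesis using y by (simp add: power2_eq_square)
    qed
    have t: "t = b - y" by (simp add: y_def)
    have "sphere_laplacian (\<lambda>x. k (x \<bullet> e)) x = (1 - t\<^sup>2) * k'' t - real n * t * k' t"
      unfolding t_def using sphere_laplacian_zonal[OF S' xI dk dk' e x xS'] card by simp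
    also have "\<dots> = (1 - t\<^sup>2) * (a * (a + 1) * Y) - real n * t * (a * (y * Y))"
      unfolding k''_def k'_def y_def[symmetric] Y_def[symmetric] Y1 by (simp add: Y_def)
    also have "\<dots> = a * (a + 1) * (1 - b\<^sup>2) * Y + a * (2 * a + 2 - real n) * b * (y * Y) - a * (a + 1 - real n) * (y * y * Y)"
      unfolding t by (simp add: power2_eq_square algebra_simps)
    also have "\<dots> = a * (a + 1) * (1 - b\<^sup>2) * y powr (- (a + 2)) + a * (2 * a + 2 - real n) * b * y powr (- (a + 1))
       - a * (a + 1 - real n) * y powr (- a)"
    proof -
      have "y powr (- (a + 2)) = Y" "y powr (- (a + 1)) = y * Y" using Y1 by (simp_all add: Y_def)
      then show ?thesis unfolding Y2 by simp
    qed
    finally show ?thesis unfolding y_def t_def .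
  qed
  have cF: "continuous_on (sphere 0 1) F" using Ck_on_le[OF F, of 0] S by (auto intro: continuous_on_subset)
  have i: "integrable sphere_measure (\<lambda>x. (b - x \<bullet> e) powr (- c) * F x)" for c
    by (intro integrable_sphere_continuous continuous_on_singular_kernel b cF)
  have "singular_integral a (sphere_laplacian F) b = (\<integral>x. sphere_laplacian (\<lambda>x. k (x \<bullet> e)) x * F x \<partial>sphere_measure)"
    using integral_sphere_laplacian_symmetric[OF S' sS' K F'] by (simp add: singular_integral_def k_def)
  also have "\<dots> = (\<integral>x. a * (a + 1) * (1 - b\<^sup>2) * ((b - x \<bullet> e) powr (- (a + 2)) * F x)
       + a * (2 * a + 2 - real n) * b * ((b - x \<bullet> e) powr (- (a + 1)) * F x)
       - a * (a + 1 - real n) * ((b - x \<bullet> e) powr (- a) * F x) \<partial>sphere_measure)"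
    by (intro Bochner_Integration.integral_cong refl) (auto simp: L algebra_simps)
  also have "\<dots> = a * (a + 1) * (1 - b\<^sup>2) * singular_integral (a + 2) F b
      + a * (2 * a + 2 - real n) * b * singular_integral (a + 1) F b
      - a * (a + 1 - real n) * singular_integral a F b"
    unfolding singular_integral_def
    by (subst Bochner_Integration.integral_diff, intro Bochner_Integration.integrable_add integrable_mult_right i,
        intro integrable_mult_right i, subst Bochner_Integration.integral_add, (intro integrable_mult_right i)+) simp
  finally show ?thesis .
qed

text \<open>The power of b^2 - 1 compensates the blow-up of the integral as b tends to 1, so that
  the kernel becomes an approximate identity. For \<kappa> = \<sigma> this is the extension along a
  ray, up to an elementary factor.\<close>

definition scaled_singular :: "real \<Rightarrow> (real^'m \<Rightarrow> real) \<Rightarrow> real \<Rightarrow> real" where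
  "scaled_singular \<kappa> w b = (b\<^sup>2 - 1) powr \<kappa> * singular_integral (real n / 2 + \<kappa>) w b"

text \<open>The product rule yields integrals with exponents \<alpha> + 1 and \<alpha> + 2 in
  exactly the proportion in which they occur in Green's identity for the exponent \<alpha>, because
  2 \<alpha> + 2 - n = 2 \<kappa>. Both are traded for integrals with exponent \<alpha>, the price
  being a Laplacian on F.\<close>

lemma has_derivative_scaled_singular:
  assumes b: "b > 1" and S: "open S" "sphere 0 1 \<subseteq> S" and F: "Ck_on 2 S F"
    and \<alpha>: "\<alpha> = real n / 2 + \<kappa> - 1" "\<alpha> \<noteq> 0"
  shows "(scaled_singular \<kappa> F has_real_derivative
     (- ((b\<^sup>2 - 1) powr (\<kappa> - 1) / \<alpha>) * singular_integral \<alpha> (\<lambda>x. \<alpha> * (real n - 1 - \<alpha>) * F x - sphere_laplacian F x) b)) (at b)"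
proof -
  have cF: "continuous_on (sphere 0 1) F" "continuous_on (sphere 0 1) (sphere_laplacian F)"
    using Ck_on_le[OF F, of 0] Ck_on_sphere_laplacian[OF S(1) F[unfolded numeral_2_eq_2]] S
    by (auto intro: continuous_on_subset)
  define M where "M a = singular_integral a F b" for a
  have b2: "b\<^sup>2 - 1 > 0" using b by (simp add: one_less_power)
  have dM: "(singular_integral (\<alpha> + 1) F has_real_derivative (- (\<alpha> + 1) * M (\<alpha> + 2))) (at b)"
    using has_derivative_singular_integral[OF b cF(1), of "\<alpha> + 1"] by (simp add: M_def add.assoc)
  have "((\<lambda>b. (b\<^sup>2 - 1) powr \<kappa> * singular_integral (\<alpha> + 1) F b) has_real_derivative
      (\<kappa> * (b\<^sup>2 - 1) powr (\<kappa> - 1) * (2 * b) * M (\<alpha> + 1) + (b\<^sup>2 - 1) powr \<kappa> * (- (\<alpha> + 1) * M (\<alpha> + 2)))) (at b)"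
    using b2 by (auto intro!: derivative_eq_intros dM simp: M_def)
  moreover have "(b\<^sup>2 - 1) powr \<kappa> = (b\<^sup>2 - 1) powr (\<kappa> - 1) * (b\<^sup>2 - 1)" using b2 by (simp add: powr_diff)
  moreover have "singular_integral \<alpha> (\<lambda>x. \<alpha> * (real n - 1 - \<alpha>) * F x - sphere_laplacian F x) b
     = \<alpha> * (real n - 1 - \<alpha>) * M \<alpha> - singular_integral \<alpha> (sphere_laplacian F) b"
  proof -
    have i: "integrable sphere_measure (\<lambda>x. (b - x \<bullet> e) powr (- \<alpha>) * F x)" "integrable sphere_measure (\<lambda>x. (b - x \<bullet> e) powr (- \<alpha>) * sphere_laplacian F x)"
      by (intro integrable_sphere_continuous continuous_on_singular_kernel b cF)+
    have eq: "(b - x \<bullet> e) powr (- \<alpha>) * (\<alpha> * (real n - 1 - \<alpha>) * F x - sphere_laplacian F x)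
       = \<alpha> * (real n - 1 - \<alpha>) * ((b - x \<bullet> e) powr (- \<alpha>) * F x) - (b - x \<bullet> e) powr (- \<alpha>) * sphere_laplacian F x" for x
      by (simp add: algebra_simps)
    show ?thesis unfolding M_def singular_integral_def eq
      by (rule trans[OF Bochner_Integration.integral_diff[OF integrable_mult_right[OF i(1)] i(2)]]) simp
  qed
  moreover have "singular_integral \<alpha> (sphere_laplacian F) b = \<alpha> * (\<alpha> + 1) * (1 - b\<^sup>2) * M (\<alpha> + 2)
      + \<alpha> * (2 * \<kappa>) * b * M (\<alpha> + 1) - \<alpha> * (\<alpha> + 1 - real n) * M \<alpha>"
    unfolding singular_integral_sphere_laplacian[OF b S F] M_def using \<alpha>(1) by simp
  ultimately have "((\<lambda>b. (b\<^sup>2 - 1) powr \<kappa> * singular_integral (\<alpha> + 1) F b) has_real_derivative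
      (- ((b\<^sup>2 - 1) powr (\<kappa> - 1) / \<alpha>) * singular_integral \<alpha> (\<lambda>x. \<alpha> * (real n - 1 - \<alpha>) * F x - sphere_laplacian F x) b)) (at b)"
    using \<alpha>(2) by (elim DERIV_cong) (simp add: divide_simps, simp add: algebra_simps)
  moreover have "\<alpha> + 1 = real n / 2 + \<kappa>" using \<alpha>(1) by simp
  ultimately show ?thesis unfolding scaled_singular_def[abs_def] by simp
qed

section \<open>Singular integrals of the constant function\<close>

lemma singular_integral_one_bounds:
  assumes b: "b > 1" and a: "a \<ge> 0"
  shows "\<omega> * (b + 1) powr (- a) \<le> singular_integral a (\<lambda>_. 1) b"
    and "singular_integral a (\<lambda>_. 1) b \<le> \<omega> * (b - 1) powr (- a)"
proof -
  have i: "integrable sphere_measure (\<lambda>x. (b - x \<bullet> e) powr (- a) * 1)"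
    by (intro integrable_sphere_continuous continuous_on_singular_kernel b) simp
  have "\<omega> * (b + 1) powr (- a) = (\<integral>x. (b + 1) powr (- a) \<partial>(sphere_measure :: (real^'m) measure))" by simp
  also have "\<dots> \<le> singular_integral a (\<lambda>_. 1) b"
    unfolding singular_integral_def
  proof (rule integral_mono[OF _ i])
    fix x assume "x \<in> space (sphere_measure :: (real^'m) measure)"
    then show "(b + 1) powr (- a) \<le> (b - x \<bullet> e) powr (- a) * 1"
      using inner_bounds[of x] a b by (auto intro!: powr_mono2')
  qed simp
  finally show "\<omega> * (b + 1) powr (- a) \<le> singular_integral a (\<lambda>_. 1) b" .
  have "singular_integral a (\<lambda>_. 1) b \<le> (\<integral>x. (b - 1) powr (- a) \<partial>(sphere_measure :: (real^'m) measure))"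
    unfolding singular_integral_def
  proof (rule integral_mono[OF i])
    fix x assume "x \<in> space (sphere_measure :: (real^'m) measure)"
    then show "(b - x \<bullet> e) powr (- a) * 1 \<le> (b - 1) powr (- a)"
      using inner_bounds[of x] a b by (auto intro!: powr_mono2')
  qed simp
  also have "\<dots> = \<omega> * (b - 1) powr (- a)" by simp
  finally show "singular_integral a (\<lambda>_. 1) b \<le> \<omega> * (b - 1) powr (- a)" .
qed

lemma sphere_laplacian_const [simp]: "sphere_laplacian (\<lambda>x :: real^'m. c) x = 0"
proof -
  have "rot_deriv i j (\<lambda>x::real^'m. c) = (\<lambda>x. 0)" "rot_deriv i j (\<lambda>x::real^'m. 0) = (\<lambda>x. 0)" for i j :: 'm and c
    by (rule ext, simp add: rot_deriv_def)+
  then show ?thesis by (simp add: sphere_laplacian_def)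
qed

text \<open>Green's identity for F = 1, whose Laplacian is zero; a contiguity relation of the
  underlying hypergeometric function.\<close>

lemma singular_integral_one_recurrence:
  assumes b: "b > 1" and a: "a \<noteq> 0"
  shows "(a + 1) * (b\<^sup>2 - 1) * singular_integral (a + 2) (\<lambda>_. 1) b
    = (2 * a + 2 - real n) * b * singular_integral (a + 1) (\<lambda>_. 1) b + (real n - 1 - a) * singular_integral a (\<lambda>_. 1) b"
proof -
  have "singular_integral a (sphere_laplacian (\<lambda>_. 1)) b = 0"
    by (simp add: singular_integral_def)
  then have "a * ((a + 1) * (1 - b\<^sup>2) * singular_integral (a + 2) (\<lambda>_. 1) b
      + (2 * a + 2 - real n) * b * singular_integral (a + 1) (\<lambda>_. 1) b
      - (a + 1 - real n) * singular_integral a (\<lambda>_. 1) b) = 0"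
    using singular_integral_sphere_laplacian[OF b open_UNIV subset_UNIV Ck_on_const, of a 1] by (simp add: algebra_simps)
  then have "(a + 1) * (1 - b\<^sup>2) * singular_integral (a + 2) (\<lambda>_. 1) b
      + (2 * a + 2 - real n) * b * singular_integral (a + 1) (\<lambda>_. 1) b
      - (a + 1 - real n) * singular_integral a (\<lambda>_. 1) b = 0"
    using a by (metis mult_eq_0_iff)
  then show ?thesis by (simp add: algebra_simps)
qed

text \<open>By the recurrence the difference of the two sides is constant in \<open>b\<close>, and it vanishes at infinity.\<close>

lemma singular_integral_one_wronskian:
  assumes b: "b > 1" and a: "a > 0" "a < real n - 1"
  shows "(b\<^sup>2 - 1) * singular_integral (a + 1) (\<lambda>_. 1) b * singular_integral (real n - a) (\<lambda>_. 1) b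
    = singular_integral a (\<lambda>_. 1) b * singular_integral (real n - 1 - a) (\<lambda>_. 1) b"
proof -
  define \<alpha> where "\<alpha> = real n - 1 - a"
  have \<alpha>: "\<alpha> > 0" using a by (simp add: \<alpha>_def)
  define M where "M c = singular_integral c (\<lambda>_. 1)" for c
  define W where "W b = (b\<^sup>2 - 1) * (M (a + 1) b * M (\<alpha> + 1) b) - M a b * M \<alpha> b" for b
  have dM: "(M c has_real_derivative (- c * M (c + 1) b)) (at b)" if "b > 1" for b c
    unfolding M_def by (rule has_derivative_singular_integral[OF that]) simp
  have dW: "(W has_real_derivative 0) (at b)" if b: "b > 1" for b
  proof -
    have r: "(a + 1) * (b\<^sup>2 - 1) * M (a + 2) b = (2 * a + 2 - real n) * b * M (a + 1) b + \<alpha> * M a b"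
       "(\<alpha> + 1) * (b\<^sup>2 - 1) * M (\<alpha> + 2) b = (2 * \<alpha> + 2 - real n) * b * M (\<alpha> + 1) b + a * M \<alpha> b"
      unfolding M_def using singular_integral_one_recurrence[OF b, of a] singular_integral_one_recurrence[OF b, of \<alpha>] a \<alpha>
      by (simp_all add: \<alpha>_def)
    have "(W has_real_derivative (2 * b * (M (a + 1) b * M (\<alpha> + 1) b)
        + (b\<^sup>2 - 1) * ((- (a + 1) * M (a + 2) b) * M (\<alpha> + 1) b + M (a + 1) b * (- (\<alpha> + 1) * M (\<alpha> + 2) b))
        - ((- a * M (a + 1) b) * M \<alpha> b + M a b * (- \<alpha> * M (\<alpha> + 1) b)))) (at b)"
      unfolding W_def[abs_def]
      using dM[OF b, of "a + 1"] dM[OF b, of "\<alpha> + 1"] dM[OF b, of a] dM[OF b, of \<alpha>]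
      by (auto intro!: derivative_eq_intros simp: add.assoc algebra_simps)
    moreover have "2 * b * (M (a + 1) b * M (\<alpha> + 1) b)
        + (b\<^sup>2 - 1) * ((- (a + 1) * M (a + 2) b) * M (\<alpha> + 1) b + M (a + 1) b * (- (\<alpha> + 1) * M (\<alpha> + 2) b))
        - ((- a * M (a + 1) b) * M \<alpha> b + M a b * (- \<alpha> * M (\<alpha> + 1) b))
      = 2 * b * (M (a + 1) b * M (\<alpha> + 1) b)
        - ((a + 1) * (b\<^sup>2 - 1) * M (a + 2) b) * M (\<alpha> + 1) b - M (a + 1) b * ((\<alpha> + 1) * (b\<^sup>2 - 1) * M (\<alpha> + 2) b)
        + a * M (a + 1) b * M \<alpha> b + \<alpha> * M a b * M (\<alpha> + 1) b"
      by (simp add: algebra_simps)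
    moreover have "\<dots> = (2 - (2 * a + 2 - real n) - (2 * \<alpha> + 2 - real n)) * (b * (M (a + 1) b * M (\<alpha> + 1) b))"
      unfolding r by (simp add: algebra_simps)
    \<comment> \<open>Here the pairing of a with n - 1 - a enters: the derivative of b^2 - 1 is
      balanced by the two recurrences together.\<close>
    moreover have "2 - (2 * a + 2 - real n) - (2 * \<alpha> + 2 - real n) = 0" by (simp add: \<alpha>_def)
    ultimately show ?thesis by simp
  qed
  have const: "W c = W b" if "c \<ge> b" for c
  proof (cases "c = b")
    case False
    then have "b < c" using that by simp
    then show ?thesis
      using DERIV_isconst_end[of b c W] dW b by (meson DERIV_isCont continuous_at_imp_continuous_on atLeastAtMost_iff less_le_trans order_less_trans)
  qed simp
  have M0: "0 \<le> M c b" "M c b \<le> \<omega> * (b - 1) powr (- c)" if "b > 1" "c \<ge> 0" for b c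
    using singular_integral_one_bounds[OF that] \<omega>_pos by (auto simp: M_def intro: order_trans[rotated])
  have lim: "(W \<longlongrightarrow> 0) at_top"
  proof -
    define H where "H b = (b\<^sup>2 - 1) * (\<omega>\<^sup>2 * (b - 1) powr (- (real n + 1))) + \<omega>\<^sup>2 * (b - 1) powr (- (real n - 1))" for b
    have "(H \<longlongrightarrow> 0) at_top"
    proof -
      \<comment> \<open>The exponents -3 and -1 are those of n = 2; for n \<ge> 2 and b \<ge> 2 they
        dominate.\<close>
      have "((\<lambda>b::real. (b\<^sup>2 - 1) * (\<omega>\<^sup>2 * (b - 1) powr (-3)) + \<omega>\<^sup>2 * (b - 1) powr (-1)) \<longlongrightarrow> 0) at_top"
        by real_asymp
      moreover have "\<forall>\<^sub>F b in at_top. \<bar>H b\<bar> \<le> (b\<^sup>2 - 1) * (\<omega>\<^sup>2 * (b - 1) powr (-3)) + \<omega>\<^sup>2 * (b - 1) powr (-1)"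
        using eventually_ge_at_top[of 2]
      proof eventually_elim
        case (elim b)
        have "(b - 1) powr (- (real n + 1)) \<le> (b - 1) powr (-3)" "(b - 1) powr (- (real n - 1)) \<le> (b - 1) powr (-1)"
          by (rule powr_mono; use elim n2 in simp)+
        moreover have "b\<^sup>2 - 1 \<ge> 0" using elim by (simp add: one_le_power)
        ultimately have "(b\<^sup>2 - 1) * (\<omega>\<^sup>2 * (b - 1) powr (- (real n + 1))) \<le> (b\<^sup>2 - 1) * (\<omega>\<^sup>2 * (b - 1) powr (-3))"
          "\<omega>\<^sup>2 * (b - 1) powr (- (real n - 1)) \<le> \<omega>\<^sup>2 * (b - 1) powr (-1)"
          "0 \<le> (b\<^sup>2 - 1) * (\<omega>\<^sup>2 * (b - 1) powr (- (real n + 1)))" "0 \<le> \<omega>\<^sup>2 * (b - 1) powr (- (real n - 1))"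
          by (intro mult_left_mono mult_nonneg_nonneg; simp)+
        then show ?case unfolding H_def by linarith
      qed
      ultimately show ?thesis
        by (intro Lim_null_comparison[of H "\<lambda>b. (b\<^sup>2 - 1) * (\<omega>\<^sup>2 * (b - 1) powr (-3)) + \<omega>\<^sup>2 * (b - 1) powr (-1)" at_top]) simp_all
    qed
    moreover have "\<forall>\<^sub>F b in at_top. \<bar>W b\<bar> \<le> H b"
      using eventually_gt_at_top[of 1]
    proof eventually_elim
      case (elim b)
      have b2: "b\<^sup>2 - 1 \<ge> 0" using elim by (simp add: one_le_power)
      have "M (a + 1) b * M (\<alpha> + 1) b \<le> (\<omega> * (b - 1) powr (- (a + 1))) * (\<omega> * (b - 1) powr (- (\<alpha> + 1)))"
        using elim a \<alpha> \<omega>_pos by (intro mult_mono M0) auto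
      also have "\<dots> = \<omega>\<^sup>2 * (b - 1) powr (- (real n + 1))"
        by (simp add: power2_eq_square \<alpha>_def mult_ac flip: powr_add)
      finally have 1: "M (a + 1) b * M (\<alpha> + 1) b \<le> \<omega>\<^sup>2 * (b - 1) powr (- (real n + 1))" .
      have "M a b * M \<alpha> b \<le> (\<omega> * (b - 1) powr (- a)) * (\<omega> * (b - 1) powr (- \<alpha>))"
        using elim a \<alpha> \<omega>_pos by (intro mult_mono M0) auto
      also have "\<dots> = \<omega>\<^sup>2 * (b - 1) powr (- (real n - 1))"
        by (simp add: power2_eq_square \<alpha>_def mult_ac flip: powr_add)
      finally have 2: "M a b * M \<alpha> b \<le> \<omega>\<^sup>2 * (b - 1) powr (- (real n - 1))" .
      have "0 \<le> M (a + 1) b * M (\<alpha> + 1) b" "0 \<le> M a b * M \<alpha> b" using elim a \<alpha> by (auto intro!: mult_nonneg_nonneg M0)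
      moreover have "(b\<^sup>2 - 1) * (M (a + 1) b * M (\<alpha> + 1) b) \<le> (b\<^sup>2 - 1) * (\<omega>\<^sup>2 * (b - 1) powr (- (real n + 1)))"
        using 1 b2 by (rule mult_left_mono)
      moreover have "0 \<le> (b\<^sup>2 - 1) * (M (a + 1) b * M (\<alpha> + 1) b)" using calculation(1) b2 by simp
      ultimately show ?case using 2 unfolding W_def H_def by linarith
    qed
    ultimately show ?thesis using Lim_null_comparison[of W H at_top] by simp
  qed
  have "(W \<longlongrightarrow> W b) at_top"
    by (rule tendsto_eventually) (rule eventually_mono[OF eventually_ge_at_top[of b]], rule const)
  then have "W b = 0" by (rule tendsto_unique[OF trivial_limit_at_top_linorder _ lim])
  then show ?thesis by (simp add: W_def M_def \<alpha>_def algebra_simps)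
qed

text \<open>Euler's transformation of the hypergeometric function behind these integrals. The
  quotient of the two sides has derivative zero by the Wronskian identity and tends to 1 at
  infinity. The right side has an integrable kernel at b = 1, which determines the limiting mass of
  the singular kernel on the left.\<close>

lemma scaled_singular_one:
  assumes b: "b > 1" and \<kappa>: "0 < \<kappa>" "\<kappa> < 1"
  shows "scaled_singular \<kappa> (\<lambda>_. 1) b = singular_integral (real n / 2 - \<kappa>) (\<lambda>_. 1) b"
proof -
  define a where "a = real n / 2 - \<kappa>"
  define \<alpha> where "\<alpha> = real n / 2 + \<kappa> - 1"
  have a0: "a > 0" "\<alpha> > 0" "a < real n - 1" using n2 \<kappa> by (auto simp: a_def \<alpha>_def)
  have a\<alpha>: "real n - 1 - a = \<alpha>" "real n - 1 - \<alpha> = a" "real n - a = \<alpha> + 1" "real n / 2 + \<kappa> = \<alpha> + 1" by (auto simp: a_def \<alpha>_def)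
  define M where "M c = singular_integral c (\<lambda>_. 1)" for c
  define f where "f = M a"
  define g where "g = scaled_singular \<kappa> (\<lambda>_. 1)"
  have fpos: "f b > 0" if "b > 1" for b
    using singular_integral_one_bounds(1)[OF that, of a] a0 \<omega>_pos that
    by (auto simp: f_def M_def intro: less_le_trans[rotated])
  have dq: "((\<lambda>b. g b / f b) has_real_derivative 0) (at b)" if b: "b > 1" for b
  proof -
    have b2: "b\<^sup>2 - 1 > 0" using b by (simp add: one_less_power)
    define p where "p = (b\<^sup>2 - 1) powr (\<kappa> - 1)"
    have df: "(f has_real_derivative (- a * M (a + 1) b)) (at b)"
      unfolding f_def M_def by (rule has_derivative_singular_integral[OF b]) simp
    have dg: "(g has_real_derivative (- (p * a * M \<alpha> b))) (at b)"
    proof -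
      have "singular_integral \<alpha> (\<lambda>x. \<alpha> * (real n - 1 - \<alpha>) * 1 - sphere_laplacian (\<lambda>_. 1) x) b = \<alpha> * a * M \<alpha> b"
        unfolding a\<alpha> by (simp add: M_def singular_integral_def mult.commute)
      then show ?thesis
        using has_derivative_scaled_singular[OF b open_UNIV subset_UNIV Ck_on_const, of \<alpha> \<kappa> 1] a0
        by (simp add: g_def \<alpha>_def p_def) (simp add: mult_ac)
    qed
    have gb: "g b = p * (b\<^sup>2 - 1) * M (\<alpha> + 1) b"
      unfolding g_def scaled_singular_def a\<alpha> M_def p_def using b2 by (simp add: powr_diff)
    have W: "(b\<^sup>2 - 1) * M (a + 1) b * M (\<alpha> + 1) b = f b * M \<alpha> b"
      using singular_integral_one_wronskian[OF b, of a] a0 by (simp add: a\<alpha> M_def f_def)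
    have D: "((\<lambda>b. g b / f b) has_real_derivative ((- (p * a * M \<alpha> b)) * f b - g b * (- a * M (a + 1) b)) / (f b * f b)) (at b)"
      by (rule DERIV_divide[OF dg df]) (use fpos[OF b] in simp)
    have "(- (p * a * M \<alpha> b)) * f b - g b * (- a * M (a + 1) b) = p * a * ((b\<^sup>2 - 1) * M (a + 1) b * M (\<alpha> + 1) b - f b * M \<alpha> b)"
      unfolding gb by (simp add: algebra_simps)
    also have "\<dots> = 0" unfolding W by simp
    finally have N: "(- (p * a * M \<alpha> b)) * f b - g b * (- a * M (a + 1) b) = 0" .
    show ?thesis using D unfolding N by simp
  qed
  have const: "g c / f c = g b / f b" if "c \<ge> b" for c
  proof (cases "c = b")
    case False
    then have "b < c" using that by simp
    then show ?thesis
      using DERIV_isconst_end[of b c "\<lambda>b. g b / f b"] dq b by (meson DERIV_isCont continuous_at_imp_continuous_on atLeastAtMost_iff less_le_trans order_less_trans)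
  qed simp
  have "((\<lambda>b. g b / f b) \<longlongrightarrow> 1) at_top"
  \<comment> \<open>Both kernels lie between powers of b + 1 and of b - 1, which squeezes the
    quotient between powers of (b - 1) / (b + 1) and of its inverse.\<close>
  proof (rule real_tendsto_sandwich)
    define N where "N = real n / 2"
    have N: "N - a = \<kappa>" "\<kappa> + - (\<alpha> + 1) = - N" by (simp_all add: N_def a_def \<alpha>_def)
    have quot: "(x / y) powr N * (c * x powr (- a)) = c * (x powr (N - a) * y powr (- N))" if "x > 0" "y > 0" for x y c :: real
    proof -
      have "x powr (N - a) = x powr N * x powr (- a)" by (simp flip: powr_add)
      moreover have "(x / y) powr N = x powr N * y powr (- N)" using that by (simp add: powr_divide powr_minus_divide)
      ultimately show ?thesis by (simp add: mult_ac)
    qed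
    have 1: "((\<lambda>b::real. (b - 1) / (b + 1)) \<longlongrightarrow> 1) at_top" "((\<lambda>b::real. (b + 1) / (b - 1)) \<longlongrightarrow> 1) at_top" by real_asymp+
    show "((\<lambda>b::real. ((b - 1) / (b + 1)) powr (real n / 2)) \<longlongrightarrow> 1) at_top"
         "((\<lambda>b::real. ((b + 1) / (b - 1)) powr (real n / 2)) \<longlongrightarrow> 1) at_top"
      using tendsto_powr[OF 1(1) tendsto_const, of "real n / 2"] tendsto_powr[OF 1(2) tendsto_const, of "real n / 2"] by simp_all
    have pw: "(b\<^sup>2 - 1) powr \<kappa> = (b - 1) powr \<kappa> * (b + 1) powr \<kappa>" if "b > 1" for b :: real
    proof -
      have "b\<^sup>2 - 1 = (b - 1) * (b + 1)" by (simp add: power2_eq_square algebra_simps)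
      then show ?thesis using that by (simp add: powr_mult)
    qed
    show "\<forall>\<^sub>F b in at_top. ((b - 1) / (b + 1)) powr (real n / 2) \<le> g b / f b"
      using eventually_gt_at_top[of 1]
    proof eventually_elim
      case (elim b)
      have "((b - 1) / (b + 1)) powr (real n / 2) * f b \<le> ((b - 1) / (b + 1)) powr (real n / 2) * (\<omega> * (b - 1) powr (- a))"
        unfolding f_def M_def using elim a0 by (intro mult_left_mono singular_integral_one_bounds) auto
      also have "\<dots> = \<omega> * ((b - 1) powr (real n / 2 - a) * (b + 1) powr (- (real n / 2)))"
        using quot[of "b - 1" "b + 1" \<omega>] elim by (simp add: N_def)
      also have "\<dots> = \<omega> * ((b - 1) powr \<kappa> * ((b + 1) powr \<kappa> * (b + 1) powr (- (\<alpha> + 1))))"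
        using N by (simp add: N_def flip: powr_add)
      also have "\<dots> = (b\<^sup>2 - 1) powr \<kappa> * (\<omega> * (b + 1) powr (- (\<alpha> + 1)))" using pw[OF elim] by (simp add: mult_ac)
      also have "\<dots> \<le> g b"
        unfolding g_def scaled_singular_def a\<alpha> using elim a0 by (intro mult_left_mono singular_integral_one_bounds) auto
      finally show ?case using fpos[OF elim] by (simp add: pos_le_divide_eq)
    qed
    show "\<forall>\<^sub>F b in at_top. g b / f b \<le> ((b + 1) / (b - 1)) powr (real n / 2)"
      using eventually_gt_at_top[of 1]
    proof eventually_elim
      case (elim b)
      have "g b \<le> (b\<^sup>2 - 1) powr \<kappa> * (\<omega> * (b - 1) powr (- (\<alpha> + 1)))"
        unfolding g_def scaled_singular_def a\<alpha> using elim a0 by (intro mult_left_mono singular_integral_one_bounds) auto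
      also have "\<dots> = \<omega> * ((b + 1) powr \<kappa> * ((b - 1) powr \<kappa> * (b - 1) powr (- (\<alpha> + 1))))" using pw[OF elim] by (simp add: mult_ac)
      also have "\<dots> = \<omega> * ((b + 1) powr (real n / 2 - a) * (b - 1) powr (- (real n / 2)))"
        using N by (simp add: N_def flip: powr_add)
      also have "\<dots> = ((b + 1) / (b - 1)) powr (real n / 2) * (\<omega> * (b + 1) powr (- a))"
        using quot[of "b + 1" "b - 1" \<omega>, symmetric] elim by (simp add: N_def)
      also have "\<dots> \<le> ((b + 1) / (b - 1)) powr (real n / 2) * f b"
        unfolding f_def M_def using elim a0 by (intro mult_left_mono singular_integral_one_bounds) auto
      finally show ?case using fpos[OF elim] by (simp add: pos_divide_le_eq)
    qed
  qed
  moreover have "((\<lambda>b. g b / f b) \<longlongrightarrow> g b / f b) at_top"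
    by (rule tendsto_eventually) (rule eventually_mono[OF eventually_ge_at_top[of b]], rule const)
  ultimately have "g b / f b = 1" by (intro tendsto_unique[OF trivial_limit_at_top_linorder, of "\<lambda>b. g b / f b"])
  then show ?thesis using fpos[OF b] by (simp add: g_def f_def M_def a_def)
qed

end


section \<open>The operator \<open>P\<^sub>\<sigma>\<close> as a Riesz potential\<close>

context sphere_dim
begin

lemma zonal_coeff_one: "zonal_coeff k (\<lambda>x. 1) = (if k = 0 then 1 else 0)"
  using zonal_coeff_orthogonal[OF one_in_harmonics, of k] \<omega>_pos by (auto simp: zonal_coeff_def)

lemma summable_zonal_coeff_one: "summable (\<lambda>k. \<bar>zonal_coeff k (\<lambda>x. 1)\<bar>)"
proof -
  have "(\<lambda>k. \<bar>zonal_coeff k (\<lambda>x. 1)\<bar>) = (\<lambda>k. if k = 0 then 1 else 0)" by (rule ext) (simp add: zonal_coeff_one)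
  then show ?thesis using sums_single[of 0 "\<lambda>_. 1::real"] by (simp add: sums_iff)
qed

text \<open>As 2 - 2 (x \<bullet> e) = |x - e|^2 on the sphere, the kernel is |x - e|^(-2
  a).\<close>

definition riesz_potential :: "real \<Rightarrow> (real^'m \<Rightarrow> real) \<Rightarrow> real" where
  "riesz_potential a w = (\<integral>x. (2 - 2 * (x \<bullet> e)) powr (- a) * w x \<partial>sphere_measure)"

text \<open>The expansion of the constant function consists of the term k = 0, which evaluates the
  potential in closed form.\<close>

lemma riesz_potential_one:
  assumes "0 < a" "a < real n / 2"
  shows "Beta a ((real n + 1) / 2 - a) * riesz_potential a (\<lambda>_. 1) = \<omega> * Beta a (real n - 2 * a)"
proof -
  have S: "(\<lambda>k. zonal_coeff k (\<lambda>x. 1) * Beta (real k + a) (real n - 2 * a)) sums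
       (Beta a ((real n + 1) / 2 - a) * riesz_potential a (\<lambda>_. 1) / \<omega>)"
    unfolding riesz_potential_def by (rule riesz_potential_expansion) (use assms in \<open>auto simp: summable_zonal_coeff_one\<close>)
  have eq: "(\<lambda>k. zonal_coeff k (\<lambda>x. 1) * Beta (real k + a) (real n - 2 * a)) = (\<lambda>k. if k = 0 then Beta (real k + a) (real n - 2 * a) else 0)"
    by (rule ext) (simp add: zonal_coeff_one)
  have "Beta a ((real n + 1) / 2 - a) * riesz_potential a (\<lambda>_. 1) / \<omega> = Beta (real 0 + a) (real n - 2 * a)"
    by (rule sums_unique2[OF S]) (unfold eq, rule sums_single)
  then show ?thesis using \<omega>_pos by (simp add: field_simps)
qed

text \<open>For a < n / 2 the limit kernel is integrable and dominates the kernels with b > 1, so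
  dominated convergence applies. The factor 2^a is due to 2 - 2 t = 2 (1 - t).\<close>

lemma singular_integral_tendsto:
  assumes a: "0 < a" "a < real n / 2" and w: "continuous_on (sphere 0 1) w"
  shows "(singular_integral a w \<longlongrightarrow> 2 powr a * riesz_potential a w) (at_right 1)"
proof -
  let ?S = "sphere_measure :: (real^'m) measure"
  have eq: "(2 - 2 * (x \<bullet> e)) powr (- a) = 2 powr (- a) * (1 - x \<bullet> e) powr (- a)" if "norm x = 1" for x
  proof -
    have "2 - 2 * (x \<bullet> e) = 2 * (1 - x \<bullet> e)" by simp
    then show ?thesis using inner_bounds[OF that] by (simp only: powr_mult)
  qed
  have eq': "2 powr a * ((2 - 2 * (x \<bullet> e)) powr (- a) * c) = (1 - x \<bullet> e) powr (- a) * c" if "norm x = 1" for x c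
  proof -
    have "2 powr a * (2 powr (- a) * (1 - x \<bullet> e) powr (- a) * c) = (2 powr a * 2 powr (- a)) * ((1 - x \<bullet> e) powr (- a) * c)"
      by (simp only: mult_ac)
    also have "2 powr a * 2 powr (- a) = (1::real)" by (simp add: powr_minus)
    finally show ?thesis unfolding eq[OF that] by simp
  qed
  have "2 powr a * riesz_potential a w = (\<integral>x. 2 powr a * ((2 - 2 * (x \<bullet> e)) powr (- a) * w x) \<partial>?S)"
    by (simp add: riesz_potential_def)
  also have "\<dots> = (\<integral>x. (1 - x \<bullet> e) powr (- a) * w x \<partial>?S)"
    by (intro Bochner_Integration.integral_cong refl eq') simp
  finally have L: "2 powr a * riesz_potential a w = (\<integral>x. (1 - x \<bullet> e) powr (- a) * w x \<partial>?S)" .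
  have "integrable ?S (\<lambda>x. 2 powr a * ((2 - 2 * (x \<bullet> e)) powr (- a) * 1))"
    by (intro integrable_mult_right riesz_potential_expansion a) (auto simp: summable_zonal_coeff_one)
  moreover have "integrable ?S (\<lambda>x. 2 powr a * ((2 - 2 * (x \<bullet> e)) powr (- a) * 1)) = integrable ?S (\<lambda>x. (1 - x \<bullet> e) powr (- a) * 1)"
    by (intro Bochner_Integration.integrable_cong refl eq') simp
  ultimately have i1: "integrable ?S (\<lambda>x. (1 - x \<bullet> e) powr (- a))" by simp
  have "bounded (w ` sphere 0 1)" using w by (intro compact_imp_bounded compact_continuous_image) auto
  then obtain B where B: "\<And>x. x \<in> sphere 0 1 \<Longrightarrow> \<bar>w x\<bar> \<le> B"
    unfolding bounded_iff real_norm_def by blast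
  have [measurable]: "(\<lambda>x. x \<bullet> e) \<in> borel_measurable ?S" "w \<in> borel_measurable ?S"
    by (intro borel_measurable_inner borel_measurable_sphere_id borel_measurable_const)
       (rule borel_measurable_sphere_measure_continuous[OF w])
  show ?thesis
  proof (rule tendsto_at_right_sequentially[where b=2])
    fix X :: "nat \<Rightarrow> real" assume X: "\<And>k. 1 < X k" "X \<longlonglongrightarrow> 1"
    show "(\<lambda>k. singular_integral a w (X k)) \<longlonglongrightarrow> 2 powr a * riesz_potential a w"
      unfolding L singular_integral_def
    proof (rule integral_dominated_convergence[where w="\<lambda>x. B * (1 - x \<bullet> e) powr (- a)"])
      show "integrable ?S (\<lambda>x. B * (1 - x \<bullet> e) powr (- a))" by (rule integrable_mult_right[OF i1])
      show "AE x in ?S. (\<lambda>k. (X k - x \<bullet> e) powr (- a) * w x) \<longlonglongrightarrow> (1 - x \<bullet> e) powr (- a) * w x"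
        using AE_inner_less_1 by eventually_elim (auto intro!: tendsto_intros X)
      show "AE x in ?S. norm ((X k - x \<bullet> e) powr (- a) * w x) \<le> B * (1 - x \<bullet> e) powr (- a)" for k
        using AE_inner_less_1 AE_space
      proof eventually_elim
        case (elim x)
        have "(X k - x \<bullet> e) powr (- a) \<le> (1 - x \<bullet> e) powr (- a)"
          using elim X(1)[of k] a by (intro powr_mono2') auto
        then have "(X k - x \<bullet> e) powr (- a) * \<bar>w x\<bar> \<le> (1 - x \<bullet> e) powr (- a) * B"
          using B[of x] elim by (intro mult_mono) auto
        then show ?case by (simp add: abs_mult mult.commute)
      qed
    qed measurable
  qed simp
qed

text \<open>The exponent n / 2 + \<kappa> is too large for dominated convergence. Instead the kernel
  concentrates at the pole, and its mass is read off from the equal integral with exponent n / 2 -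
  \<kappa>, which does converge.\<close>

lemma scaled_singular_tendsto:
  assumes \<kappa>: "0 < \<kappa>" "\<kappa> < 1" and w: "continuous_on (sphere 0 1) w"
  shows "(scaled_singular \<kappa> w \<longlongrightarrow> 2 powr (real n / 2 - \<kappa>) * riesz_potential (real n / 2 - \<kappa>) (\<lambda>_. 1) * w e) (at_right 1)"
proof -
  define K where "K b t = (b\<^sup>2 - 1) powr \<kappa> * (b - t) powr (- (real n / 2 + \<kappa>))" for b t :: real
  define A where "A = 2 powr (real n / 2 - \<kappa>) * riesz_potential (real n / 2 - \<kappa>) (\<lambda>_. 1)"
  have ev: "\<forall>\<^sub>F b::real in at_right 1. 1 < b" by (simp add: eventually_at_right_less)
  have Kw: "(\<integral>x. K b (x \<bullet> e) * w x \<partial>sphere_measure) = scaled_singular \<kappa> w b" for b w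
    by (simp add: K_def scaled_singular_def singular_integral_def mult.assoc)
  have "((\<lambda>b. \<integral>x. K b (x \<bullet> e) * w x \<partial>sphere_measure) \<longlongrightarrow> A * w e) (at_right 1)"
  proof (rule sphere_approximate_identity[OF _ _ _ _ w])
    show "\<forall>\<^sub>F b in at_right 1. continuous_on {-1..1} (K b)"
      using ev unfolding K_def by eventually_elim (auto intro!: continuous_intros)
    show "\<forall>\<^sub>F b in at_right 1. \<forall>t\<in>{-1..1}. 0 \<le> K b t" by (simp add: K_def)
    have "(singular_integral (real n / 2 - \<kappa>) (\<lambda>_. 1) \<longlongrightarrow> A) (at_right 1)"
      unfolding A_def by (rule singular_integral_tendsto) (use n2 \<kappa> in auto)
    moreover have "\<forall>\<^sub>F b in at_right 1. singular_integral (real n / 2 - \<kappa>) (\<lambda>_. 1) b = (\<integral>x. K b (x \<bullet> e) \<partial>sphere_measure)"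
      using ev by eventually_elim (use Kw[of _ "\<lambda>_. 1"] scaled_singular_one[OF _ \<kappa>] in simp)
    ultimately show "((\<lambda>b. \<integral>x. K b (x \<bullet> e) \<partial>sphere_measure) \<longlongrightarrow> A) (at_right 1)"
      by (rule Lim_transform_eventually)
    fix \<delta> \<eta> :: real assume \<delta>: "\<delta> > 0" and \<eta>: "\<eta> > 0"
    have "((\<lambda>b::real. (b\<^sup>2 - 1) powr \<kappa> * \<delta> powr (- (real n / 2 + \<kappa>))) \<longlongrightarrow> (1\<^sup>2 - 1) powr \<kappa> * \<delta> powr (- (real n / 2 + \<kappa>))) (at_right 1)"
      using ev \<kappa> by (intro tendsto_intros) (auto elim!: eventually_mono simp: one_le_power)
    then have "\<forall>\<^sub>F b in at_right 1. (b\<^sup>2 - 1) powr \<kappa> * \<delta> powr (- (real n / 2 + \<kappa>)) < \<eta>"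
      using \<eta> by (intro order_tendstoD(2)) auto
    with ev show "\<forall>\<^sub>F b in at_right 1. \<forall>t\<in>{-1..1-\<delta>}. K b t \<le> \<eta>"
    proof eventually_elim
      case (elim b)
      show ?case
      proof
        fix t assume t: "t \<in> {-1..1-\<delta>}"
        have "(b - t) powr (- (real n / 2 + \<kappa>)) \<le> \<delta> powr (- (real n / 2 + \<kappa>))"
          using \<delta> t elim \<kappa> by (intro powr_mono2') auto
        then have "K b t \<le> (b\<^sup>2 - 1) powr \<kappa> * \<delta> powr (- (real n / 2 + \<kappa>))"
          unfolding K_def by (intro mult_left_mono) auto
        with elim show "K b t \<le> \<eta>" by simp
      qed
    qed
  qed
  then show ?thesis unfolding Kw A_def .
qed

definition conf_laplacian :: "real \<Rightarrow> (real^'m \<Rightarrow> real) \<Rightarrow> real^'m \<Rightarrow> real" where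
  "conf_laplacian \<alpha> F x = \<alpha> * (real n - 1 - \<alpha>) * F x - sphere_laplacian F x"

text \<open>To be read with x = k + \<alpha> and y = 2 - 2 \<sigma>: then x + 1 = k + n / 2 +
  \<sigma> and x + y - 1 = k + n / 2 - \<sigma>. The right side is \<Gamma>(y) times the eigenvalue
  of \<open>P\<^sub>\<sigma>\<close>, and the factors in front of \<open>Beta\<close> form the
  eigenvalue of \<open>conf_laplacian\<close>.\<close>

lemma Gamma_ratio_Beta:
  fixes x y :: real
  assumes "x > 0" "y > 0" "x + y > 1"
  shows "x * (x + y - 1) * Beta x y = Gamma y * (Gamma (x + 1) / Gamma (x + y - 1))"
proof -
  define z where "z = x + y - 1"
  have z: "z > 0" using assms by (simp add: z_def)
  have 1: "Gamma (x + 1) = x * Gamma x" using assms by (intro Gamma_plus1) (auto elim!: nonpos_Ints_cases)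
  have "Gamma (z + 1) = z * Gamma z" using z by (intro Gamma_plus1) (auto elim!: nonpos_Ints_cases)
  then have 2: "Gamma (x + y) = z * Gamma z" by (simp add: z_def)
  have "Gamma z > 0" using z by (rule Gamma_real_pos)
  then show ?thesis unfolding Beta_def 1 2 z_def[symmetric] using z by (simp add: field_simps)
qed

text \<open>\<open>P\<^sub>\<sigma>\<close> is the composition of the second order operator \<open>conf_laplacian\<close>, whose eigenvalues are
  \<open>(k + \<alpha>) (k + n - 1 - \<alpha>)\<close> with \<open>\<alpha> = n/2 + \<sigma> - 1\<close>, and a Riesz potential.\<close>

lemma P_op_eq_riesz_potential:
  assumes \<sigma>: "0 < \<sigma>" "\<sigma> < 1" and S: "open S" "sphere 0 1 \<subseteq> S" and F: "\<forall>k. Ck_on k S F"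
    and w: "\<And>x. x \<in> sphere 0 1 \<Longrightarrow> w x = F x" and \<alpha>: "\<alpha> = real n / 2 + \<sigma> - 1"
  shows "P_op n \<sigma> w e * (\<omega> * Gamma (2 - 2 * \<sigma>)) = Beta \<alpha> (3 / 2 - \<sigma>) * riesz_potential \<alpha> (conf_laplacian \<alpha> F)"
proof -
  have \<alpha>0: "\<alpha> > 0" "\<alpha> < real n / 2" using \<sigma> n2 by (auto simp: \<alpha>)
  have cF: "continuous_on (sphere 0 1) F" "continuous_on (sphere 0 1) (sphere_laplacian F)"
    using spec[OF F, of 0] Ck_on_sphere_laplacian[OF S(1) spec[OF F, of "Suc (Suc 0)"]] S(2)
    by (auto intro: continuous_on_subset)
  have cw: "continuous_on (sphere 0 1) w" using cF(1) w continuous_on_cong[of "sphere 0 1" "sphere 0 1" w F] by simp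
  have SG: "\<forall>k. Ck_on k S (conf_laplacian \<alpha> F)"
    unfolding conf_laplacian_def[abs_def] using F S(1) by (intro allI Ck_on_diff Ck_on_cmult Ck_on_sphere_laplacian) blast+
  have cG: "continuous_on (sphere 0 1) (conf_laplacian \<alpha> F)"
    using spec[OF SG, of 0] S(2) by (auto intro: continuous_on_subset)
  have sG: "summable (\<lambda>k. \<bar>zonal_coeff k (conf_laplacian \<alpha> F)\<bar>)"
    using zonal_coeff_summable[OF S SG, of 0] by simp
  have zG: "zonal_coeff k (conf_laplacian \<alpha> F) = (real k + \<alpha>) * (real k + real n - 1 - \<alpha>) * zonal_coeff k F" for k
    unfolding conf_laplacian_def[abs_def] zonal_coeff_diff[OF continuous_on_mult_left[OF cF(1)] cF(2)]
      zonal_coeff_cmult zonal_coeff_sphere_laplacian[OF S spec[OF F]]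
    by (simp add: algebra_simps)
  \<comment> \<open>The extension F agrees with w on the sphere, and the coefficients see nothing
    else.\<close>
  have hw: "harmonic_component k w e = zonal_coeff k F" for k
  proof -
    have "zonal_coeff k w = zonal_coeff k F"
      unfolding zonal_coeff_def using w by (intro arg_cong2[where f="(/)"] Bochner_Integration.integral_cong) auto
    then show ?thesis using harmonic_component_eq[OF cw] by simp
  qed
  have Bt: "zonal_coeff k (conf_laplacian \<alpha> F) * Beta (real k + \<alpha>) (real n - 2 * \<alpha>)
     = Gamma (2 - 2 * \<sigma>) * (Gamma (real k + real n / 2 + \<sigma>) / Gamma (real k + real n / 2 - \<sigma>) * harmonic_component k w e)" for k
  proof -
    have "(real k + \<alpha>) * (real k + real n - 1 - \<alpha>) * Beta (real k + \<alpha>) (real n - 2 * \<alpha>)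
       = Gamma (real n - 2 * \<alpha>) * (Gamma (real k + \<alpha> + 1) / Gamma (real k + \<alpha> + (real n - 2 * \<alpha>) - 1))"
    proof -
      have "real k + \<alpha> + (real n - 2 * \<alpha>) > 1" using \<sigma> n2 by (simp add: \<alpha> field_simps)
      from Gamma_ratio_Beta[OF _ _ this] \<alpha>0
      have A: "(real k + \<alpha>) * (real k + \<alpha> + (real n - 2 * \<alpha>) - 1) * Beta (real k + \<alpha>) (real n - 2 * \<alpha>)
       = Gamma (real n - 2 * \<alpha>) * (Gamma (real k + \<alpha> + 1) / Gamma (real k + \<alpha> + (real n - 2 * \<alpha>) - 1))" by simp
      have E: "real k + real n - 1 - \<alpha> = real k + \<alpha> + (real n - 2 * \<alpha>) - 1" by simp
      show ?thesis unfolding E by (rule A)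
    qed
    also have "real k + \<alpha> + 1 = real k + real n / 2 + \<sigma>" by (simp add: \<alpha>)
    also have "real k + \<alpha> + (real n - 2 * \<alpha>) - 1 = real k + real n / 2 - \<sigma>" by (simp add: \<alpha> field_simps)
    also have nn: "real n - 2 * \<alpha> = 2 - 2 * \<sigma>" by (simp add: \<alpha> field_simps)
    finally have "(real k + \<alpha>) * (real k + real n - 1 - \<alpha>) * Beta (real k + \<alpha>) (2 - 2 * \<sigma>) * zonal_coeff k F
       = Gamma (2 - 2 * \<sigma>) * (Gamma (real k + real n / 2 + \<sigma>) / Gamma (real k + real n / 2 - \<sigma>)) * zonal_coeff k F"
      by (rule arg_cong[where f = "\<lambda>z. z * zonal_coeff k F"])
    then show ?thesis unfolding zG hw nn by (simp only: mult_ac)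
  qed
  have G0: "Gamma (2 - 2 * \<sigma>) > 0" using \<sigma> by (intro Gamma_real_pos) auto
  have "(\<lambda>k. Gamma (2 - 2 * \<sigma>) * (Gamma (real k + real n / 2 + \<sigma>) / Gamma (real k + real n / 2 - \<sigma>) * harmonic_component k w e)) sums
     (Beta \<alpha> ((real n + 1) / 2 - \<alpha>) * riesz_potential \<alpha> (conf_laplacian \<alpha> F) / \<omega>)"
    unfolding Bt[symmetric] riesz_potential_def by (rule riesz_potential_expansion[OF cG sG \<alpha>0])
  from sums_divide[OF this, of "Gamma (2 - 2 * \<sigma>)"] G0
  have "(\<lambda>k. Gamma (real k + real n / 2 + \<sigma>) / Gamma (real k + real n / 2 - \<sigma>) * harmonic_component k w e) sums
     (Beta \<alpha> ((real n + 1) / 2 - \<alpha>) * riesz_potential \<alpha> (conf_laplacian \<alpha> F) / \<omega> / Gamma (2 - 2 * \<sigma>))" by simp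
  then have "P_op n \<sigma> w e = Beta \<alpha> ((real n + 1) / 2 - \<alpha>) * riesz_potential \<alpha> (conf_laplacian \<alpha> F) / \<omega> / Gamma (2 - 2 * \<sigma>)"
    unfolding P_op_def by (rule sums_unique[symmetric])
  moreover have "(real n + 1) / 2 - \<alpha> = 3 / 2 - \<sigma>" unfolding \<alpha> by (simp add: add_divide_distrib)
  ultimately have "P_op n \<sigma> w e = Beta \<alpha> (3 / 2 - \<sigma>) * riesz_potential \<alpha> (conf_laplacian \<alpha> F) / \<omega> / Gamma (2 - 2 * \<sigma>)"
    by (simp only:)
  then show ?thesis using \<omega>_pos G0 by (simp only:) simp
qed

end

lemma Gamma_duplication_real:
  fixes x :: real
  assumes "x > 0"
  shows "Gamma x * Gamma (x + 1 / 2) = 2 powr (1 - 2 * x) * sqrt pi * Gamma (2 * x)"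
proof -
  have nn: "complex_of_real y \<notin> \<int>\<^sub>\<le>\<^sub>0" if "y > 0" for y using that by (auto elim!: nonpos_Ints_cases simp: complex_eq_iff)
  have "complex_of_real (Gamma x * Gamma (x + 1 / 2)) = Gamma (of_real x) * Gamma (of_real x + 1 / 2)"
  proof -
    have "complex_of_real x + 1 / 2 = of_real (x + 1 / 2)" by simp
    then show ?thesis by (simp only: Gamma_complex_of_real of_real_mult)
  qed
  also have "\<dots> = exp ((1 - 2 * of_real x) * of_real (ln 2)) * of_real (sqrt pi) * Gamma (2 * of_real x)"
    by (rule Gamma_legendre_duplication) (use nn[of x] nn[of "x + 1/2"] assms in auto)
  also have "\<dots> = of_real (2 powr (1 - 2 * x) * sqrt pi * Gamma (2 * x))"
    by (simp add: powr_def Gamma_complex_of_real[of "2 * x", simplified] exp_of_real[symmetric])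
  finally show ?thesis by (simp only: of_real_eq_iff)
qed


section \<open>The constant \<open>\<beta>\<close>\<close>

text \<open>Represents c^(-p) as a superposition of exponentials in c, which factorise over the
  coordinates when c is a sum of squares.\<close>

lemma nn_integral_Gamma_scaled:
  assumes p: "p > 0" and c: "c > (0::real)"
  shows "(\<integral>\<^sup>+z. ennreal (indicator {0<..} z * (z powr (p - 1) * exp (- c * z))) \<partial>lborel) = ennreal (Gamma p * c powr (- p))"
proof -
  define f where "f z = indicator {0<..} z * (z powr (p - 1) * exp (- z))" for z :: real
  have "f z = indicator {0..} z * (z powr (p - 1) / exp z)" for z
    by (auto simp: f_def indicator_def exp_minus divide_inverse)
  then have "(\<integral>\<^sup>+z. ennreal (f z) \<partial>lborel) = ennreal (Gamma p)"
    using nn_integral_has_integral_lebesgue[OF _ Gamma_integral_real[OF p]] by simp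
  moreover have "(\<integral>\<^sup>+z. ennreal (f z) \<partial>lborel) = ennreal \<bar>c\<bar> * (\<integral>\<^sup>+z. ennreal (f (0 + c * z)) \<partial>lborel)"
    by (rule nn_integral_real_affine) (use c in \<open>auto simp: f_def\<close>)
  moreover have "ennreal (f (0 + c * z)) = ennreal (c powr (p - 1)) * ennreal (indicator {0<..} z * (z powr (p - 1) * exp (- c * z)))" for z
    using c by (cases "z > 0") (auto simp: f_def powr_mult mult_ac zero_less_mult_iff indicator_def simp flip: ennreal_mult')
  ultimately have "ennreal (Gamma p) = ennreal c * (ennreal (c powr (p - 1)) * (\<integral>\<^sup>+z. ennreal (indicator {0<..} z * (z powr (p - 1) * exp (- c * z))) \<partial>lborel))"
    using c by (simp add: nn_integral_cmult)
  then have 1: "ennreal (Gamma p) = ennreal (c powr p) * (\<integral>\<^sup>+z. ennreal (indicator {0<..} z * (z powr (p - 1) * exp (- c * z))) \<partial>lborel)"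
    using c by (simp add: mult.assoc[symmetric] powr_diff flip: ennreal_mult')
  have "ennreal (Gamma p * c powr (- p)) = ennreal (c powr (- p)) * ennreal (Gamma p)"
    using Gamma_real_pos[OF p] by (simp add: mult.commute ennreal_mult')
  also have "\<dots> = (ennreal (c powr (- p)) * ennreal (c powr p)) * (\<integral>\<^sup>+z. ennreal (indicator {0<..} z * (z powr (p - 1) * exp (- c * z))) \<partial>lborel)"
    unfolding 1 by (simp add: mult.assoc)
  also have "ennreal (c powr (- p)) * ennreal (c powr p) = 1"
    using c by (simp flip: ennreal_mult' powr_add)
  finally show ?thesis by simp
qed

lemma nn_integral_gaussian:
  assumes z: "z > (0::real)"
  shows "(\<integral>\<^sup>+x. ennreal (exp (- z * x\<^sup>2)) \<partial>lborel) = ennreal (sqrt (pi / z))"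
proof -
  define s where "s = 1 / sqrt (2 * z)"
  have s: "s > 0" using z by (simp add: s_def)
  have s2: "2 * s\<^sup>2 = 1 / z" using z by (simp add: s_def power_divide)
  have "2 * pi * s\<^sup>2 = pi / z" using s2 by (simp add: algebra_simps)
  then have nd: "exp (- z * x\<^sup>2) = sqrt (pi / z) * normal_density 0 s x" for x
    using s2 z by (simp add: normal_density_def mult.commute)
  have "(\<integral>\<^sup>+x. ennreal (normal_density 0 s x) \<partial>lborel) = 1"
    by (subst nn_integral_eq_integral) (use s in \<open>auto intro: integrable_normal_density simp: integral_normal_density\<close>)
  then show ?thesis unfolding nd using z by (simp add: ennreal_mult' nn_integral_cmult)
qed

text \<open>The power of |x'|^2 + t^2 is replaced by a superposition of Gaussians, and Fubini splits
  the n-dimensional integral into one-dimensional ones. What remains is a Gamma integral of exponent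
  \<sigma> and rate t^2; its power of t cancels the numerator, so a single b serves every t.\<close>

lemma beta_const_eq:
  assumes n: "n \<ge> 1" and \<sigma>: "\<sigma> > 0"
  shows "beta_const n \<sigma> = Gamma (real n / 2 + \<sigma>) / (pi powr (real n / 2) * Gamma \<sigma>)"
proof -
  define p where "p = (real n + 2 * \<sigma>) / 2"
  have p: "p > 0" using \<sigma> by (simp add: p_def add_nonneg_pos)
  define C where "C = pi powr (real n / 2) * Gamma \<sigma> / Gamma p"
  have C: "C > 0" using \<sigma> p by (simp add: C_def Gamma_real_pos)
  define PP where "PP = (\<Pi>\<^sub>M i\<in>{..<n}. (lborel :: real measure))"
  interpret PS: product_sigma_finite "\<lambda>_. lborel :: real measure" ..
  interpret sigma_finite_measure PP unfolding PP_def by (rule PS.sigma_finite) simp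
  interpret P: pair_sigma_finite PP "lborel :: real measure" ..
  define S where "S x = (\<Sum>i<n. (x i)\<^sup>2)" for x :: "nat \<Rightarrow> real"
  have S0: "S x \<ge> 0" for x by (simp add: S_def sum_nonneg)
  have Sm[measurable]: "S \<in> borel_measurable PP" unfolding S_def PP_def by measurable
  have I: "(\<integral>x. t powr (2 * \<sigma>) / ((\<Sum>i<n. (x i)\<^sup>2) + t\<^sup>2) powr ((real n + 2 * \<sigma>) / 2) \<partial>PP) = C" if t: "t > 0" for t
  proof -
    define K where "K x = t powr (2 * \<sigma>) / (S x + t\<^sup>2) powr p" for x
    have pos: "S x + t\<^sup>2 > 0" for x using S0[of x] t by (simp add: add_nonneg_pos)
    define F where "F x z = indicator {0<..} z * (z powr (p - 1) * exp (- (S x + t\<^sup>2) * z))" for x z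
    have "ennreal (Gamma p) * (\<integral>\<^sup>+x. ennreal (K x) \<partial>PP) = (\<integral>\<^sup>+x. ennreal (t powr (2 * \<sigma>)) * (\<integral>\<^sup>+z. ennreal (F x z) \<partial>lborel) \<partial>PP)"
    proof (subst nn_integral_cmult[symmetric])
      show "(\<lambda>x. ennreal (K x)) \<in> borel_measurable PP" unfolding K_def by measurable
      show "(\<integral>\<^sup>+x. ennreal (Gamma p) * ennreal (K x) \<partial>PP) = (\<integral>\<^sup>+x. ennreal (t powr (2 * \<sigma>)) * (\<integral>\<^sup>+z. ennreal (F x z) \<partial>lborel) \<partial>PP)"
        unfolding F_def nn_integral_Gamma_scaled[OF p pos] using p
        by (intro nn_integral_cong) (simp add: K_def powr_minus divide_inverse Gamma_real_pos less_imp_le mult_ac flip: ennreal_mult')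
    qed
    also have "\<dots> = ennreal (t powr (2 * \<sigma>)) * (\<integral>\<^sup>+x. \<integral>\<^sup>+z. ennreal (F x z) \<partial>lborel \<partial>PP)"
      by (rule nn_integral_cmult) (unfold F_def nn_integral_Gamma_scaled[OF p pos], measurable)
    also have "(\<integral>\<^sup>+x. \<integral>\<^sup>+z. ennreal (F x z) \<partial>lborel \<partial>PP) = (\<integral>\<^sup>+z. \<integral>\<^sup>+x. ennreal (F x z) \<partial>PP \<partial>lborel)"
    proof (rule P.Fubini'[symmetric])
      have [measurable]: "(\<lambda>q. S (fst q)) \<in> borel_measurable (PP \<Otimes>\<^sub>M lborel)" by (rule measurable_compose[OF measurable_fst Sm])
      show "(\<lambda>(x, z). ennreal (F x z)) \<in> borel_measurable (PP \<Otimes>\<^sub>M lborel)"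
        unfolding F_def split_beta' by measurable
    qed
    also have "\<dots> = (\<integral>\<^sup>+z. ennreal (pi powr (real n / 2)) * ennreal (indicator {0<..} z * (z powr (\<sigma> - 1) * exp (- t\<^sup>2 * z))) \<partial>lborel)"
    proof (intro nn_integral_cong)
      fix z :: real
      show "(\<integral>\<^sup>+x. ennreal (F x z) \<partial>PP) = ennreal (pi powr (real n / 2)) * ennreal (indicator {0<..} z * (z powr (\<sigma> - 1) * exp (- t\<^sup>2 * z)))"
      proof (cases "z > 0")
        case True
        have "(\<integral>\<^sup>+x. ennreal (exp (- (z * S x))) \<partial>PP) = (\<integral>\<^sup>+x. (\<Prod>i<n. ennreal (exp (- z * (x i)\<^sup>2))) \<partial>PP)"
          by (intro nn_integral_cong) (simp add: S_def sum_distrib_left exp_sum prod_ennreal sum_negf[symmetric])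
        also have "\<dots> = (\<Prod>i<n. \<integral>\<^sup>+y. ennreal (exp (- z * y\<^sup>2)) \<partial>lborel)"
          unfolding PP_def by (rule PS.product_nn_integral_prod) auto
        also have "\<dots> = ennreal (sqrt (pi / z)) ^ n" using nn_integral_gaussian[OF True] by simp
        also have "\<dots> = ennreal (sqrt (pi / z) ^ n)" using True by (simp add: ennreal_power)
        also have "sqrt (pi / z) ^ n = pi powr (real n / 2) * z powr (- (real n / 2))"
        proof -
          have "sqrt (pi / z) ^ n = (pi / z) powr (real n / 2)"
            using True by (simp add: powr_half_sqrt[symmetric] powr_powr flip: powr_realpow)
          then show ?thesis using True by (simp add: powr_divide powr_minus_divide)
        qed
        finally have G: "(\<integral>\<^sup>+x. ennreal (exp (- (z * S x))) \<partial>PP) = ennreal (pi powr (real n / 2) * z powr (- (real n / 2)))" .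
        have "ennreal (F x z) = ennreal (z powr (p - 1) * exp (- t\<^sup>2 * z)) * ennreal (exp (- (z * S x)))" for x
          using True by (simp add: F_def mult_ac flip: ennreal_mult') (simp add: algebra_simps flip: exp_add)
        then have "(\<integral>\<^sup>+x. ennreal (F x z) \<partial>PP) = ennreal (z powr (p - 1) * exp (- t\<^sup>2 * z)) * ennreal (pi powr (real n / 2) * z powr (- (real n / 2)))"
          by (simp add: nn_integral_cmult G)
        also have "\<dots> = ennreal (pi powr (real n / 2)) * ennreal ((z powr (p - 1) * z powr (- (real n / 2))) * exp (- t\<^sup>2 * z))"
          by (simp add: mult_ac flip: ennreal_mult')
        also have "z powr (p - 1) * z powr (- (real n / 2)) = z powr (\<sigma> - 1)"
          by (simp add: p_def add_divide_distrib flip: powr_add)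
        finally show ?thesis using True by simp
      qed (simp add: F_def)
    qed
    also have "\<dots> = ennreal (pi powr (real n / 2)) * ennreal (Gamma \<sigma> * (t\<^sup>2) powr (- \<sigma>))"
      using nn_integral_Gamma_scaled[OF \<sigma>, of "t\<^sup>2"] t by (subst nn_integral_cmult) auto
    also have "ennreal (t powr (2 * \<sigma>)) * (ennreal (pi powr (real n / 2)) * ennreal (Gamma \<sigma> * (t\<^sup>2) powr (- \<sigma>)))
       = ennreal (pi powr (real n / 2) * Gamma \<sigma>)"
    proof -
      have "(t\<^sup>2) powr (- \<sigma>) = t powr (- (2 * \<sigma>))" using t by (simp add: powr_powr flip: powr_numeral)
      then have "t powr (2 * \<sigma>) * (pi powr (real n / 2) * (Gamma \<sigma> * (t\<^sup>2) powr (- \<sigma>))) = pi powr (real n / 2) * Gamma \<sigma>"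
        using t by (simp add: powr_minus)
      then show ?thesis using \<sigma> by (simp add: Gamma_real_pos less_imp_le flip: ennreal_mult')
    qed
    also have "ennreal (pi powr (real n / 2) * Gamma \<sigma>) = ennreal (Gamma p) * ennreal C"
    proof -
      have "Gamma p \<noteq> 0" using Gamma_real_pos[OF p] by linarith
      then have "pi powr (real n / 2) * Gamma \<sigma> = Gamma p * C" by (simp add: C_def)
      then show ?thesis using Gamma_real_pos[OF p] by (simp only: ennreal_mult' less_imp_le)
    qed
    finally have N: "(\<integral>\<^sup>+x. ennreal (K x) \<partial>PP) = ennreal C"
      using Gamma_real_pos[OF p] by (simp add: ennreal_mult_cancel_left)
    have "(\<integral>x. K x \<partial>PP) = C"
    proof -
      have "K \<in> borel_measurable PP" unfolding K_def by measurable
      moreover have "\<And>x. 0 \<le> K x" by (simp add: K_def)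
      ultimately show ?thesis using N C by (subst integral_eq_nn_integral) auto
    qed
    then show ?thesis by (simp add: K_def S_def p_def)
  qed
  have "beta_const n \<sigma> = 1 / C"
    unfolding beta_const_def
  proof (rule the_equality)
    show "\<forall>t>0. 1 / C * (\<integral>x. t powr (2 * \<sigma>) / ((\<Sum>i<n. (x i)\<^sup>2) + t\<^sup>2) powr ((real n + 2 * \<sigma>) / 2) \<partial>(\<Pi>\<^sub>M i\<in>{..<n}. (lborel :: real measure))) = 1"
      using I C by (simp add: PP_def)
    fix b assume h: "\<forall>t>0. b * (\<integral>x. t powr (2 * \<sigma>) / ((\<Sum>i<n. (x i)\<^sup>2) + t\<^sup>2) powr ((real n + 2 * \<sigma>) / 2) \<partial>(\<Pi>\<^sub>M i\<in>{..<n}. (lborel :: real measure))) = 1"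
    have "b * C = 1" using h[rule_format, OF zero_less_one] unfolding I[OF zero_less_one, unfolded PP_def] .
    then show "b = 1 / C" using C by (simp add: field_simps)
  qed
  then show ?thesis by (simp add: C_def p_def add_divide_distrib)
qed


section \<open>The divergence equation\<close>

definition power_potential :: "real \<Rightarrow> (real^'m::finite \<Rightarrow> real) \<Rightarrow> real^'m \<Rightarrow> real" where
  "power_potential p w y = (\<integral>x. ((y - x) \<bullet> (y - x)) powr (- p) * w x \<partial>sphere_measure)"

lemma sphere_ball_dist_pos:
  fixes x y :: "'a::real_inner"
  assumes "norm x = 1" "norm y < 1" shows "(y - x) \<bullet> (y - x) > 0"
  using assms by auto

lemma continuous_on_power_kernel:
  fixes y :: "real^'m::finite"
  assumes "norm y < 1" "continuous_on (sphere 0 1) w"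
  shows "continuous_on (sphere 0 1) (\<lambda>x. ((y - x) \<bullet> (y - x)) powr (- p) * w x)"
proof -
  have "(y - x) \<bullet> (y - x) \<noteq> 0" if "x \<in> sphere 0 1" for x
    using sphere_ball_dist_pos[of x y] assms that by auto
  then show ?thesis by (intro continuous_intros assms) auto
qed

text \<open>Differentiation raises the exponent by one and produces the first moments x_j w as new
  weights. The class of potentials is thus closed under differentiation, and the same rule covers
  second derivatives.\<close>

lemma has_derivative_power_potential:
  fixes w :: "real^'m::finite \<Rightarrow> real"
  assumes y: "norm y < 1" and w: "continuous_on (sphere 0 1) w"
  shows "power_potential p w differentiable (at y)"
    and "partial_deriv j (power_potential p w) y
      = - 2 * p * (y $ j * power_potential (p + 1) w y - power_potential (p + 1) (\<lambda>x. x $ j * w x) y)"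
proof -
  define g where "g y x = (- 2 * p * (((y - x) \<bullet> (y - x)) powr (- (p + 1)) * w x)) *\<^sub>R (y - x)" for y x :: "real^'m"
  have "((\<lambda>y. \<integral>x. ((y - x) \<bullet> (y - x)) powr (- p) * w x \<partial>sphere_measure) has_derivative (\<lambda>h. (\<integral>x. g y x \<partial>sphere_measure) \<bullet> h)) (at y)"
  proof (rule has_derivative_integral_sphere[where S="ball 0 1"])
    show "continuous_on (sphere 0 1) (\<lambda>x. ((y - x) \<bullet> (y - x)) powr (- p) * w x)" if "y \<in> ball 0 1" for y
      using continuous_on_power_kernel[OF _ w] that by simp
    show "continuous_on (ball 0 1 \<times> sphere 0 1) (\<lambda>(y, x). g y x)"
    proof -
      have "continuous_on (ball 0 1 \<times> sphere 0 1) (\<lambda>q::(real^'m) \<times> (real^'m). w (snd q))"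
        by (rule continuous_on_compose2[OF w]) (auto intro!: continuous_intros)
      moreover have "\<forall>q \<in> ball 0 1 \<times> sphere 0 1. (fst q - snd q) \<bullet> (fst q - snd q) \<noteq> 0"
        using sphere_ball_dist_pos by fastforce
      ultimately show ?thesis unfolding g_def split_beta' by (intro continuous_intros) auto
    qed
    fix y x :: "real^'m" assume "y \<in> ball 0 1" "x \<in> sphere 0 1"
    then have pos: "(y - x) \<bullet> (y - x) > 0" using sphere_ball_dist_pos[of x y] by auto
    have 1: "((\<lambda>y. (y - x) \<bullet> (y - x)) has_derivative (\<lambda>h. 2 * ((y - x) \<bullet> h))) (at y)"
      by (auto intro!: derivative_eq_intros simp: inner_commute)
    have 2: "((\<lambda>q. q powr (- p)) has_derivative (\<lambda>h. (- p * ((y - x) \<bullet> (y - x)) powr (- p - 1)) * h)) (at ((y - x) \<bullet> (y - x)))"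
      using has_real_derivative_powr[OF pos, of "- p"] unfolding has_field_derivative_def .
    have 3: "((\<lambda>y. ((y - x) \<bullet> (y - x)) powr (- p) * w x) has_derivative
        (\<lambda>h. (- p * ((y - x) \<bullet> (y - x)) powr (- p - 1)) * (2 * ((y - x) \<bullet> h)) * w x)) (at y)"
      by (rule has_derivative_mult_left[OF has_derivative_compose[OF 1 2]])
    have "- (p + 1) = - p - 1" by simp
    then show "((\<lambda>y. ((y - x) \<bullet> (y - x)) powr (- p) * w x) has_derivative (\<lambda>h. g y x \<bullet> h)) (at y)"
      using 3 by (simp add: g_def mult_ac)
  qed (use y in auto)
  then have D: "(power_potential p w has_derivative (\<lambda>h. (\<integral>x. g y x \<partial>sphere_measure) \<bullet> h)) (at y)"
    unfolding power_potential_def[abs_def] .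
  then show "power_potential p w differentiable (at y)" by (auto simp: differentiable_def)
  have cw: "continuous_on (sphere 0 1) (\<lambda>x. x $ j * w x)" by (intro continuous_intros w)
  have ci: "continuous_on (sphere 0 1) (\<lambda>x. ((y - x) \<bullet> (y - x)) powr (- (p + 1)) * w x)" by (rule continuous_on_power_kernel[OF y w])
  have ig: "integrable sphere_measure (g y)"
    unfolding g_def by (intro integrable_sphere_continuous continuous_intros continuous_on_scaleR continuous_on_mult_left ci)
  have "(\<integral>x. g y x \<partial>sphere_measure) $ j = (\<integral>x. g y x $ j \<partial>sphere_measure)"
    by (rule integral_bounded_linear[OF bounded_linear_vec_nth ig, symmetric])
  also have "\<dots> = (\<integral>x. - 2 * p * (y $ j * (((y - x) \<bullet> (y - x)) powr (- (p + 1)) * w x)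
      - ((y - x) \<bullet> (y - x)) powr (- (p + 1)) * (x $ j * w x)) \<partial>sphere_measure)"
    by (intro Bochner_Integration.integral_cong refl) (simp add: g_def algebra_simps)
  also have "\<dots> = - 2 * p * (y $ j * power_potential (p + 1) w y - power_potential (p + 1) (\<lambda>x. x $ j * w x) y)"
  proof -
    have i1: "integrable sphere_measure (\<lambda>x. y $ j * (((y - x) \<bullet> (y - x)) powr (- (p + 1)) * w x))"
      and i2: "integrable sphere_measure (\<lambda>x. ((y - x) \<bullet> (y - x)) powr (- (p + 1)) * (x $ j * w x))"
      by (intro integrable_mult_right integrable_sphere_continuous continuous_on_power_kernel y w cw)+
    show ?thesis unfolding power_potential_def integral_mult_right_zero Bochner_Integration.integral_diff[OF i1 i2] ..
  qed
  finally show "partial_deriv j (power_potential p w) y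
      = - 2 * p * (y $ j * power_potential (p + 1) w y - power_potential (p + 1) (\<lambda>x. x $ j * w x) y)"
    using partial_deriv_eqI[OF D, of j] by (simp add: inner_axis)
qed

text \<open>On |x| = 1 one has 2 y \<bullet> (y - x) = |y - x|^2 - (1 - |y|^2), and the squared
  coordinates of y - x sum to |y - x|^2; each factor |y - x|^2 lowers the exponent by one. These are
  the contractions left over by a divergence of potentials.\<close>

lemma power_potential_moments:
  fixes w :: "real^'m::finite \<Rightarrow> real"
  assumes y: "norm y < 1" and w: "continuous_on (sphere 0 1) w"
  shows "(\<Sum>i\<in>UNIV. y $ i * (y $ i * power_potential (p + 1) w y - power_potential (p + 1) (\<lambda>x. x $ i * w x) y))
      = (power_potential p w y - (1 - (norm y)\<^sup>2) * power_potential (p + 1) w y) / 2" (is ?A)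
    and "(\<Sum>i\<in>UNIV. y $ i * (y $ i * power_potential (p + 1) w y - power_potential (p + 1) (\<lambda>x. x $ i * w x) y)
        - (y $ i * power_potential (p + 1) (\<lambda>x. x $ i * w x) y - power_potential (p + 1) (\<lambda>x. x $ i * (x $ i * w x)) y))
      = power_potential p w y" (is ?B)
proof -
  define k where "k p x = ((y - x) \<bullet> (y - x)) powr (- p)" for p x
  have I: "integrable sphere_measure (\<lambda>x. k p x * v x)" if "continuous_on (sphere 0 1) v" for v p
    unfolding k_def by (intro integrable_sphere_continuous continuous_on_power_kernel y that)
  have c: "continuous_on (sphere 0 1) (\<lambda>x. x $ i * w x)" "continuous_on (sphere 0 1) (\<lambda>x. x $ i * (x $ i * w x))" for i
    by (intro continuous_intros w)+
  note Iw = I[OF w] I[OF c(1)] I[OF c(2)]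
  have kk: "((y - x) \<bullet> (y - x)) * k (p + 1) x = k p x" if "norm x = 1" for x
  proof -
    have pos: "(y - x) \<bullet> (y - x) > 0" using sphere_ball_dist_pos[of x y] y that by auto
    have "- p = 1 + - (p + 1)" by simp
    then have "k p x = ((y - x) \<bullet> (y - x)) powr 1 * k (p + 1) x" unfolding k_def by (metis powr_add)
    then show ?thesis using pos by simp
  qed
  have yy: "(y - x) \<bullet> (y - x) = y \<bullet> y - 2 * (x \<bullet> y) + 1" if "norm x = 1" for x
  proof -
    have "x \<bullet> x = 1" using that by (simp add: dot_square_norm)
    then show ?thesis by (simp add: inner_diff_left inner_diff_right inner_commute)
  qed
  have "(\<Sum>i\<in>UNIV. y $ i * (y $ i * power_potential (p + 1) w y - power_potential (p + 1) (\<lambda>x. x $ i * w x) y))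
     = (\<integral>x. (\<Sum>i\<in>UNIV. y $ i * (y $ i * (k (p + 1) x * w x) - k (p + 1) x * (x $ i * w x))) \<partial>sphere_measure)"
    unfolding power_potential_def k_def[symmetric] by (simp add: Bochner_Integration.integral_sum Iw)
  also have "\<dots> = (\<integral>x. (k p x * w x - (1 - (norm y)\<^sup>2) * (k (p + 1) x * w x)) / 2 \<partial>sphere_measure)"
  proof (intro Bochner_Integration.integral_cong refl)
    fix x assume "x \<in> space (sphere_measure :: (real^'m) measure)"
    then have x: "norm x = 1" by simp
    have "(\<Sum>i\<in>UNIV. y $ i * (y $ i * (k (p + 1) x * w x) - k (p + 1) x * (x $ i * w x)))
      = (\<Sum>i\<in>UNIV. y $ i * y $ i - x $ i * y $ i) * (k (p + 1) x * w x)"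
      unfolding sum_distrib_right by (intro sum.cong refl) (simp add: algebra_simps)
    also have "(\<Sum>i\<in>UNIV. y $ i * y $ i - x $ i * y $ i) = y \<bullet> y - x \<bullet> y"
      by (simp add: inner_vec_def sum_subtractf)
    also have "\<dots> = ((y - x) \<bullet> (y - x) - (1 - (norm y)\<^sup>2)) / 2"
      using yy[OF x] by (simp add: power2_norm_eq_inner)
    also have "\<dots> * (k (p + 1) x * w x) = (((y - x) \<bullet> (y - x) * k (p + 1) x) * w x - (1 - (norm y)\<^sup>2) * (k (p + 1) x * w x)) / 2"
      by (simp add: algebra_simps diff_divide_distrib)
    finally show "(\<Sum>i\<in>UNIV. y $ i * (y $ i * (k (p + 1) x * w x) - k (p + 1) x * (x $ i * w x)))
       = (k p x * w x - (1 - (norm y)\<^sup>2) * (k (p + 1) x * w x)) / 2" unfolding kk[OF x] .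
  qed
  also have "\<dots> = (power_potential p w y - (1 - (norm y)\<^sup>2) * power_potential (p + 1) w y) / 2"
    unfolding power_potential_def k_def[symmetric] by (simp add: Iw)
  finally show ?A .
  have "(\<Sum>i\<in>UNIV. y $ i * (y $ i * power_potential (p + 1) w y - power_potential (p + 1) (\<lambda>x. x $ i * w x) y)
        - (y $ i * power_potential (p + 1) (\<lambda>x. x $ i * w x) y - power_potential (p + 1) (\<lambda>x. x $ i * (x $ i * w x)) y))
     = (\<integral>x. (\<Sum>i\<in>UNIV. y $ i * (y $ i * (k (p + 1) x * w x) - k (p + 1) x * (x $ i * w x))
        - (y $ i * (k (p + 1) x * (x $ i * w x)) - k (p + 1) x * (x $ i * (x $ i * w x)))) \<partial>sphere_measure)"
    unfolding power_potential_def k_def[symmetric] by (simp add: Bochner_Integration.integral_sum Iw)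
  also have "\<dots> = (\<integral>x. k p x * w x \<partial>sphere_measure)"
  proof (intro Bochner_Integration.integral_cong refl)
    fix x assume "x \<in> space (sphere_measure :: (real^'m) measure)"
    then have x: "norm x = 1" by simp
    have "(\<Sum>i\<in>UNIV. y $ i * (y $ i * (k (p + 1) x * w x) - k (p + 1) x * (x $ i * w x))
        - (y $ i * (k (p + 1) x * (x $ i * w x)) - k (p + 1) x * (x $ i * (x $ i * w x))))
      = (\<Sum>i\<in>UNIV. (y - x) $ i * (y - x) $ i) * (k (p + 1) x * w x)"
      unfolding sum_distrib_right by (intro sum.cong refl) (simp add: algebra_simps)
    also have "\<dots> = ((y - x) \<bullet> (y - x)) * k (p + 1) x * w x" by (simp add: inner_vec_def mult.assoc)
    finally show "(\<Sum>i\<in>UNIV. y $ i * (y $ i * (k (p + 1) x * w x) - k (p + 1) x * (x $ i * w x))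
        - (y $ i * (k (p + 1) x * (x $ i * w x)) - k (p + 1) x * (x $ i * (x $ i * w x)))) = k p x * w x" unfolding kk[OF x] .
  qed
  also have "\<dots> = power_potential p w y" by (simp add: power_potential_def k_def)
  finally show ?B .
qed

lemma Q_op_eq_power_potential:
  fixes w :: "real^'m::finite \<Rightarrow> real"
  shows "Q_op n \<sigma> w y = 2 powr (- 2 * \<sigma>) * beta_const n \<sigma> * ((1 - (norm y)\<^sup>2) powr (2 * \<sigma>) * power_potential ((real n + 2 * \<sigma>) / 2) w y)"
proof -
  have "norm (x - y) powr (real n + 2 * \<sigma>) = ((y - x) \<bullet> (y - x)) powr ((real n + 2 * \<sigma>) / 2)" for x
  proof (cases "x = y")
    case False
    then have "norm (x - y) > 0" by simp
    define m where "m = real n + 2 * \<sigma>"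
    have "((norm (x - y))\<^sup>2) powr (m / 2) = norm (x - y) powr m"
      using powr_powr[of "norm (x - y)" 2 "m / 2"] \<open>norm (x - y) > 0\<close> by simp
    then have "((norm (x - y))\<^sup>2) powr ((real n + 2 * \<sigma>) / 2) = norm (x - y) powr (real n + 2 * \<sigma>)"
      by (simp only: m_def)
    moreover have "(y - x) \<bullet> (y - x) = (norm (x - y))\<^sup>2" by (simp add: power2_norm_eq_inner[symmetric] norm_minus_commute)
    ultimately show ?thesis by simp
  qed simp
  note nrm = this
  have "(\<integral>x. (1 - (norm y)\<^sup>2) powr (2 * \<sigma>) / norm (x - y) powr (real n + 2 * \<sigma>) * w x \<partial>sphere_measure)
    = (\<integral>x. (1 - (norm y)\<^sup>2) powr (2 * \<sigma>) * (((y - x) \<bullet> (y - x)) powr (- ((real n + 2 * \<sigma>) / 2)) * w x) \<partial>sphere_measure)"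
    unfolding nrm by (intro Bochner_Integration.integral_cong refl) (simp only: powr_minus_divide, simp)
  then show ?thesis by (simp add: Q_op_def power_potential_def)
qed

text \<open>In the ball, component \<open>i\<close> of \<open>(1 - |y|\<^sup>2) powr (1 - 2 * \<sigma>) \<nabla>W\<close> with \<open>W = Q_op n \<sigma> w\<close>, with the powers of
  \<open>1 - |y|\<^sup>2\<close> cancelled.\<close>

definition Q_flux :: "nat \<Rightarrow> real \<Rightarrow> (real^'m::finite \<Rightarrow> real) \<Rightarrow> 'm \<Rightarrow> real^'m \<Rightarrow> real" where
  "Q_flux n \<sigma> w i y = (let p = (real n + 2 * \<sigma>) / 2 in
     2 powr (- 2 * \<sigma>) * beta_const n \<sigma> *
       (- 4 * \<sigma> * (y $ i * power_potential p w y)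
        - 2 * p * ((1 - (norm y)\<^sup>2) * (y $ i * power_potential (p + 1) w y - power_potential (p + 1) (\<lambda>x. x $ i * w x) y))))"

lemma has_derivative_one_minus_norm_sq:
  "((\<lambda>y::'a::real_inner. 1 - (norm y)\<^sup>2) has_derivative (\<lambda>h. - 2 * (y \<bullet> h))) (at y)"
  unfolding power2_norm_eq_inner by (auto intro!: derivative_eq_intros simp: inner_commute)

lemma Q_op_differentiable:
  fixes w :: "real^'m::finite \<Rightarrow> real"
  assumes y: "norm y < 1" and w: "continuous_on (sphere 0 1) w"
  shows "Q_op n \<sigma> w differentiable (at y)"
    and "(1 - (norm y)\<^sup>2) powr (1 - 2 * \<sigma>) * partial_deriv i (Q_op n \<sigma> w) y = Q_flux n \<sigma> w i y"
proof -
  define p where "p = (real n + 2 * \<sigma>) / 2"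
  define c where "c = 2 powr (- 2 * \<sigma>) * beta_const n \<sigma>"
  define s where "s = 1 - (norm y)\<^sup>2"
  have s: "s > 0" using y by (simp add: s_def abs_square_less_1)
  have Q: "Q_op n \<sigma> w = (\<lambda>y. c * ((1 - (norm y)\<^sup>2) powr (2 * \<sigma>) * power_potential p w y))"
    by (rule ext) (simp add: Q_op_eq_power_potential c_def p_def)
  have 2: "((\<lambda>q. q powr (2 * \<sigma>)) has_derivative (\<lambda>h. (2 * \<sigma> * s powr (2 * \<sigma> - 1)) * h)) (at (1 - (norm y)\<^sup>2))"
    using has_real_derivative_powr[OF s, of "2 * \<sigma>"] unfolding has_field_derivative_def s_def .
  have D: "((\<lambda>y. (1 - (norm y)\<^sup>2) powr (2 * \<sigma>)) has_derivative (\<lambda>h. (2 * \<sigma> * s powr (2 * \<sigma> - 1)) * (- 2 * (y \<bullet> h)))) (at y)"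
    by (rule has_derivative_compose[OF has_derivative_one_minus_norm_sq 2])
  then have d1: "(\<lambda>y. (1 - (norm y)\<^sup>2) powr (2 * \<sigma>)) differentiable (at y)" by (auto simp: differentiable_def)
  note d2 = has_derivative_power_potential[OF y w, where p = p]
  show "Q_op n \<sigma> w differentiable (at y)" unfolding Q by (intro differentiable_mult differentiable_const d1 d2(1))
  have "partial_deriv i (Q_op n \<sigma> w) y = c * (s powr (2 * \<sigma>) * partial_deriv i (power_potential p w) y
      + (2 * \<sigma> * s powr (2 * \<sigma> - 1)) * (- 2 * y $ i) * power_potential p w y)"
    unfolding Q by (subst partial_deriv_cmult, intro differentiable_mult d1 d2(1), subst partial_deriv_mult[OF d1 d2(1)])
      (simp add: partial_deriv_eqI[OF D] inner_axis s_def)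
  moreover have "s powr (1 - 2 * \<sigma>) * s powr (2 * \<sigma>) = s" "s powr (1 - 2 * \<sigma>) * s powr (2 * \<sigma> - 1) = 1"
    using s by (simp_all flip: powr_add)
  moreover have "X * (c * (A * d + (2 * \<sigma> * B) * (- 2 * y $ i) * I)) = c * ((X * A) * d + 2 * \<sigma> * (- 2 * y $ i) * (X * B) * I)" for X A B d I
    by (simp add: algebra_simps)
  ultimately have "s powr (1 - 2 * \<sigma>) * partial_deriv i (Q_op n \<sigma> w) y = c * (s * partial_deriv i (power_potential p w) y
      + 2 * \<sigma> * (- 2 * y $ i) * 1 * power_potential p w y)"
    by metis
  then show "(1 - (norm y)\<^sup>2) powr (1 - 2 * \<sigma>) * partial_deriv i (Q_op n \<sigma> w) y = Q_flux n \<sigma> w i y"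
    unfolding d2(2) s_def[symmetric] Q_flux_def Let_def p_def[symmetric] c_def[symmetric]
    by (simp add: algebra_simps)
qed

text \<open>Contracting the second derivatives leaves potentials with exponents p and p + 1. Since 2
  p = n + 2 \<sigma> and the dimension is n + 1, the coefficient of the latter vanishes, and the
  divergence is a multiple of the extension itself, with a multiplier independent of w.\<close>

lemma Q_flux_divergence:
  fixes w :: "real^'m::finite \<Rightarrow> real"
  assumes card: "CARD('m) = n + 1" and y: "norm y < 1" and w: "continuous_on (sphere 0 1) w"
  shows "Q_flux n \<sigma> w i differentiable (at y)"
    and "(\<Sum>i\<in>UNIV. partial_deriv i (Q_flux n \<sigma> w i) y)
      = (real n - 2 * \<sigma>) * (1 - 2 * \<sigma>) * ((1 - (norm y)\<^sup>2) powr (- (2 * \<sigma>)) * Q_op n \<sigma> w y)"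
proof -
  define p where "p = (real n + 2 * \<sigma>) / 2"
  define c where "c = 2 powr (- 2 * \<sigma>) * beta_const n \<sigma>"
  define s where "s = 1 - (norm y)\<^sup>2"
  have s: "s > 0" using y by (simp add: s_def abs_square_less_1)
  define I where "I q v = power_potential q v y" for q v
  define xw where "xw i x = x $ i * w x" for i and x :: "real^'m"
  have cxw: "continuous_on (sphere 0 1) (xw i)" "continuous_on (sphere 0 1) (\<lambda>x. x $ i * xw i x)" for i
    unfolding xw_def by (intro continuous_intros w)+
  have Qf: "Q_flux n \<sigma> w i = (\<lambda>y. c * (- 4 * \<sigma> * (y $ i * power_potential p w y)
      - 2 * p * ((1 - (norm y)\<^sup>2) * (y $ i * power_potential (p + 1) w y - power_potential (p + 1) (xw i) y))))" for i
    by (rule ext) (simp add: Q_flux_def Let_def p_def c_def xw_def[abs_def])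
  note dI = has_derivative_power_potential[OF y w] and dX = has_derivative_power_potential[OF y cxw(1)]
  have dy: "(\<lambda>y::real^'m. y $ i) differentiable (at y)" for i
    by (simp add: bounded_linear_imp_differentiable bounded_linear_vec_nth)
  have ds: "(\<lambda>y::real^'m. 1 - (norm y)\<^sup>2) differentiable (at y)"
    using has_derivative_one_minus_norm_sq by (auto simp: differentiable_def)
  note dd = differentiable_mult differentiable_diff differentiable_const dy ds dI(1) dX(1)
  show "Q_flux n \<sigma> w i differentiable (at y)" for i unfolding Qf by (intro dd)
  have ps: "partial_deriv i (\<lambda>y::real^'m. 1 - (norm y)\<^sup>2) y = - 2 * y $ i" for i
    using partial_deriv_eqI[OF has_derivative_one_minus_norm_sq, of i y] by (simp add: inner_axis)
  define a where "a i = y $ i * I (p + 1) w - I (p + 1) (xw i)" for i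
  define a2 where "a2 i = y $ i * I (p + 2) w - I (p + 2) (xw i)" for i
  define b2 where "b2 i = y $ i * I (p + 2) (xw i) - I (p + 2) (\<lambda>x. x $ i * xw i x)" for i
  have pI: "partial_deriv i (power_potential p w) y = - 2 * p * a i"
     "partial_deriv i (power_potential (p + 1) w) y = - 2 * (p + 1) * a2 i"
     "partial_deriv i (power_potential (p + 1) (xw i)) y = - 2 * (p + 1) * b2 i" for i
    unfolding dI(2) dX(2) a_def a2_def b2_def I_def by (simp_all add: xw_def[abs_def] add.assoc)
  have P: "partial_deriv i (Q_flux n \<sigma> w i) y = c * (- 4 * \<sigma> * (y $ i * (- 2 * p * a i) + I p w)
      - 2 * p * (s * (y $ i * (- 2 * (p + 1) * a2 i) + I (p + 1) w - (- 2 * (p + 1) * b2 i)) + (- 2 * y $ i) * a i))" for i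
  proof -
    have 1: "partial_deriv i (\<lambda>y. y $ i * power_potential p w y) y = y $ i * (- 2 * p * a i) + I p w"
      by (subst partial_deriv_mult[OF dy dI(1)]) (simp add: pI I_def)
    have 2: "partial_deriv i (\<lambda>y. y $ i * power_potential (p + 1) w y - power_potential (p + 1) (xw i) y) y
       = y $ i * (- 2 * (p + 1) * a2 i) + I (p + 1) w - (- 2 * (p + 1) * b2 i)"
      by (subst partial_deriv_diff[OF differentiable_mult[OF dy dI(1)] dX(1)], subst partial_deriv_mult[OF dy dI(1)]) (simp add: pI I_def)
    have 3: "partial_deriv i (\<lambda>y. (1 - (norm y)\<^sup>2) * (y $ i * power_potential (p + 1) w y - power_potential (p + 1) (xw i) y)) y
       = s * (y $ i * (- 2 * (p + 1) * a2 i) + I (p + 1) w - (- 2 * (p + 1) * b2 i)) + (- 2 * y $ i) * a i"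
      by (subst partial_deriv_mult, intro dd, intro dd) (simp add: 2 ps s_def a_def I_def)
    show ?thesis unfolding Qf
      by (subst partial_deriv_cmult, intro dd, subst partial_deriv_diff, intro dd, intro dd,
          subst partial_deriv_cmult, intro dd, subst partial_deriv_cmult, intro dd) (simp add: 1 3)
  qed
  have "2 * p = real n + 2 * \<sigma>" by (simp add: p_def)
  then have np: "real n = 2 * p - 2 * \<sigma>" by simp
  have M1: "(\<Sum>i\<in>UNIV. y $ i * a i) = (I p w - s * I (p + 1) w) / 2"
    using power_potential_moments(1)[OF y w, of p] by (simp add: a_def I_def s_def xw_def[abs_def])
  have M2: "(\<Sum>i\<in>UNIV. y $ i * a2 i - b2 i) = I (p + 1) w"
    using power_potential_moments(2)[OF y w, of "p + 1"] by (simp add: a2_def b2_def I_def xw_def[abs_def] add.assoc)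
  have "(\<Sum>i\<in>UNIV. partial_deriv i (Q_flux n \<sigma> w i) y)
    = (\<Sum>i\<in>UNIV. c * ((8 * \<sigma> * p + 4 * p) * (y $ i * a i) + (- 4 * \<sigma> * I p w - 2 * p * s * I (p + 1) w)
        + 4 * p * (p + 1) * s * (y $ i * a2 i - b2 i)))"
    unfolding P by (intro sum.cong refl) (simp add: algebra_simps)
  also have "\<dots> = c * ((8 * \<sigma> * p + 4 * p) * (\<Sum>i\<in>UNIV. y $ i * a i) + real CARD('m) * (- 4 * \<sigma> * I p w - 2 * p * s * I (p + 1) w)
        + 4 * p * (p + 1) * s * (\<Sum>i\<in>UNIV. y $ i * a2 i - b2 i))"
    by (simp only: sum.distrib sum_distrib_left[symmetric] sum_constant)
  also have "\<dots> = c * ((4 * \<sigma> * p + 2 * p - 4 * \<sigma> * (real n + 1)) * I p w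
        + s * 2 * p * (- (2 * \<sigma> + 1) - (real n + 1) + 2 * (p + 1)) * I (p + 1) w)"
    unfolding M1 M2 card by (simp add: field_simps)
  also have "- (2 * \<sigma> + 1) - (real n + 1) + 2 * (p + 1) = 0" by (simp add: np)
  also have "4 * \<sigma> * p + 2 * p - 4 * \<sigma> * (real n + 1) = (real n - 2 * \<sigma>) * (1 - 2 * \<sigma>)"
    by (simp add: np algebra_simps)
  finally have "(\<Sum>i\<in>UNIV. partial_deriv i (Q_flux n \<sigma> w i) y) = (real n - 2 * \<sigma>) * (1 - 2 * \<sigma>) * (c * I p w)"
    by simp
  moreover have "s powr (- (2 * \<sigma>)) * Q_op n \<sigma> w y = c * I p w"
    using s by (simp add: Q_op_eq_power_potential c_def p_def I_def s_def powr_minus)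
  ultimately show "(\<Sum>i\<in>UNIV. partial_deriv i (Q_flux n \<sigma> w i) y)
      = (real n - 2 * \<sigma>) * (1 - 2 * \<sigma>) * ((1 - (norm y)\<^sup>2) powr (- (2 * \<sigma>)) * Q_op n \<sigma> w y)" by (simp add: s_def)
qed

section \<open>Conformally flat metrics and the interior equation\<close>

lemma conf_flat_riem_grad:
  fixes f :: "real^'m::finite \<Rightarrow> real"
  assumes "\<phi> y \<noteq> 0" "f differentiable (at y)"
  shows "riem_grad (conf_flat \<phi>) f y = (1 / \<phi> y) *\<^sub>R gradient f y"
  unfolding riem_grad_def conf_flat_def
proof (rule the_equality)
  have fd: "frechet_derivative f (at y) z = gradient f y \<bullet> z" for z
    using frechet_derivative_at[OF has_derivative_gradient[OF assms(2)]] by simp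
  show "\<forall>z. \<phi> y * ((1 / \<phi> y) *\<^sub>R gradient f y \<bullet> z) = frechet_derivative f (at y) z"
    using assms(1) by (simp add: fd)
  fix w assume "\<forall>z. \<phi> y * (w \<bullet> z) = frechet_derivative f (at y) z"
  then have "\<forall>z. (\<phi> y *\<^sub>R w) \<bullet> z = gradient f y \<bullet> z" by (simp add: fd)
  then have "\<phi> y *\<^sub>R w = gradient f y" using vector_eq_rdot by blast
  then show "w = (1 / \<phi> y) *\<^sub>R gradient f y" using assms(1) by (metis divide_self_if divide_inverse_commute mult.right_neutral scaleR_one scaleR_scaleR)
qed

lemma conf_flat_vol_density:
  fixes y :: "real^'m::finite"
  assumes "\<phi> y > 0"
  shows "vol_density (conf_flat \<phi>) y = \<phi> y powr (real CARD('m) / 2)"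
proof -
  have "det (\<chi> i j. conf_flat \<phi> y (axis i 1) (axis j 1) :: real^'m^'m) = (\<Prod>i\<in>(UNIV::'m set). \<phi> y)"
    by (subst det_diagonal) (auto simp: conf_flat_def inner_axis_axis)
  also have "\<dots> = \<phi> y powr real CARD('m)" using assms by (simp add: powr_realpow)
  finally show ?thesis using assms by (simp add: vol_density_def powr_half_sqrt[symmetric] powr_powr)
qed

text \<open>The integrand is continuous and positive on the sphere, so a vanishing integral would
  force it to be zero pointwise. Positivity licenses the division by U and its real powers.\<close>

lemma Q_op_pos:
  fixes u :: "real^'m::finite \<Rightarrow> real"
  assumes \<beta>: "beta_const n \<sigma> > 0" and u: "continuous_on (sphere 0 1) u" "\<And>x. x \<in> sphere 0 1 \<Longrightarrow> 0 < u x"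
    and y: "norm y < 1"
  shows "Q_op n \<sigma> u y > 0"
proof -
  have c: "continuous_on (sphere 0 1) (\<lambda>x. ((y - x) \<bullet> (y - x)) powr (- p) * u x)" for p
    by (rule continuous_on_power_kernel[OF y u(1)])
  have pos: "((y - x) \<bullet> (y - x)) powr (- p) * u x > 0" if "x \<in> sphere 0 1" for x p
    using sphere_ball_dist_pos[of x y] y u(2)[OF that] that by (intro mult_pos_pos) auto
  obtain z :: "real^'m" where z: "z \<in> sphere 0 1" using norm_axis_1 by (metis mem_sphere_0)
  have "power_potential p u y > 0" for p
  proof -
    have "power_potential p u y \<ge> 0" unfolding power_potential_def
      using pos by (intro Bochner_Integration.integral_nonneg_AE AE_I2) (auto intro: less_imp_le)
    moreover have "power_potential p u y \<noteq> 0"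
      using integral_sphere_eq_0_iff[OF c _ _ z, of p] pos z unfolding power_potential_def by (metis less_imp_le less_irrefl)
    ultimately show ?thesis by simp
  qed
  moreover have "(1 - (norm y)\<^sup>2) powr (2 * \<sigma>) > 0" using y by (simp add: abs_square_eq_1 )
  ultimately show ?thesis unfolding Q_op_eq_power_potential using \<beta> by simp
qed

lemma divergence_equation:
  fixes u w :: "real^'m::finite \<Rightarrow> real"
  assumes card: "CARD('m) = n + 1" and n\<sigma>: "real n - 2 * \<sigma> > 0" and \<beta>: "beta_const n \<sigma> > 0"
    and u: "continuous_on (sphere 0 1) u" "\<And>x. x \<in> sphere 0 1 \<Longrightarrow> 0 < u x" and w: "continuous_on (sphere 0 1) w"
    and U: "U = Q_op n \<sigma> u" and V: "V = Q_op n \<sigma> w" and a: "a = (2 - 4 * \<sigma>) / (real n - 2 * \<sigma>)"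
    and G: "G = conf_flat (\<lambda>y. U y powr (4 / (real n - 2 * \<sigma>)))" and y: "y \<in> ball 0 1"
  shows "riem_div G (\<lambda>z. ((1 - (norm z)\<^sup>2) powr (1 - 2 * \<sigma>) * U z powr a) *\<^sub>R riem_grad G (\<lambda>z. V z / U z) z) y = 0"
proof -
  have Up: "U z > 0" if "norm z < 1" for z unfolding U by (rule Q_op_pos[OF \<beta> u that])
  have dU: "U differentiable (at z)" "V differentiable (at z)" if "norm z < 1" for z
    unfolding U V using Q_op_differentiable(1)[OF that] u(1) w by auto
  define X where "X i z = U z * Q_flux n \<sigma> w i z - V z * Q_flux n \<sigma> u i z" for i z
  have quot: "(\<lambda>z. V z / U z) differentiable (at z)"
    "partial_deriv i (\<lambda>z. V z / U z) z = (U z * partial_deriv i V z - V z * partial_deriv i U z) / (U z)\<^sup>2" if z: "norm z < 1" for z i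
  proof -
    have "U z \<noteq> 0" using Up[OF z] by simp
    from has_derivative_divide[OF has_derivative_gradient[OF dU(2)[OF z]] has_derivative_gradient[OF dU(1)[OF z]] this]
    have D: "((\<lambda>z. V z / U z) has_derivative (\<lambda>h. - V z * (inverse (U z) * (gradient U z \<bullet> h) * inverse (U z)) + gradient V z \<bullet> h / U z)) (at z)" .
    then show "(\<lambda>z. V z / U z) differentiable (at z)" by (auto simp: differentiable_def)
    show "partial_deriv i (\<lambda>z. V z / U z) z = (U z * partial_deriv i V z - V z * partial_deriv i U z) / (U z)\<^sup>2"
      using \<open>U z \<noteq> 0\<close> partial_deriv_eqI[OF D, of i] by (simp add: inner_axis field_simps power2_eq_square)
  qed
  have field: "vol_density G z * (((1 - (norm z)\<^sup>2) powr (1 - 2 * \<sigma>) * U z powr a) *\<^sub>R riem_grad G (\<lambda>z. V z / U z) z) $ i = X i z"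
    if z: "norm z < 1" for z i
  proof -
    define U0 where "U0 = U z"
    have U0: "U0 > 0" using Up[OF z] by (simp add: U0_def)
    define \<phi> where "\<phi> = U0 powr (4 / (real n - 2 * \<sigma>))"
    have \<phi>: "\<phi> > 0" using U0 by (simp add: \<phi>_def)
    have vd: "vol_density G z = \<phi> powr (real CARD('m) / 2)"
      unfolding G using conf_flat_vol_density[of "\<lambda>y. U y powr (4 / (real n - 2 * \<sigma>))" z] \<phi> by (simp add: \<phi>_def U0_def)
    have rg: "riem_grad G (\<lambda>z. V z / U z) z = (1 / \<phi>) *\<^sub>R gradient (\<lambda>z. V z / U z) z"
      unfolding G using conf_flat_riem_grad[of "\<lambda>y. U y powr (4 / (real n - 2 * \<sigma>))" z, OF _ quot(1)[OF z]] \<phi> by (simp add: \<phi>_def U0_def)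
    \<comment> \<open>Volume density, weight and inverse metric contribute 2 (n + 1), 2 - 4 \<sigma>
      and -4, each over n - 2 \<sigma>. The sum is 2, and the resulting square of U cancels the
      denominator of the quotient rule; this is the origin of a.\<close>
    have "4 / (real n - 2 * \<sigma>) * (real CARD('m) / 2) + a + - (4 / (real n - 2 * \<sigma>)) = 2"
    proof -
      define N where "N = real n - 2 * \<sigma>"
      have "N \<noteq> 0" "real CARD('m) = N + 2 * \<sigma> + 1" using n\<sigma> by (simp_all add: N_def card)
      then show ?thesis unfolding a N_def[symmetric] by (simp add: field_simps)
    qed
    note ex = this
    have pw: "\<phi> powr (real CARD('m) / 2) * U0 powr a * (1 / \<phi>) = U0\<^sup>2"
    proof -
      have "\<phi> powr (real CARD('m) / 2) * U0 powr a * (1 / \<phi>)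
        = U0 powr (4 / (real n - 2 * \<sigma>) * (real CARD('m) / 2) + a + - (4 / (real n - 2 * \<sigma>)))"
        unfolding \<phi>_def powr_add powr_powr powr_minus_divide ..
      also have "\<dots> = U0 powr 2" by (simp only: ex)
      finally show ?thesis using U0 by simp
    qed
    have "vol_density G z * (((1 - (norm z)\<^sup>2) powr (1 - 2 * \<sigma>) * U z powr a) *\<^sub>R riem_grad G (\<lambda>z. V z / U z) z) $ i
      = (\<phi> powr (real CARD('m) / 2) * U0 powr a * (1 / \<phi>)) * ((1 - (norm z)\<^sup>2) powr (1 - 2 * \<sigma>) * partial_deriv i (\<lambda>z. V z / U z) z)"
      unfolding vd rg by (simp add: U0_def)
    also have "\<dots> = (1 - (norm z)\<^sup>2) powr (1 - 2 * \<sigma>) * (U z * partial_deriv i V z - V z * partial_deriv i U z)"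
      unfolding pw quot(2)[OF z] using U0 by (simp add: U0_def)
    also have "\<dots> = U z * ((1 - (norm z)\<^sup>2) powr (1 - 2 * \<sigma>) * partial_deriv i V z) - V z * ((1 - (norm z)\<^sup>2) powr (1 - 2 * \<sigma>) * partial_deriv i U z)"
      by (simp add: algebra_simps)
    also have "\<dots> = X i z"
      unfolding U V Q_op_differentiable(2)[OF z u(1)] Q_op_differentiable(2)[OF z w] by (simp add: X_def U V)
    finally show ?thesis .
  qed
  have yn: "norm y < 1" using y by simp
  note fl = Q_flux_divergence[OF card yn]
  have "(\<Sum>i\<in>UNIV. partial_deriv i (\<lambda>z. vol_density G z * (((1 - (norm z)\<^sup>2) powr (1 - 2 * \<sigma>) * U z powr a) *\<^sub>R riem_grad G (\<lambda>z. V z / U z) z) $ i) y)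
     = (\<Sum>i\<in>UNIV. partial_deriv i (X i) y)"
    by (intro sum.cong refl partial_deriv_cong[OF open_ball y] field) simp
  also have "\<dots> = (\<Sum>i\<in>UNIV. U y * partial_deriv i (Q_flux n \<sigma> w i) y + partial_deriv i U y * Q_flux n \<sigma> w i y
      - (V y * partial_deriv i (Q_flux n \<sigma> u i) y + partial_deriv i V y * Q_flux n \<sigma> u i y))"
    unfolding X_def[abs_def]
    by (intro sum.cong refl, subst partial_deriv_diff, (intro differentiable_mult dU yn fl(1) w u(1))+,
        subst partial_deriv_mult[OF dU(1)[OF yn] fl(1)[OF w]], subst partial_deriv_mult[OF dU(2)[OF yn] fl(1)[OF u(1)]]) simp
  \<comment> \<open>The cross terms cancel: both are the weight times the product of the partial
    derivatives of U and V.\<close>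
  also have "\<dots> = (\<Sum>i\<in>UNIV. U y * partial_deriv i (Q_flux n \<sigma> w i) y - V y * partial_deriv i (Q_flux n \<sigma> u i) y)"
  proof (intro sum.cong refl)
    fix i :: 'm
    have "partial_deriv i U y * Q_flux n \<sigma> w i y = partial_deriv i V y * Q_flux n \<sigma> u i y"
      unfolding U V Q_op_differentiable(2)[OF yn u(1), symmetric] Q_op_differentiable(2)[OF yn w, symmetric] by (simp add: mult_ac)
    then show "U y * partial_deriv i (Q_flux n \<sigma> w i) y + partial_deriv i U y * Q_flux n \<sigma> w i y
      - (V y * partial_deriv i (Q_flux n \<sigma> u i) y + partial_deriv i V y * Q_flux n \<sigma> u i y)
      = U y * partial_deriv i (Q_flux n \<sigma> w i) y - V y * partial_deriv i (Q_flux n \<sigma> u i) y" by simp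
  qed
  also have "\<dots> = U y * (\<Sum>i\<in>UNIV. partial_deriv i (Q_flux n \<sigma> w i) y) - V y * (\<Sum>i\<in>UNIV. partial_deriv i (Q_flux n \<sigma> u i) y)"
    by (simp add: sum_subtractf sum_distrib_left)
  also have "\<dots> = 0" unfolding fl(2)[OF w] fl(2)[OF u(1)] U V by (simp add: mult_ac)
  finally show ?thesis by (simp add: riem_div_def)
qed


section \<open>The conormal derivative\<close>

context sphere_dim
begin

lemma \<omega>_Gamma: "\<omega> * Gamma ((real n + 1) / 2) = 2 * pi powr ((real n + 1) / 2)"
proof -
  define N where "N = (real n + 1) / 2"
  have N: "N > 0" by (simp add: N_def add_nonneg_pos)
  have "Gamma (N + 1) = N * Gamma N" using N by (intro Gamma_plus1) (auto elim!: nonpos_Ints_cases)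
  moreover have "\<omega> = 2 * N * (pi powr N / Gamma (N + 1))"
  proof -
    have "real n + 1 = 2 * N" by (simp add: N_def)
    then show ?thesis by (simp add: \<omega>_eq unit_ball_vol_def)
  qed
  moreover have "Gamma N > 0" using N by (rule Gamma_real_pos)
  ultimately show ?thesis using N unfolding N_def[symmetric] by (simp add: field_simps)
qed

lemma riesz_potential_one_Gamma:
  assumes \<sigma>: "0 < \<sigma>" "\<sigma> < 1"
  shows "riesz_potential (real n / 2 - \<sigma>) (\<lambda>_. 1) * (Gamma (real n / 2 + \<sigma>) * Gamma (\<sigma> + 1 / 2))
    = \<omega> * Gamma (2 * \<sigma>) * Gamma ((real n + 1) / 2)"
proof -
  define a where "a = real n / 2 - \<sigma>"
  have a: "0 < a" "a < real n / 2" using \<sigma> n2 by (auto simp: a_def)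
  have e: "(real n + 1) / 2 - a = \<sigma> + 1 / 2" "real n - 2 * a = 2 * \<sigma>" "a + 2 * \<sigma> = real n / 2 + \<sigma>" "a + (\<sigma> + 1 / 2) = (real n + 1) / 2"
    by (auto simp: a_def add_divide_distrib)
  have pos: "Gamma a > 0" "Gamma (\<sigma> + 1 / 2) > 0" "Gamma (2 * \<sigma>) > 0" "Gamma (real n / 2 + \<sigma>) > 0" "Gamma ((real n + 1) / 2) > 0"
    using a \<sigma> by (auto intro!: Gamma_real_pos simp: add_nonneg_pos)
  have "Beta a (\<sigma> + 1 / 2) * riesz_potential a (\<lambda>_. 1) = \<omega> * Beta a (2 * \<sigma>)"
    using riesz_potential_one[OF a] unfolding e .
  then have "Gamma a * Gamma (\<sigma> + 1 / 2) / Gamma ((real n + 1) / 2) * riesz_potential a (\<lambda>_. 1)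
     = \<omega> * (Gamma a * Gamma (2 * \<sigma>) / Gamma (real n / 2 + \<sigma>))"
    unfolding Beta_def e .
  moreover have "R * (g1 * g2) = w * g3 * g4"
    if "g0 * g2 / g4 * R = w * (g0 * g3 / g1)" "g0 > 0" "g1 > 0" "g4 > 0" for R w g0 g1 g2 g3 g4 :: real
    using that by (simp add: field_simps)
  ultimately show ?thesis using pos unfolding a_def[symmetric] by blast
qed

text \<open>The constant of the extension is defined through the half space. Together with 2^(-2
  \<sigma>) it is the right one for the ball too, which is what makes the extension attain its
  boundary values. The area of the sphere and duplication at \<sigma> reconcile the two.\<close>

lemma Q_normalization:
  assumes \<sigma>: "0 < \<sigma>" "\<sigma> < 1"
  shows "2 powr (- 2 * \<sigma>) * beta_const n \<sigma> * riesz_potential (real n / 2 - \<sigma>) (\<lambda>_. 1) = 1"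
proof -
  define R where "R = riesz_potential (real n / 2 - \<sigma>) (\<lambda>_. 1)"
  define g1 g2 g3 g4 g5 where "g1 = Gamma (real n / 2 + \<sigma>)" and "g2 = Gamma (\<sigma> + 1 / 2)" and "g3 = Gamma (2 * \<sigma>)"
    and "g4 = Gamma ((real n + 1) / 2)" and "g5 = Gamma \<sigma>"
  have g: "g1 > 0" "g2 > 0" "g3 > 0" "g4 > 0" "g5 > 0"
    using \<sigma> by (auto intro!: Gamma_real_pos simp: g1_def g2_def g3_def g4_def g5_def add_nonneg_pos)
  have b: "beta_const n \<sigma> = g1 / (pi powr (real n / 2) * g5)"
    using beta_const_eq[of n \<sigma>] n2 \<sigma> by (simp add: g1_def g5_def)
  have R: "R * (g1 * g2) = 2 * pi powr ((real n + 1) / 2) * g3"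
    using riesz_potential_one_Gamma[OF \<sigma>] \<omega>_Gamma by (simp add: R_def g1_def g2_def g3_def g4_def mult_ac)
  have d: "g5 * g2 = 2 powr (1 - 2 * \<sigma>) * sqrt pi * g3"
    using Gamma_duplication_real[OF \<sigma>(1)] by (simp add: g5_def g2_def g3_def)
  have p: "pi powr ((real n + 1) / 2) = pi powr (real n / 2) * sqrt pi"
    by (simp add: add_divide_distrib powr_add powr_half_sqrt)
  have t: "2 powr (- 2 * \<sigma>) * 2 = 2 powr (1 - 2 * \<sigma>)" by (simp add: powr_diff powr_minus divide_inverse)
  have "2 powr (- 2 * \<sigma>) * beta_const n \<sigma> * R * (pi powr (real n / 2) * g5 * g2)
     = 2 powr (- 2 * \<sigma>) * (R * (g1 * g2))"
    unfolding b using g by (simp add: field_simps)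
  also have "\<dots> = (2 powr (- 2 * \<sigma>) * 2) * sqrt pi * g3 * pi powr (real n / 2)" unfolding R p by (simp add: mult_ac)
  also have "\<dots> = 1 * (pi powr (real n / 2) * g5 * g2)" unfolding t using d by (simp add: mult_ac)
  finally have "2 powr (- 2 * \<sigma>) * beta_const n \<sigma> * R = 1"
    by (rule mult_right_cancel[THEN iffD1, rotated]) (use g in simp)
  then show ?thesis by (simp add: R_def)
qed

text \<open>Besides duplication at \<sigma>, duplication at 1 - \<sigma> enters: it links \<Gamma>(1
  - \<sigma>) from \<open>N_const\<close> and \<Gamma>(3/2 - \<sigma>) from the Riesz expansion to
  \<Gamma>(2 - 2 \<sigma>) from the eigenvalues.\<close>

lemma conormal_constant:
  assumes \<sigma>: "0 < \<sigma>" "\<sigma> < 1" and \<alpha>: "\<alpha> = real n / 2 + \<sigma> - 1"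
  shows "2 powr \<alpha> * (\<omega> * Gamma (2 - 2 * \<sigma>))
    = N_const \<sigma> * \<alpha> * (2 powr (real n / 2 - \<sigma>) * riesz_potential (real n / 2 - \<sigma>) (\<lambda>_. 1)) * Beta \<alpha> (3 / 2 - \<sigma>)"
proof -
  define R where "R = riesz_potential (real n / 2 - \<sigma>) (\<lambda>_. 1)"
  define g1 g2 g3 g4 g5 where "g1 = Gamma (real n / 2 + \<sigma>)" and "g2 = Gamma (\<sigma> + 1 / 2)" and "g3 = Gamma (2 * \<sigma>)"
    and "g4 = Gamma ((real n + 1) / 2)" and "g5 = Gamma \<sigma>"
  define h1 h2 h3 where "h1 = Gamma (1 - \<sigma>)" and "h2 = Gamma (3 / 2 - \<sigma>)" and "h3 = Gamma (2 - 2 * \<sigma>)"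
  have \<alpha>0: "\<alpha> > 0" using \<sigma> n2 by (simp add: \<alpha>)
  have g: "g1 > 0" "g2 > 0" "g3 > 0" "g4 > 0" "g5 > 0" "h1 > 0" "h2 > 0" "h3 > 0"
    using \<sigma> by (auto intro!: Gamma_real_pos simp: g1_def g2_def g3_def g4_def g5_def h1_def h2_def h3_def add_nonneg_pos)
  have R: "R * (g1 * g2) = \<omega> * g3 * g4"
    using riesz_potential_one_Gamma[OF \<sigma>] by (simp add: R_def g1_def g2_def g3_def g4_def)
  have "Gamma (\<alpha> + 1) = \<alpha> * Gamma \<alpha>" using \<alpha>0 by (intro Gamma_plus1) (auto elim!: nonpos_Ints_cases)
  then have "\<alpha> * Gamma \<alpha> = g1" by (simp add: \<alpha> g1_def)
  moreover have "Beta \<alpha> (3 / 2 - \<sigma>) = Gamma \<alpha> * h2 / g4"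
  proof -
    have "\<alpha> + (3 / 2 - \<sigma>) = (real n + 1) / 2" by (simp add: \<alpha> add_divide_distrib)
    then show ?thesis unfolding Beta_def h2_def g4_def by (simp only:)
  qed
  ultimately have B: "\<alpha> * Beta \<alpha> (3 / 2 - \<sigma>) = g1 * h2 / g4" by simp
  have N: "N_const \<sigma> = 2 powr (1 - 2 * \<sigma>) * h1 / g5" by (simp add: N_const_def h1_def g5_def)
  have d1: "g5 * g2 = 2 powr (1 - 2 * \<sigma>) * sqrt pi * g3"
    using Gamma_duplication_real[OF \<sigma>(1)] by (simp add: g5_def g2_def g3_def)
  have d2: "h1 * h2 = 2 powr (1 - 2 * (1 - \<sigma>)) * sqrt pi * h3"
  proof -
    have "1 - \<sigma> + 1 / 2 = 3 / 2 - \<sigma>" "2 * (1 - \<sigma>) = 2 - 2 * \<sigma>" by simp_all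
    then show ?thesis using Gamma_duplication_real[of "1 - \<sigma>"] \<sigma> by (simp add: h1_def h2_def h3_def)
  qed
  have t: "2 powr (real n / 2 - \<sigma>) * 2 powr (1 - 2 * (1 - \<sigma>)) = 2 powr \<alpha>"
    unfolding \<alpha> powr_add[symmetric] by (rule arg_cong[where f="\<lambda>z. 2 powr z"]) simp
  have "N_const \<sigma> * \<alpha> * (2 powr (real n / 2 - \<sigma>) * R) * Beta \<alpha> (3 / 2 - \<sigma>) * (g5 * g2)
     = 2 powr (1 - 2 * \<sigma>) * h1 * 2 powr (real n / 2 - \<sigma>) * h2 / g4 * (R * (g1 * g2))"
  proof -
    have "N_const \<sigma> * \<alpha> * (2 powr (real n / 2 - \<sigma>) * R) * Beta \<alpha> (3 / 2 - \<sigma>) * (g5 * g2)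
       = N_const \<sigma> * (2 powr (real n / 2 - \<sigma>) * R) * (\<alpha> * Beta \<alpha> (3 / 2 - \<sigma>)) * (g5 * g2)" by (simp only: mult_ac)
    also have "\<dots> = 2 powr (1 - 2 * \<sigma>) * h1 * 2 powr (real n / 2 - \<sigma>) * h2 / g4 * (R * (g1 * g2))"
      unfolding B N using g by (simp add: field_simps)
    finally show ?thesis .
  qed
  also have "\<dots> = (h1 * h2) * 2 powr (1 - 2 * \<sigma>) * 2 powr (real n / 2 - \<sigma>) * \<omega> * g3"
    unfolding R using g by (simp add: field_simps)
  also have "\<dots> = (2 powr (real n / 2 - \<sigma>) * 2 powr (1 - 2 * (1 - \<sigma>))) * (2 powr (1 - 2 * \<sigma>) * sqrt pi * g3) * \<omega> * h3"
    unfolding d2 by (simp only: mult_ac)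
  also have "\<dots> = 2 powr \<alpha> * (\<omega> * h3) * (g5 * g2)" unfolding t d1[symmetric] by (simp only: mult_ac)
  finally have "N_const \<sigma> * \<alpha> * (2 powr (real n / 2 - \<sigma>) * R) * Beta \<alpha> (3 / 2 - \<sigma>) = 2 powr \<alpha> * (\<omega> * h3)"
    by (rule mult_right_cancel[THEN iffD1, rotated]) (use g in simp)
  then show ?thesis by (simp add: R_def h3_def)
qed

text \<open>The weight becomes a function of b as well, because b^2 - 1 = ((1 - \<tau>^2) / (2
  \<tau>))^2. The power of 2 \<tau> that is left over does not involve w, so it cancels in a
  quotient of two extensions.\<close>

lemma Q_op_radial:
  assumes \<tau>: "0 < \<tau>" "\<tau> < 1"
  shows "Q_op n \<sigma> w (\<tau> *\<^sub>R e) = 2 powr (- 2 * \<sigma>) * beta_const n \<sigma> * ((2 * \<tau>) powr (\<sigma> - real n / 2)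
     * scaled_singular \<sigma> w ((1 + \<tau>\<^sup>2) / (2 * \<tau>)))"
proof -
  define b where "b = (1 + \<tau>\<^sup>2) / (2 * \<tau>)"
  define s where "s = 1 - \<tau>\<^sup>2"
  have s: "s > 0" using \<tau> by (simp add: s_def abs_square_less_1)
  have ee: "e \<bullet> e = 1" using e by (simp add: dot_square_norm)
  have ns: "(norm (\<tau> *\<^sub>R e))\<^sup>2 = \<tau>\<^sup>2" using e \<tau> by simp
  define p where "p = real n / 2 + \<sigma>"
  have b1: "b - 1 > 0"
  proof -
    have "b - 1 = (1 - \<tau>)\<^sup>2 / (2 * \<tau>)" using \<tau> by (simp add: b_def divide_simps) (simp add: power2_eq_square algebra_simps)
    then show ?thesis using \<tau> by simp
  qed
  have "power_potential p w (\<tau> *\<^sub>R e) = (\<integral>x. (2 * \<tau>) powr (- p) * ((b - x \<bullet> e) powr (- p) * w x) \<partial>sphere_measure)"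
    unfolding power_potential_def
  proof (intro Bochner_Integration.integral_cong refl)
    fix x assume "x \<in> space (sphere_measure :: (real^'m) measure)"
    then have x: "norm x = 1" by simp
    then have xx: "x \<bullet> x = 1" by (simp add: dot_square_norm)
    have "(\<tau> *\<^sub>R e - x) \<bullet> (\<tau> *\<^sub>R e - x) = \<tau>\<^sup>2 * (e \<bullet> e) - 2 * \<tau> * (x \<bullet> e) + x \<bullet> x"
      by (simp add: inner_diff_left inner_diff_right inner_commute power2_eq_square algebra_simps)
    also have "\<dots> = 2 * \<tau> * (b - x \<bullet> e)" using \<tau> unfolding ee xx b_def by (simp add: field_simps)
    finally show "((\<tau> *\<^sub>R e - x) \<bullet> (\<tau> *\<^sub>R e - x)) powr (- p) * w x = (2 * \<tau>) powr (- p) * ((b - x \<bullet> e) powr (- p) * w x)"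
      using \<tau> b1 inner_bounds(2)[OF x] by (simp add: powr_mult)
  qed
  then have PP: "power_potential p w (\<tau> *\<^sub>R e) = (2 * \<tau>) powr (- p) * singular_integral p w b"
    by (simp add: singular_integral_def)
  have b2: "b\<^sup>2 - 1 = (s / (2 * \<tau>)) powr 2"
  proof -
    have "b\<^sup>2 - 1 = (s / (2 * \<tau>))\<^sup>2"
      using \<tau> by (simp add: b_def s_def power_divide divide_simps) (simp add: power2_eq_square algebra_simps)
    then show ?thesis using s \<tau> by simp
  qed
  have "(b\<^sup>2 - 1) powr \<sigma> = s powr (2 * \<sigma>) * (2 * \<tau>) powr (- (2 * \<sigma>))"
    unfolding b2 powr_powr using s \<tau> by (simp add: powr_divide powr_minus_divide)
  then have sp: "s powr (2 * \<sigma>) = (2 * \<tau>) powr (2 * \<sigma>) * (b\<^sup>2 - 1) powr \<sigma>"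
    using \<tau> by (simp add: powr_minus)
  have pe: "(real n + 2 * \<sigma>) / 2 = p" by (simp add: p_def add_divide_distrib)
  have pw: "(2 * \<tau>) powr (2 * \<sigma>) * (2 * \<tau>) powr (- p) = (2 * \<tau>) powr (\<sigma> - real n / 2)"
    by (simp add: p_def flip: powr_add)
  have "Q_op n \<sigma> w (\<tau> *\<^sub>R e) = 2 powr (- 2 * \<sigma>) * beta_const n \<sigma> * (s powr (2 * \<sigma>) * ((2 * \<tau>) powr (- p) * singular_integral p w b))"
    unfolding Q_op_eq_power_potential ns pe PP s_def ..
  also have "\<dots> = 2 powr (- 2 * \<sigma>) * beta_const n \<sigma> * (((2 * \<tau>) powr (2 * \<sigma>) * (2 * \<tau>) powr (- p)) * ((b\<^sup>2 - 1) powr \<sigma> * singular_integral p w b))"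
    unfolding sp by (simp only: mult_ac)
  finally show ?thesis unfolding pw unfolding scaled_singular_def b_def p_def .
qed

lemma filterlim_radial_parameter:
  "filterlim (\<lambda>\<tau>::real. (1 + \<tau>\<^sup>2) / (2 * \<tau>)) (at_right 1) (at_left 1)"
proof (rule tendsto_imp_filterlim_at_right)
  have "((\<lambda>\<tau>::real. (1 + \<tau>\<^sup>2) / (2 * \<tau>)) \<longlongrightarrow> (1 + 1\<^sup>2) / (2 * 1)) (at_left 1)" by (intro tendsto_intros) simp
  then show "((\<lambda>\<tau>::real. (1 + \<tau>\<^sup>2) / (2 * \<tau>)) \<longlongrightarrow> 1) (at_left 1)" by simp
  have "1 < (1 + \<tau>\<^sup>2) / (2 * \<tau>)" if "0 < \<tau>" "\<tau> < 1" for \<tau> :: real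
  proof -
    have "(1 - \<tau>)\<^sup>2 > 0" using that by simp
    then have "2 * \<tau> < 1 + \<tau>\<^sup>2" by (simp add: power2_eq_square algebra_simps)
    then show ?thesis using that by simp
  qed
  then show "\<forall>\<^sub>F \<tau> in at_left 1. 1 < (1 + \<tau>\<^sup>2) / (2 * (\<tau>::real))"
    by (intro eventually_at_leftI[of 0]) auto
qed

text \<open>Along the ray V / U is a quotient of functions of b, each with derivative (b^2 -
  1)^(\<sigma> - 1) times a quantity with a finite limit. The chain rule and the weight remove
  exactly this singular power. The limit is left unsimplified, with 2 * 1 and 1^2, as the term by
  term value at \<tau> = 1.\<close>

lemma conormal_derivative_limit:
  assumes \<sigma>: "0 < \<sigma>" "\<sigma> < 1" and S: "open S" "sphere 0 1 \<subseteq> S"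
    and u: "\<forall>k. Ck_on k S u" and u0: "\<And>x. x \<in> sphere 0 1 \<Longrightarrow> 0 < u x" and w: "\<forall>k. Ck_on k S w"
    and U: "U = Q_op n \<sigma> u" and V: "V = Q_op n \<sigma> w" and a: "a = (2 - 4 * \<sigma>) / (real n - 2 * \<sigma>)"
    and G: "G = conf_flat (\<lambda>y. U y powr (4 / (real n - 2 * \<sigma>)))" and \<alpha>: "\<alpha> = real n / 2 + \<sigma> - 1"
    and A: "A = 2 powr (real n / 2 - \<sigma>) * riesz_potential (real n / 2 - \<sigma>) (\<lambda>_. 1)"
  shows "has_conormal_deriv \<sigma> a U G (\<lambda>z. V z / U z) e
    (u e powr (- (4 * \<sigma> / (real n - 2 * \<sigma>))) * ((2 * 1) powr (2 - 2 * \<sigma>) / (2 * \<alpha> * 1\<^sup>2)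
      * ((2 powr \<alpha> * riesz_potential \<alpha> (conf_laplacian \<alpha> w) * (A * u e) - A * w e * (2 powr \<alpha> * riesz_potential \<alpha> (conf_laplacian \<alpha> u)))
         / (A * u e)\<^sup>2)))"
proof -
  have \<alpha>0: "\<alpha> > 0" "\<alpha> < real n / 2" "\<alpha> \<noteq> 0" using \<sigma> n2 by (auto simp: \<alpha>)
  have n\<sigma>: "real n - 2 * \<sigma> > 0" using \<sigma> n2 by auto
  have \<beta>: "beta_const n \<sigma> > 0" using beta_const_eq[of n \<sigma>] n2 \<sigma> by (simp add: Gamma_real_pos add_nonneg_pos)
  define c where "c = 2 powr (- 2 * \<sigma>) * beta_const n \<sigma>"
  have c: "c > 0" using \<beta> by (simp add: c_def)
  have cu: "continuous_on (sphere 0 1) u" "continuous_on (sphere 0 1) w"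
    using spec[OF u, of 0] spec[OF w, of 0] S(2) by (auto intro: continuous_on_subset)
  have Lap: "continuous_on (sphere 0 1) (conf_laplacian \<alpha> F)" if F: "\<forall>k. Ck_on k S F" for F
  proof -
    have "Ck_on 0 S (conf_laplacian \<alpha> F)"
      unfolding conf_laplacian_def[abs_def] using F S(1) by (intro Ck_on_diff Ck_on_cmult Ck_on_sphere_laplacian) blast+
    then show ?thesis using S(2) by (auto intro: continuous_on_subset)
  qed
  have es: "e \<in> sphere 0 1" using e by simp
  define b where "b \<tau> = (1 + \<tau>\<^sup>2) / (2 * \<tau>)" for \<tau> :: real
  define EU where "EU = scaled_singular \<sigma> u"
  define EV where "EV = scaled_singular \<sigma> w"
  define SU where "SU = singular_integral \<alpha> (conf_laplacian \<alpha> u)"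
  define SV where "SV = singular_integral \<alpha> (conf_laplacian \<alpha> w)"
  have Ur: "U (\<tau> *\<^sub>R e) = c * ((2 * \<tau>) powr (\<sigma> - real n / 2) * EU (b \<tau>))"
    "V (\<tau> *\<^sub>R e) = c * ((2 * \<tau>) powr (\<sigma> - real n / 2) * EV (b \<tau>))" if "0 < \<tau>" "\<tau> < 1" for \<tau>
    unfolding U V EU_def EV_def b_def c_def by (rule Q_op_radial[OF that])+
  have Up: "U y > 0" if "norm y < 1" for y unfolding U by (rule Q_op_pos[OF \<beta> cu(1) u0 that])
  have bb: "filterlim b (at_right 1) (at_left 1)" unfolding b_def by (rule filterlim_radial_parameter)
  have dE: "(scaled_singular \<sigma> F has_real_derivative (- ((b\<^sup>2 - 1) powr (\<sigma> - 1) / \<alpha>) * singular_integral \<alpha> (conf_laplacian \<alpha> F) b)) (at b)"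
    if "b > 1" "\<forall>k. Ck_on k S F" for b F
    unfolding conf_laplacian_def[abs_def] by (rule has_derivative_scaled_singular[OF that(1) S spec[OF that(2)] \<alpha> \<alpha>0(3)])
  have main: "(1 - (norm (\<tau> *\<^sub>R e))\<^sup>2) powr (1 - 2 * \<sigma>) * U (\<tau> *\<^sub>R e) powr a * radial_deriv G (\<lambda>z. V z / U z) (\<tau> *\<^sub>R e)
     = U (\<tau> *\<^sub>R e) powr (- (4 * \<sigma> / (real n - 2 * \<sigma>))) * ((2 * \<tau>) powr (2 - 2 * \<sigma>) / (2 * \<alpha> * \<tau>\<^sup>2)
       * ((SV (b \<tau>) * EU (b \<tau>) - EV (b \<tau>) * SU (b \<tau>)) / (EU (b \<tau>))\<^sup>2))" if \<tau>: "0 < \<tau>" "\<tau> < 1" for \<tau>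
  proof -
    define y where "y = \<tau> *\<^sub>R e"
    define f where "f z = V z / U z" for z
    define s where "s = 1 - \<tau>\<^sup>2"
    have s: "s > 0" using \<tau> by (simp add: s_def abs_square_less_1)
    have yn: "norm y < 1" using e \<tau> by (simp add: y_def)
    have Uy: "U y > 0" by (rule Up[OF yn])
    have b1: "b t > 1" if "0 < t" "t < 1" for t
    proof -
      have "(1 - t)\<^sup>2 > 0" using that by simp
      then have "2 * t < 1 + t\<^sup>2" by (simp add: power2_eq_square algebra_simps)
      then show ?thesis using that by (simp add: b_def)
    qed
    have EUp: "EU (b t) > 0" if t: "0 < t" "t < 1" for t
    proof -
      have "U (t *\<^sub>R e) > 0" using e t by (intro Up) auto
      then show ?thesis using c t unfolding Ur(1)[OF t] by (simp add: zero_less_mult_iff)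
    qed
    define D where "D = frechet_derivative f (at y)"
    have fD: "(f has_derivative D) (at y)"
    proof -
      have "V differentiable (at y)" "U differentiable (at y)" unfolding U V by (intro Q_op_differentiable(1) yn cu)+
      then have "f differentiable (at y)" unfolding f_def[abs_def] using Uy by (intro differentiable_divide) auto
      then show ?thesis by (simp add: D_def frechet_derivative_works)
    qed
    have 1: "((\<lambda>t. f (t *\<^sub>R e)) has_real_derivative D e) (at \<tau>)"
    proof -
      have "((\<lambda>t. f (t *\<^sub>R e)) has_derivative (\<lambda>h. D (h *\<^sub>R e))) (at \<tau>)"
        by (rule has_derivative_compose[where g=f and f="\<lambda>t. t *\<^sub>R e"]) (use fD in \<open>auto intro!: derivative_eq_intros simp: y_def\<close>)
      moreover have "D (h *\<^sub>R e) = D e * h" for h using linear_cmul[OF has_derivative_linear[OF fD], of h e] by simp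
      ultimately show ?thesis by (simp add: has_field_derivative_def)
    qed
    define B where "B = ((b \<tau>)\<^sup>2 - 1) powr (\<sigma> - 1)"
    define Q where "Q = (SV (b \<tau>) * EU (b \<tau>) - EV (b \<tau>) * SU (b \<tau>)) / (EU (b \<tau>))\<^sup>2"
    have db: "(b has_real_derivative (- s / (2 * \<tau>\<^sup>2))) (at \<tau>)"
      unfolding b_def[abs_def] s_def using \<tau>
      by (auto intro!: derivative_eq_intros simp: divide_simps) (simp add: power2_eq_square algebra_simps)
    have 2: "((\<lambda>t. EV (b t) / EU (b t)) has_real_derivative (B * s / (2 * \<alpha> * \<tau>\<^sup>2) * Q)) (at \<tau>)"
    proof -
      have dU: "((\<lambda>t. EU (b t)) has_real_derivative (- (B / \<alpha>) * SU (b \<tau>)) * (- s / (2 * \<tau>\<^sup>2))) (at \<tau>)"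
        unfolding EU_def SU_def B_def by (rule DERIV_chain2[OF dE[OF b1[OF \<tau>] u] db])
      have dV: "((\<lambda>t. EV (b t)) has_real_derivative (- (B / \<alpha>) * SV (b \<tau>)) * (- s / (2 * \<tau>\<^sup>2))) (at \<tau>)"
        unfolding EV_def SV_def B_def by (rule DERIV_chain2[OF dE[OF b1[OF \<tau>] w] db])
      have "EU (b \<tau>) \<noteq> 0" using EUp[OF \<tau>] by simp
      from DERIV_divide[OF dV dU this] show ?thesis
        by (rule DERIV_cong) (use \<alpha>0 \<tau> in \<open>simp add: Q_def field_simps power2_eq_square\<close>)
    qed
    have "((\<lambda>t. f (t *\<^sub>R e)) has_real_derivative (B * s / (2 * \<alpha> * \<tau>\<^sup>2) * Q)) (at \<tau>)"
    proof (rule has_field_derivative_transform_within_open[OF 2])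
      show "open {0<..<1::real}" "\<tau> \<in> {0<..<1}" using \<tau> by auto
      fix t :: real assume "t \<in> {0<..<1}"
      then have t: "0 < t" "t < 1" by auto
      have "(2 * t) powr (\<sigma> - real n / 2) > 0" using t by simp
      then show "EV (b t) / EU (b t) = f (t *\<^sub>R e)" unfolding f_def Ur[OF t] using c EUp[OF t] by simp
    qed
    from DERIV_unique[OF 1 this] have De: "D e = B * s / (2 * \<alpha> * \<tau>\<^sup>2) * Q" .
    define \<phi> where "\<phi> = U y powr (4 / (real n - 2 * \<sigma>))"
    have \<phi>: "\<phi> > 0" using Uy by (simp add: \<phi>_def)
    have ee: "e \<bullet> e = 1" using e by (simp add: dot_square_norm)
    have "G y y y = \<phi> * \<tau>\<^sup>2" unfolding G conf_flat_def y_def \<phi>_def by (simp add: ee power2_eq_square)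
    then have "sqrt (G y y y) = sqrt \<phi> * \<tau>" using \<tau> by (simp add: real_sqrt_mult)
    then have "(1 / sqrt (G y y y)) *\<^sub>R y = (1 / sqrt \<phi>) *\<^sub>R e" using \<tau> by (simp add: y_def)
    then have rd: "radial_deriv G (\<lambda>z. V z / U z) y = (1 / sqrt \<phi>) * D e"
      unfolding radial_deriv_def using linear_cmul[OF has_derivative_linear[OF fD], of "1 / sqrt \<phi>" e]
      by (simp add: D_def f_def[abs_def])
    \<comment> \<open>The exponents of s are 1 - 2 \<sigma> from the weight, 2 \<sigma> - 2 from
      (b^2 - 1)^(\<sigma> - 1) and 1 from the derivative of b; their sum is 0.\<close>
    have Ba: "s powr (1 - 2 * \<sigma>) * (B * s) = (2 * \<tau>) powr (2 - 2 * \<sigma>)"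
    proof -
      have "(b \<tau>)\<^sup>2 - 1 = (s / (2 * \<tau>))\<^sup>2"
        using \<tau> by (simp add: b_def s_def power_divide divide_simps) (simp add: power2_eq_square algebra_simps)
      also have "\<dots> = (s / (2 * \<tau>)) powr 2" using s \<tau> by simp
      finally have "B = (s / (2 * \<tau>)) powr (2 * (\<sigma> - 1))" unfolding B_def by (simp only: powr_powr)
      also have "\<dots> = s powr (2 * (\<sigma> - 1)) * (2 * \<tau>) powr (- (2 * (\<sigma> - 1)))"
        using s \<tau> by (simp only: powr_minus_divide) (simp add: powr_divide)
      finally have "s powr (1 - 2 * \<sigma>) * (B * s) = (s powr (1 - 2 * \<sigma>) * s powr (2 * (\<sigma> - 1)) * s powr 1) * (2 * \<tau>) powr (- (2 * (\<sigma> - 1)))"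
        using s by (simp only: mult_ac powr_one)
      also have "s powr (1 - 2 * \<sigma>) * s powr (2 * (\<sigma> - 1)) * s powr 1 = s powr 0"
        unfolding powr_add[symmetric] by (rule arg_cong[where f="\<lambda>z. s powr z"]) simp
      also have "- (2 * (\<sigma> - 1)) = 2 - 2 * \<sigma>" by simp
      finally show ?thesis using s by simp
    qed
    \<comment> \<open>The unit length normalisation contributes the exponent -2 / (n - 2 \<sigma>),
      which removes the constant 2 from the numerator of a.\<close>
    have Ua: "U y powr a * (1 / sqrt \<phi>) = U y powr (- (4 * \<sigma> / (real n - 2 * \<sigma>)))"
    proof -
      have "sqrt \<phi> = U y powr (4 / (real n - 2 * \<sigma>) * (1 / 2))" using \<phi> by (simp add: powr_half_sqrt[symmetric] \<phi>_def powr_powr)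
      then have "U y powr a * (1 / sqrt \<phi>) = U y powr (a + - (4 / (real n - 2 * \<sigma>) * (1 / 2)))"
        by (simp only: powr_add powr_minus_divide)
      also have "a + - (4 / (real n - 2 * \<sigma>) * (1 / 2)) = - (4 * \<sigma> / (real n - 2 * \<sigma>))"
      proof -
        have "(2 - 4 * \<sigma>) / d + - (4 / d * (1 / 2)) = - (4 * \<sigma> / d)" for d :: real
          by (simp add: diff_divide_distrib)
        then show ?thesis unfolding a .
      qed
      finally show ?thesis .
    qed
    have ns: "1 - (norm y)\<^sup>2 = s" using e \<tau> by (simp add: y_def s_def)
    have "(1 - (norm y)\<^sup>2) powr (1 - 2 * \<sigma>) * U y powr a * radial_deriv G (\<lambda>z. V z / U z) y
      = (U y powr a * (1 / sqrt \<phi>)) * ((s powr (1 - 2 * \<sigma>) * (B * s)) / (2 * \<alpha> * \<tau>\<^sup>2) * Q)"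
      unfolding rd De ns by (simp only: times_divide_eq_left times_divide_eq_right mult_ac)
    then show ?thesis unfolding Ba Ua unfolding Q_def y_def .
  qed
  have limE: "(EU \<longlongrightarrow> A * u e) (at_right 1)" "(EV \<longlongrightarrow> A * w e) (at_right 1)"
    unfolding EU_def EV_def A by (rule scaled_singular_tendsto[OF \<sigma>], rule cu)+
  have limS: "(SU \<longlongrightarrow> 2 powr \<alpha> * riesz_potential \<alpha> (conf_laplacian \<alpha> u)) (at_right 1)"
     "(SV \<longlongrightarrow> 2 powr \<alpha> * riesz_potential \<alpha> (conf_laplacian \<alpha> w)) (at_right 1)"
    unfolding SU_def SV_def by (rule singular_integral_tendsto[OF \<alpha>0(1,2)], rule Lap, rule u w)+
  note lims = limE[THEN filterlim_compose, OF bb] limS[THEN filterlim_compose, OF bb]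
  \<comment> \<open>The normalisation of the extension in the form it takes at \<tau> = 1; it turns
    the limit A u(e) into the boundary value u(e) of U.\<close>
  have norm1: "c * (2 powr (\<sigma> - real n / 2) * A) = 1"
  proof -
    have "2 powr (\<sigma> - real n / 2) * 2 powr (real n / 2 - \<sigma>) = (1::real)" by (simp flip: powr_add)
    then have "c * (2 powr (\<sigma> - real n / 2) * A) = c * riesz_potential (real n / 2 - \<sigma>) (\<lambda>_. 1)"
      unfolding A by (simp add: mult.assoc[symmetric])
    also have "\<dots> = 1" unfolding c_def by (rule Q_normalization[OF \<sigma>])
    finally show ?thesis .
  qed
  have A0: "A \<noteq> 0" using norm1 by auto
  have ue: "u e > 0" by (rule u0[OF es])
  have ev: "\<forall>\<^sub>F \<tau>::real in at_left 1. 0 < \<tau> \<and> \<tau> < 1" by (rule eventually_at_leftI[of 0]) auto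
  have limU: "((\<lambda>\<tau>. U (\<tau> *\<^sub>R e)) \<longlongrightarrow> u e) (at_left 1)"
  proof -
    have "((\<lambda>\<tau>. c * ((2 * \<tau>) powr (\<sigma> - real n / 2) * EU (b \<tau>))) \<longlongrightarrow> c * ((2 * 1) powr (\<sigma> - real n / 2) * (A * u e))) (at_left 1)"
      by (intro tendsto_intros lims) auto
    moreover have "c * ((2 * 1) powr (\<sigma> - real n / 2) * (A * u e)) = u e" using norm1 by (simp add: mult.assoc[symmetric])
    ultimately have "((\<lambda>\<tau>. c * ((2 * \<tau>) powr (\<sigma> - real n / 2) * EU (b \<tau>))) \<longlongrightarrow> u e) (at_left 1)" by (simp only:)
    then show ?thesis by (rule Lim_transform_eventually) (use ev in \<open>eventually_elim, simp add: Ur\<close>)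
  qed
  have "((\<lambda>\<tau>. U (\<tau> *\<^sub>R e) powr (- (4 * \<sigma> / (real n - 2 * \<sigma>))) * ((2 * \<tau>) powr (2 - 2 * \<sigma>) / (2 * \<alpha> * \<tau>\<^sup>2)
       * ((SV (b \<tau>) * EU (b \<tau>) - EV (b \<tau>) * SU (b \<tau>)) / (EU (b \<tau>))\<^sup>2))) \<longlongrightarrow>
     (u e powr (- (4 * \<sigma> / (real n - 2 * \<sigma>))) * ((2 * 1) powr (2 - 2 * \<sigma>) / (2 * \<alpha> * 1\<^sup>2)
      * ((2 powr \<alpha> * riesz_potential \<alpha> (conf_laplacian \<alpha> w) * (A * u e) - A * w e * (2 powr \<alpha> * riesz_potential \<alpha> (conf_laplacian \<alpha> u)))
         / (A * u e)\<^sup>2)))) (at_left 1)"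
    using \<alpha>0 A0 ue by (intro tendsto_intros lims limU) auto
  then show ?thesis unfolding has_conormal_deriv_def
    by (rule Lim_transform_eventually) (use ev in \<open>eventually_elim, simp only: main\<close>)
qed

end

theorem theorem2p1:
  fixes n :: nat and \<sigma> a :: real
    and u v U V :: "real ^ 'm::finite \<Rightarrow> real"
    and G :: "'m metric_tensor"
  assumes "n \<ge> 2" and "CARD('m) = n + 1"
    and "0 < \<sigma>" and "\<sigma> < 1"
    and "smooth_on_sphere u" and "\<forall>x\<in>sphere 0 1. 0 < u x"
    and "smooth_on_sphere v"
    and "U = Q_op n \<sigma> u"
    and "V = Q_op n \<sigma> (\<lambda>x. u x * v x)"
    and "a = (2 - 4 * \<sigma>) / (real n - 2 * \<sigma>)"
    and "G = conf_flat (\<lambda>y. U y powr (4 / (real n - 2 * \<sigma>)))"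
  shows "(\<forall>y\<in>ball 0 1.
            riem_div G (\<lambda>z. ((1 - (norm z)\<^sup>2) powr (1 - 2 * \<sigma>) * U z powr a)
                              *\<^sub>R riem_grad G (\<lambda>z. V z / U z) z) y = 0) \<and>
         (\<forall>x\<in>sphere 0 1. \<exists>L. has_conormal_deriv \<sigma> a U G (\<lambda>z. V z / U z) x L \<and>
            P_conf n \<sigma> u v x = 2 powr (2 * \<sigma> - 1) / N_const \<sigma> * L + R_conf n \<sigma> u x * v x)"
proof -
  have n\<sigma>: "real n - 2 * \<sigma> > 0" using assms(1,4) by auto
  have \<beta>: "beta_const n \<sigma> > 0" using beta_const_eq[of n \<sigma>] assms(1,3) by (simp add: Gamma_real_pos add_nonneg_pos)
  obtain S1 F where F: "open S1" "sphere 0 1 \<subseteq> S1" "\<forall>k. Ck_on k S1 F" "\<And>x. x \<in> sphere 0 1 \<Longrightarrow> F x = u x"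
    using assms(5) unfolding smooth_on_sphere_def by blast
  obtain S2 H where H: "open S2" "sphere 0 1 \<subseteq> S2" "\<forall>k. Ck_on k S2 H" "\<And>x. x \<in> sphere 0 1 \<Longrightarrow> H x = v x"
    using assms(7) unfolding smooth_on_sphere_def by blast
  \<comment> \<open>The smooth extensions of u and v live on different neighbourhoods; the
    intersection serves both and their product.\<close>
  define S where "S = S1 \<inter> S2"
  have S: "open S" "sphere 0 1 \<subseteq> S" using F H by (auto simp: S_def)
  have SF: "\<forall>k. Ck_on k S F" "\<forall>k. Ck_on k S H" using F(3) H(3) by (auto simp: S_def intro: Ck_on_subset)
  define W where "W x = F x * H x" for x
  have SW: "\<forall>k. Ck_on k S W" unfolding W_def using SF S(1) by (auto intro: Ck_on_mult)
  have Qcong: "Q_op n \<sigma> f = Q_op n \<sigma> g" if "\<And>x. x \<in> sphere 0 1 \<Longrightarrow> f x = g x" for f g :: "real^'m \<Rightarrow> real"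
    unfolding Q_op_def by (intro ext arg_cong2[where f="(*)"] refl Bochner_Integration.integral_cong) (use that in auto)
  have U: "U = Q_op n \<sigma> F" unfolding assms(8) by (rule Qcong) (simp add: F(4))
  have V: "V = Q_op n \<sigma> W" unfolding assms(9) by (rule Qcong) (simp add: F(4) H(4) W_def)
  have F0: "0 < F x" if "x \<in> sphere 0 1" for x using assms(6) F(4)[OF that] that by simp
  have cF: "continuous_on (sphere 0 1) F" "continuous_on (sphere 0 1) W"
    using spec[OF SF(1), of 0] spec[OF SW, of 0] S(2) by (auto intro: continuous_on_subset)
  have interior: "riem_div G (\<lambda>z. ((1 - (norm z)\<^sup>2) powr (1 - 2 * \<sigma>) * U z powr a) *\<^sub>R riem_grad G (\<lambda>z. V z / U z) z) y = 0"
    if "y \<in> ball 0 1" for y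
    by (rule divergence_equation[OF assms(2) n\<sigma> \<beta> cF(1) F0 cF(2) U V assms(10,11) that])
  have boundary: "\<exists>L. has_conormal_deriv \<sigma> a U G (\<lambda>z. V z / U z) x L \<and>
      P_conf n \<sigma> u v x = 2 powr (2 * \<sigma> - 1) / N_const \<sigma> * L + R_conf n \<sigma> u x * v x"
    if x: "x \<in> sphere 0 1" for x
  proof -
    interpret X: sphere_dim n x by unfold_locales (use assms(1,2) x in auto)
    define \<alpha> where "\<alpha> = real n / 2 + \<sigma> - 1"
    define A where "A = 2 powr (real n / 2 - \<sigma>) * X.riesz_potential (real n / 2 - \<sigma>) (\<lambda>_. 1)"
    define RU where "RU = X.riesz_potential \<alpha> (X.conf_laplacian \<alpha> F)"
    define RV where "RV = X.riesz_potential \<alpha> (X.conf_laplacian \<alpha> W)"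
    define N where "N = N_const \<sigma>"
    define B where "B = Beta \<alpha> (3 / 2 - \<sigma>)"
    define C where "C = X.\<omega> * Gamma (2 - 2 * \<sigma>)"
    define L where "L = F x powr (- (4 * \<sigma> / (real n - 2 * \<sigma>))) * ((2 * 1) powr (2 - 2 * \<sigma>) / (2 * \<alpha> * 1\<^sup>2)
      * ((2 powr \<alpha> * RV * (A * F x) - A * W x * (2 powr \<alpha> * RU)) / (A * F x)\<^sup>2))"
    have L: "has_conormal_deriv \<sigma> a U G (\<lambda>z. V z / U z) x L"
      unfolding L_def RU_def RV_def
      by (rule X.conormal_derivative_limit[OF assms(3,4) S SF(1) F0 SW U V assms(10,11) \<alpha>_def A_def])
    have PV: "P_op n \<sigma> (\<lambda>z. u z * v z) x * C = B * RV"
      unfolding C_def B_def RV_def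
      by (rule X.P_op_eq_riesz_potential[OF assms(3,4) S SW _ \<alpha>_def]) (simp add: W_def F(4) H(4))
    have PU: "P_op n \<sigma> (\<lambda>z. u z * 1) x * C = B * RU"
      unfolding C_def B_def RU_def
      by (rule X.P_op_eq_riesz_potential[OF assms(3,4) S SF(1) _ \<alpha>_def]) (simp add: F(4))
    \<comment> \<open>With both operators expressed through Riesz potentials, this identity carries
      all the constants.\<close>
    have const: "2 powr \<alpha> * C = N * \<alpha> * A * B"
      using X.conormal_constant[OF assms(3,4) \<alpha>_def] unfolding C_def N_def A_def B_def .
    have \<alpha>0: "\<alpha> > 0" using assms(1,3) by (simp add: \<alpha>_def)
    have A0: "A \<noteq> 0" using X.Q_normalization[OF assms(3,4)] by (auto simp: A_def)
    have N0: "N > 0" using assms(3,4) by (simp add: N_def N_const_def Gamma_real_pos)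
    have C0: "C > 0" using assms(4) X.\<omega>_pos by (simp add: C_def Gamma_real_pos)
    have u0: "u x > 0" using assms(6) x by blast
    define q where "q = u x powr (- ((real n + 2 * \<sigma>) / (real n - 2 * \<sigma>)))"
    \<comment> \<open>The power of u in the limit is the conformal factor of \<open>P_conf\<close>
      times one more u, which cancels together with the square in the denominator.\<close>
    have q: "u x powr (- (4 * \<sigma> / (real n - 2 * \<sigma>))) = q * u x"
    proof -
      have "- (4 * \<sigma> / (real n - 2 * \<sigma>)) = - ((real n + 2 * \<sigma>) / (real n - 2 * \<sigma>)) + 1"
        using n\<sigma> by (simp add: field_simps)
      then show ?thesis using u0 by (simp only: powr_add q_def powr_one)
    qed
    define t where "t = (2 powr (2 * \<sigma> - 1) :: real)"
    have t: "2 powr (2 - 2 * \<sigma>) = 2 / t" "t > 0"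
      unfolding t_def by (simp_all add: powr_diff field_simps)
    have FW: "F x = u x" "W x = u x * v x" using F(4)[OF x] H(4)[OF x] by (simp_all add: W_def)
    \<comment> \<open>As W = u v on the sphere, the numerator of the limit is a multiple of u (RV -
      v RU). The second term is therefore v times the Riesz potential belonging to u alone, that is,
      to \<open>R_conf\<close>.\<close>
    have "t / N * L = q * (2 powr \<alpha> / (N * \<alpha> * A)) * (RV - v x * RU)"
      unfolding L_def FW q mult_1_right t(1) using t(2) u0 \<alpha>0 N0 A0 by (simp add: field_simps power2_eq_square)
    also have "2 powr \<alpha> / (N * \<alpha> * A) = B / C"
      using const \<alpha>0 N0 A0 C0 by (simp add: field_simps)
    also have "q * (B / C) * (RV - v x * RU) = q * (B * RV / C) - q * (B * RU / C) * v x"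
      using C0 by (simp add: field_simps)
    also have "\<dots> = P_conf n \<sigma> u v x - R_conf n \<sigma> u x * v x"
      unfolding PV[symmetric] PU[symmetric] R_conf_def P_conf_def q_def using C0 by simp
    finally show ?thesis using L unfolding t_def N_def by (intro exI[of _ L]) simp
  qed
  show ?thesis using interior boundary by blast
qed

end
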